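(* Let $n\ge 3$, let $a<b$ be real numbers, and let $W\in C^2(\mathbb{R})$ be a potential such that $W'(a)=W'(b)=0$, $W'<0$ on $(a,b)$, and such that for some $\delta>0$ and some $p\ge\frac{n+2}{n-2}$ the function $t\mapsto \frac{W'(t)}{|t-b|^p}$ is Hölder continuous on $[b-\delta,b]$ (i.e. it extends from $[b-\delta,b)$ to a Hölder continuous function on $[b-\delta,b]$). Let $u:\mathbb{R}^n\to\mathbb{R}$ be a $C^2$ solution to $\Delta u=W'(u)$ in $\mathbb{R}^n$ such that $u<b$ in $\mathbb{R}^n$ and $\lim_{|x|\to\infty}u(x)=b$. Then $u$ is radially symmetric.
   Context: "Radially symmetric" means radially symmetric about some point: there exist $x_0\in\mathbb{R}^n$ and a function $v:[0,\infty)\to\mathbb{R}$ such that $u(x)=v(|x-x_0|)$ for all $x\in\mathbb{R}^n$. *)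

theory Defs
  imports "HOL-Analysis.Analysis"
begin

definition partial_deriv :: "'a::euclidean_space \<Rightarrow> ('a \<Rightarrow> real) \<Rightarrow> 'a \<Rightarrow> real" where
  "partial_deriv i f x = deriv (\<lambda>t. f (x + t *\<^sub>R i)) 0"

text \<open>On the real line the only basis vector is 1, and the partial derivative along it is the
  ordinary derivative.\<close>

lemma partial_deriv_real: "partial_deriv 1 f = deriv (f :: real \<Rightarrow> real)"
proof
  fix x :: real
  have "((\<lambda>t. f (x + t)) has_real_derivative D) (at 0) \<longleftrightarrow> (f has_real_derivative D) (at x)" for D
    using DERIV_at_within_shift[of f D x 0 UNIV] by simp
  then show "partial_deriv 1 f x = deriv f x"
    by (simp add: partial_deriv_def deriv_def)
qed

definition C1 :: "('a::euclidean_space \<Rightarrow> real) \<Rightarrow> bool" where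
  "C1 f \<longleftrightarrow> f differentiable_on UNIV \<and> (\<forall>i\<in>Basis. continuous_on UNIV (partial_deriv i f))"

definition C2 :: "('a::euclidean_space \<Rightarrow> real) \<Rightarrow> bool" where
  "C2 f \<longleftrightarrow> C1 f \<and> (\<forall>i\<in>Basis. C1 (partial_deriv i f))"

lemma C2_real_iff:
  fixes f :: "real \<Rightarrow> real"
  shows "C2 f \<longleftrightarrow> f differentiable_on UNIV \<and> deriv f differentiable_on UNIV
    \<and> continuous_on UNIV (deriv (deriv f))"
  by (auto simp: C2_def C1_def partial_deriv_real differentiable_imp_continuous_on)

definition laplacian :: "('a::euclidean_space \<Rightarrow> real) \<Rightarrow> 'a \<Rightarrow> real" where
  "laplacian f x = (\<Sum>i\<in>Basis. partial_deriv i (partial_deriv i f) x)"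

definition hoelder_continuous_on :: "'a::metric_space set \<Rightarrow> ('a \<Rightarrow> 'b::metric_space) \<Rightarrow> bool" where
  "hoelder_continuous_on S f \<longleftrightarrow>
    (\<exists>\<alpha> C. 0 < \<alpha> \<and> \<alpha> \<le> 1 \<and> (\<forall>x\<in>S. \<forall>y\<in>S. dist (f x) (f y) \<le> C * dist x y powr \<alpha>))"

text \<open>The profile is total on the reals, but only its values on nonnegative arguments matter.\<close>

definition radially_symmetric :: "('a::real_normed_vector \<Rightarrow> real) \<Rightarrow> bool" where
  "radially_symmetric u \<longleftrightarrow> (\<exists>x\<^sub>0. \<exists>v :: real \<Rightarrow> real. \<forall>x. u x = v (norm (x - x\<^sub>0)))"

end

theory Submission
  imports Defs
begin

text \<open>
  Put \<open>w = b - u\<close>, which is positive, tends to \<open>0\<close> at infinity and is subharmonic outside a ball.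
  Comparison with \<open>|x|\<^bsup>2 - n\<^esup>\<close> gives the decay rate of \<open>w\<close>, and the condition on \<open>p\<close>
  then yields \<open>\<Delta> w = O(|x|\<^bsup>- n - 2\<^esup>)\<close>. Hence \<open>w\<close> is a Newtonian potential, and it has an
  expansion at infinity with a monopole and a dipole term; the monopole coefficient is positive and
  the dipole is removed by moving the origin to the centre of mass of \<open>- \<Delta> w\<close>.
  The nonlinearity need not be monotone near \<open>b\<close>, so no maximum principle is available near infinity.
  Instead the expansion, with a Lipschitz estimate of its remainder, shows directly that reflection
  in any plane at distance at least \<open>\<lambda> > 0\<close> from the centre decreases \<open>w\<close> outside a fixed ball.
  The moving plane method then only needs maximum principles on compact sets, and the planes can be
  moved up to the centre from every direction.
\<close>

section \<open>Hessians and Laplacians\<close>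

text \<open>The threshold for p is what the asymptotics ask for: w = O(|x|^(2 - n)) turns w^p into
  O(|x|^(- n - 2)), a density with finite moments of every order below 2. The moment of order 3/2
  gives an expansion whose remainder is smaller than the monopole by |x|^(- 3/2). The dipole is
  smaller by only |x|^(- 1), so after centring half a power of |x| is left over to beat all
  constants far out. Reflecting a point x at distance d from the plane gains only about d |x|^(- n),
  which vanishes as x approaches the plane. A pointwise bound of the remainder cannot compete with
  that near the plane. Hence the kernel estimates are made for the difference between two points x
  and x', and each carries a factor |x - x'|. The singular kernel is never integrated against the
  density. The potential is kept as a limit of integrals with the regularised kernel, the difference
  estimates are uniform in \<epsilon>, and \<epsilon> tends to 0 only in the finished
  inequality.\<close>

definition lin_trace :: "('a::euclidean_space \<Rightarrow> 'a) \<Rightarrow> real" where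
  "lin_trace A = (\<Sum>i\<in>Basis. A i \<bullet> i)"

text \<open>Gradient and Hessian are explicit arguments, so sums, multiples, shifts and reflections
  of functions carry their Laplacian \<open>lin_trace (H x)\<close> along by the chain rule.\<close>

definition has_hessian ::
    "('a::euclidean_space \<Rightarrow> real) \<Rightarrow> ('a \<Rightarrow> 'a) \<Rightarrow> ('a \<Rightarrow> 'a \<Rightarrow> 'a) \<Rightarrow> 'a set \<Rightarrow> bool" where
  "has_hessian f g H S \<longleftrightarrow>
     (\<forall>x\<in>S. (f has_derivative (\<lambda>h. g x \<bullet> h)) (at x) \<and> (g has_derivative H x) (at x))"

lemma partial_deriv_eqI:
  assumes "(f has_derivative D) (at x)"
  shows "partial_deriv i f x = D i"
proof -
  interpret bounded_linear D by (rule has_derivative_bounded_linear[OF assms])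
  have "((\<lambda>t. f (x + t *\<^sub>R i)) has_derivative (\<lambda>t. D (t *\<^sub>R i))) (at 0)"
    using assms by (intro has_derivative_compose[of "\<lambda>t. x + t *\<^sub>R i" _ 0 UNIV f, simplified])
      (auto intro!: derivative_eq_intros)
  then have "((\<lambda>t. f (x + t *\<^sub>R i)) has_real_derivative D i) (at 0)"
    by (simp add: has_field_derivative_def scaleR mult.commute[of _ "D i"])
  then show ?thesis unfolding partial_deriv_def by (rule DERIV_imp_deriv)
qed

lemma has_derivative_partials:
  assumes "f differentiable (at (x::'a::euclidean_space))"
  shows "(f has_derivative (\<lambda>h. \<Sum>j\<in>Basis. (h \<bullet> j) * partial_deriv j f x)) (at x)"
proof -
  obtain D where D: "(f has_derivative D) (at x)" using assms by (auto simp: differentiable_def)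
  interpret bounded_linear D by (rule has_derivative_bounded_linear[OF D])
  have "D = (\<lambda>h. \<Sum>j\<in>Basis. (h \<bullet> j) * partial_deriv j f x)"
  proof
    fix h
    have "D h = D (\<Sum>j\<in>Basis. (h \<bullet> j) *\<^sub>R j)" by (simp add: euclidean_representation)
    also have "\<dots> = (\<Sum>j\<in>Basis. (h \<bullet> j) * D j)" by (simp add: sum scaleR)
    finally show "D h = (\<Sum>j\<in>Basis. (h \<bullet> j) * partial_deriv j f x)"
      by (simp add: partial_deriv_eqI[OF D])
  qed
  then show ?thesis using D by simp
qed

text \<open>\<open>C1\<close> contains total differentiability, so the gradient assembled from the
  partial derivatives is differentiable componentwise. Continuity is exported for the diagonal of
  the Hessian, which is what Green's identity and the continuity of the trace rest on.\<close>

lemma C2_has_hessian: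
  fixes u :: "'a::euclidean_space \<Rightarrow> real"
  assumes "C2 u"
  obtains g H where "has_hessian u g H UNIV" "\<And>x. laplacian u x = lin_trace (H x)"
    "\<And>i. i \<in> Basis \<Longrightarrow> continuous_on UNIV (\<lambda>x. H x i \<bullet> i)"
proof -
  define g where "g x = (\<Sum>j\<in>Basis. partial_deriv j u x *\<^sub>R j)" for x
  define H where "H x h = (\<Sum>j\<in>Basis. (\<Sum>k\<in>Basis. (h \<bullet> k) * partial_deriv k (partial_deriv j u) x) *\<^sub>R j)" for x h
  have d0: "u differentiable (at x)" and d1: "j \<in> Basis \<Longrightarrow> partial_deriv j u differentiable (at x)"
    and c: "j \<in> Basis \<Longrightarrow> continuous_on UNIV (partial_deriv j (partial_deriv j u))" for x j
    using assms by (auto simp: C2_def C1_def differentiable_on_def)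
  have g: "(u has_derivative (\<lambda>h. g x \<bullet> h)) (at x)" for x
  proof -
    have "g x \<bullet> h = (\<Sum>j\<in>Basis. (h \<bullet> j) * partial_deriv j u x)" for h
      unfolding g_def inner_sum_left by (intro sum.cong) (auto simp: inner_commute)
    then show ?thesis using has_derivative_partials[OF d0, of x] by simp
  qed
  have H: "(g has_derivative H x) (at x)" for x
    unfolding g_def[abs_def] H_def
    by (rule has_derivative_sum) (intro has_derivative_scaleR_left has_derivative_partials d1)
  have Hii: "H x i \<bullet> i = partial_deriv i (partial_deriv i u) x" if "i \<in> Basis" for x i
    using that by (simp add: H_def inner_Basis inner_sum_left if_distrib if_distribR sum.delta cong: if_cong)
  show ?thesis
  proof (rule that)
    show "has_hessian u g H UNIV" using g H by (simp add: has_hessian_def)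
    show "laplacian u x = lin_trace (H x)" for x by (simp add: laplacian_def lin_trace_def Hii)
    show "continuous_on UNIV (\<lambda>x. H x i \<bullet> i)" if "i \<in> Basis" for i
      using c[OF that] by (simp add: Hii[OF that])
  qed
qed

lemma has_hessian_subset: "has_hessian f g H S \<Longrightarrow> T \<subseteq> S \<Longrightarrow> has_hessian f g H T"
  by (auto simp: has_hessian_def)

lemma has_hessian_continuous_on: "has_hessian f g H S \<Longrightarrow> continuous_on S f"
  by (auto simp: has_hessian_def intro!: continuous_at_imp_continuous_on has_derivative_continuous)

lemma has_hessian_add:
  "has_hessian f g H S \<Longrightarrow> has_hessian f' g' H' S \<Longrightarrow>
    has_hessian (\<lambda>x. f x + f' x) (\<lambda>x. g x + g' x) (\<lambda>x h. H x h + H' x h) S"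
  by (auto simp: has_hessian_def inner_add_left intro!: derivative_intros)

lemma has_hessian_cmult:
  "has_hessian f g H S \<Longrightarrow> has_hessian (\<lambda>x. c * f x) (\<lambda>x. c *\<^sub>R g x) (\<lambda>x h. c *\<^sub>R H x h) S"
  by (auto simp: has_hessian_def intro!: derivative_intros)

lemma has_hessian_diff:
  "has_hessian f g H S \<Longrightarrow> has_hessian f' g' H' S \<Longrightarrow>
    has_hessian (\<lambda>x. f x - f' x) (\<lambda>x. g x - g' x) (\<lambda>x h. H x h - H' x h) S"
  by (auto simp: has_hessian_def inner_diff_left intro!: derivative_intros)

lemma has_hessian_const: "has_hessian (\<lambda>_. c) (\<lambda>_. 0) (\<lambda>_ _. 0) S"
  by (auto simp: has_hessian_def)

lemma lin_trace_add: "lin_trace (\<lambda>h. A h + B h) = lin_trace A + lin_trace B"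
  by (simp add: lin_trace_def inner_add_left sum.distrib)

lemma lin_trace_diff: "lin_trace (\<lambda>h. A h - B h) = lin_trace A - lin_trace B"
  by (simp add: lin_trace_def inner_diff_left sum_subtractf)

lemma lin_trace_cmult: "lin_trace (\<lambda>h. c *\<^sub>R A h) = c * lin_trace A"
  by (simp add: lin_trace_def sum_distrib_left)

lemma lin_trace_zero: "lin_trace (\<lambda>h. 0) = 0"
  by (simp add: lin_trace_def)

lemma has_hessian_line:
  assumes "has_hessian f g H S" "x + t *\<^sub>R v \<in> S"
  shows "((\<lambda>t. f (x + t *\<^sub>R v)) has_real_derivative (g (x + t *\<^sub>R v) \<bullet> v)) (at t)"
    and "((\<lambda>t. g (x + t *\<^sub>R v) \<bullet> v) has_real_derivative (H (x + t *\<^sub>R v) v \<bullet> v)) (at t)"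
proof -
  have l: "((\<lambda>t. x + t *\<^sub>R v) has_derivative (\<lambda>t. t *\<^sub>R v)) (at t)" for t
    by (auto intro!: derivative_eq_intros)
  have f: "(f has_derivative (\<lambda>h. g (x + t *\<^sub>R v) \<bullet> h)) (at (x + t *\<^sub>R v))"
    and g: "(g has_derivative H (x + t *\<^sub>R v)) (at (x + t *\<^sub>R v))"
    using assms by (auto simp: has_hessian_def)
  show "((\<lambda>t. f (x + t *\<^sub>R v)) has_real_derivative (g (x + t *\<^sub>R v) \<bullet> v)) (at t)"
    using has_derivative_compose[OF l f] by (simp add: has_field_derivative_def mult_commute_abs)
  interpret bounded_linear "H (x + t *\<^sub>R v)" by (rule has_derivative_bounded_linear[OF g])
  show "((\<lambda>t. g (x + t *\<^sub>R v) \<bullet> v) has_real_derivative (H (x + t *\<^sub>R v) v \<bullet> v)) (at t)"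
    using has_derivative_inner_left[OF has_derivative_compose[OF l g], of v]
    by (simp add: has_field_derivative_def scaleR mult.commute[of _ "_ \<bullet> _"])
qed

text \<open>Second derivative test in each coordinate direction: a negative second derivative would
  make the first derivative negative just past the minimum, and the mean value theorem would then
  produce a smaller value.\<close>

lemma local_min_lin_trace:
  assumes h: "has_hessian f g H S" and S: "open S" "x \<in> S" and min: "\<And>y. y \<in> S \<Longrightarrow> f x \<le> f y"
  shows "lin_trace (H x) \<ge> 0"
proof -
  obtain d where d: "d > 0" "ball x d \<subseteq> S" using S by (auto simp: open_contains_ball)
  have "H x v \<bullet> v \<ge> 0" if v: "v \<in> Basis" for v
  proof (rule ccontr)
    assume neg: "\<not> ?thesis"
    have inS: "x + t *\<^sub>R v \<in> S" if "\<bar>t\<bar> < d" for t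
      using d that v by (auto simp: dist_norm subset_eq)
    define \<phi> where "\<phi> t = f (x + t *\<^sub>R v)" for t
    define \<psi> where "\<psi> t = g (x + t *\<^sub>R v) \<bullet> v" for t
    have \<phi>: "(\<phi> has_real_derivative \<psi> t) (at t)" if "\<bar>t\<bar> < d" for t
      unfolding \<phi>_def[abs_def] \<psi>_def using h inS[OF that] by (rule has_hessian_line)
    have \<psi>: "(\<psi> has_real_derivative H x v \<bullet> v) (at 0)"
      using has_hessian_line(2)[OF h inS[of 0]] d(1) unfolding \<psi>_def[abs_def] by simp
    have min0: "\<phi> 0 \<le> \<phi> t" if "\<bar>t\<bar> < d" for t
      using min[OF inS[OF that]] by (simp add: \<phi>_def)
    have "\<psi> 0 = 0"
      by (rule DERIV_local_min[OF \<phi> d(1)]) (use d min0 in auto)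
    moreover obtain e where e: "e > 0" "\<And>s. 0 < s \<Longrightarrow> s < e \<Longrightarrow> \<psi> (0 + s) < \<psi> 0"
      using DERIV_neg_dec_right[OF \<psi>] neg by (meson not_le)
    ultimately have \<psi>neg: "\<psi> s < 0" if "0 < s" "s < e" for s using that by force
    define s where "s = min d e / 2"
    have s: "0 < s" "s < d" "s < e" using d e by (auto simp: s_def)
    obtain z where z: "0 < z" "z < s" "\<phi> s - \<phi> 0 = (s - 0) * \<psi> z"
      using MVT2[OF s(1), of \<phi> \<psi>] \<phi> s by (auto)
    then have "\<phi> s < \<phi> 0" using \<psi>neg[of z] s by (smt (verit) mult_pos_neg)
    then show False using min0[of s] s by auto
  qed
  then show ?thesis unfolding lin_trace_def by (auto intro: sum_nonneg)
qed

text \<open>Radial functions are written in the squared distance, which is smooth through the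
  centre, so kernels and barriers need no case distinction there.\<close>

lemma has_hessian_radial:
  assumes F: "\<And>y. y \<in> S \<Longrightarrow> (F has_real_derivative F' ((y - c) \<bullet> (y - c))) (at ((y - c) \<bullet> (y - c)))"
    and F': "\<And>y. y \<in> S \<Longrightarrow> (F' has_real_derivative F'' ((y - c) \<bullet> (y - c))) (at ((y - c) \<bullet> (y - c)))"
  shows "has_hessian (\<lambda>y. F ((y - c) \<bullet> (y - c))) (\<lambda>y. (2 * F' ((y - c) \<bullet> (y - c))) *\<^sub>R (y - c))
    (\<lambda>y h. (2 * F' ((y - c) \<bullet> (y - c))) *\<^sub>R h + (4 * F'' ((y - c) \<bullet> (y - c)) * ((y - c) \<bullet> h)) *\<^sub>R (y - c)) S"
proof -
  have q: "((\<lambda>y. (y - c) \<bullet> (y - c)) has_derivative (\<lambda>h. 2 * ((y - c) \<bullet> h))) (at y)" for y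
    by (auto intro!: derivative_eq_intros simp: inner_commute)
  show ?thesis
    unfolding has_hessian_def
  proof (intro ballI conjI)
    fix y assume y: "y \<in> S"
    show "((\<lambda>y. F ((y - c) \<bullet> (y - c))) has_derivative (\<lambda>h. (2 * F' ((y - c) \<bullet> (y - c))) *\<^sub>R (y - c) \<bullet> h)) (at y)"
      using has_derivative_compose[OF q F[OF y, THEN has_field_derivative_imp_has_derivative]]
      by (simp add: algebra_simps)
    have "((\<lambda>y. F' ((y - c) \<bullet> (y - c))) has_derivative (\<lambda>h. F'' ((y - c) \<bullet> (y - c)) * (2 * ((y - c) \<bullet> h)))) (at y)"
      using has_derivative_compose[OF q F'[OF y, THEN has_field_derivative_imp_has_derivative]] .
    then have "((\<lambda>y. (2 * F' ((y - c) \<bullet> (y - c))) *\<^sub>R (y - c)) has_derivative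
       (\<lambda>h. (2 * F' ((y - c) \<bullet> (y - c))) *\<^sub>R h + (2 * (F'' ((y - c) \<bullet> (y - c)) * (2 * ((y - c) \<bullet> h)))) *\<^sub>R (y - c))) (at y)"
      by (intro derivative_eq_intros) (auto simp: )
    then show "((\<lambda>y. (2 * F' ((y - c) \<bullet> (y - c))) *\<^sub>R (y - c)) has_derivative
       (\<lambda>h. (2 * F' ((y - c) \<bullet> (y - c))) *\<^sub>R h + (4 * F'' ((y - c) \<bullet> (y - c)) * ((y - c) \<bullet> h)) *\<^sub>R (y - c))) (at y)"
      by (simp add: algebra_simps)
  qed
qed

lemma sum_Basis_inner_mult: "(\<Sum>i\<in>Basis. (x \<bullet> i) * (y \<bullet> i)) = x \<bullet> (y::'a::euclidean_space)"
  by (rule euclidean_inner[symmetric])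

lemma lin_trace_radial:
  "lin_trace (\<lambda>h. a *\<^sub>R h + (b * (x \<bullet> h)) *\<^sub>R x) = real DIM('a) * a + b * (x \<bullet> (x::'a::euclidean_space))"
proof -
  have "lin_trace (\<lambda>h. a *\<^sub>R h + (b * (x \<bullet> h)) *\<^sub>R x) = (\<Sum>i\<in>(Basis::'a set). a + b * ((x \<bullet> i) * (x \<bullet> i)))"
    unfolding lin_trace_def by (intro sum.cong) (auto simp: inner_add_left)
  also have "\<dots> = real DIM('a) * a + b * (x \<bullet> x)"
    by (simp add: sum.distrib sum_distrib_left[symmetric] sum_Basis_inner_mult)
  finally show ?thesis .
qed

section \<open>Reflections in hyperplanes and invariance of the Laplacian\<close>

definition refl_vec :: "'a::euclidean_space \<Rightarrow> 'a \<Rightarrow> 'a" where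
  "refl_vec e h = h - (2 * (h \<bullet> e)) *\<^sub>R e"

definition refl_plane :: "'a::euclidean_space \<Rightarrow> real \<Rightarrow> 'a \<Rightarrow> 'a" where
  "refl_plane e \<mu> x = x + (2 * (\<mu> - x \<bullet> e)) *\<^sub>R e"

text \<open>Invariance of the trace under conjugation by an orthogonal involution. Expanding in the
  fixed basis leaves corrections - 2, - 2 and + 4 times \<open>A e \<bullet> e\<close>, which cancel
  because e is a unit vector.\<close>

lemma lin_trace_refl:
  assumes "linear A" "norm e = 1"
  shows "lin_trace (\<lambda>h. refl_vec e (A (refl_vec e h))) = lin_trace A"
proof -
  interpret linear A by fact
  have ee: "e \<bullet> e = 1" using assms(2) by (simp add: norm_eq_1)
  have adj: "refl_vec e x \<bullet> y = x \<bullet> refl_vec e y" for x y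
    by (simp add: refl_vec_def inner_diff_left inner_diff_right inner_commute)
  have "A (refl_vec e i) \<bullet> refl_vec e i = A i \<bullet> i - 2 * ((e \<bullet> i) * (A e \<bullet> i)) - 2 * ((A i \<bullet> e) * (e \<bullet> i))
      + 4 * (A e \<bullet> e) * ((e \<bullet> i) * (e \<bullet> i))" for i
    by (simp add: refl_vec_def diff scaleR inner_diff_left inner_diff_right algebra_simps inner_commute)
  moreover have "(\<Sum>i\<in>Basis. (A i \<bullet> e) * (e \<bullet> i)) = A e \<bullet> e"
  proof -
    have "A e \<bullet> e = A (\<Sum>i\<in>Basis. (e \<bullet> i) *\<^sub>R i) \<bullet> e" by (simp add: euclidean_representation)
    also have "\<dots> = (\<Sum>i\<in>Basis. (A i \<bullet> e) * (e \<bullet> i))"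
      by (simp add: sum scaleR inner_sum_left mult.commute)
    finally show ?thesis ..
  qed
  ultimately have "(\<Sum>i\<in>Basis. A (refl_vec e i) \<bullet> refl_vec e i) = lin_trace A"
    by (simp add: sum.distrib sum_subtractf sum_distrib_left[symmetric] sum_Basis_inner_mult ee
        lin_trace_def inner_commute[of e "A e"])
  then show ?thesis by (simp add: lin_trace_def adj)
qed

lemma has_hessian_refl:
  assumes h: "has_hessian f g H UNIV"
  shows "has_hessian (\<lambda>x. f (refl_plane e \<mu> x)) (\<lambda>x. refl_vec e (g (refl_plane e \<mu> x)))
    (\<lambda>x h. refl_vec e (H (refl_plane e \<mu> x) (refl_vec e h))) S"
proof -
  have r: "(refl_plane e \<mu> has_derivative refl_vec e) (at x)" for x
    unfolding refl_plane_def[abs_def] refl_vec_def[abs_def]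
    by (auto intro!: derivative_eq_intros simp: algebra_simps)
  have bl: "bounded_linear (refl_vec e)" by (rule has_derivative_bounded_linear[OF r])
  have adj: "refl_vec e x \<bullet> y = x \<bullet> refl_vec e y" for x y
    by (simp add: refl_vec_def inner_diff_left inner_diff_right inner_commute)
  have f: "(f has_derivative (\<lambda>h. g x \<bullet> h)) (at x)" and g: "(g has_derivative H x) (at x)" for x
    using h by (auto simp: has_hessian_def)
  have eq: "(\<lambda>h. g y \<bullet> refl_vec e h) = (\<lambda>h. refl_vec e (g y) \<bullet> h)" for y by (simp add: adj)
  show ?thesis
    unfolding has_hessian_def
    using has_derivative_compose[OF r f, unfolded eq] has_derivative_compose[OF r g, THEN bounded_linear.has_derivative[OF bl]]
    by auto
qed

lemma has_hessian_shift:
  assumes "has_hessian f g H UNIV"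
  shows "has_hessian (\<lambda>x. f (c + x)) (\<lambda>x. g (c + x)) (\<lambda>x. H (c + x)) S"
proof -
  have r: "((\<lambda>x. c + x) has_derivative (\<lambda>h. h)) (at x)" for x by (auto intro!: derivative_eq_intros)
  have f: "(f has_derivative (\<lambda>h. g x \<bullet> h)) (at x)" and g: "(g has_derivative H x) (at x)" for x
    using assms by (auto simp: has_hessian_def)
  show ?thesis
    unfolding has_hessian_def using has_derivative_compose[OF r f] has_derivative_compose[OF r g] by auto
qed

lemma has_hessian_linear:
  assumes "has_hessian f g H S" "x \<in> S" shows "linear (H x)"
  using assms by (auto simp: has_hessian_def intro: has_derivative_linear)

text \<open>The limit 0 at infinity forces a negative infimum to be attained, and the boundary
  values push it off the sphere. The Laplacian is controlled only where f < 0, so that a comparison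
  of w with a barrier may use the inequality between them inside the differential
  inequality.\<close>

lemma exterior_max_principle:
  fixes f :: "'a::euclidean_space \<Rightarrow> real"
  assumes h: "has_hessian f g H {x. norm x > R}" and c: "continuous_on {x. norm x \<ge> R} f"
    and lim: "(f \<longlongrightarrow> 0) at_infinity" and bd: "\<And>x. norm x = R \<Longrightarrow> f x \<ge> 0"
    and pos: "\<And>x. norm x > R \<Longrightarrow> f x < 0 \<Longrightarrow> lin_trace (H x) < 0"
    and x: "norm x \<ge> R"
  shows "f x \<ge> 0"
proof (rule ccontr)
  assume "\<not> f x \<ge> 0"
  then have neg: "f x < 0" by simp
  have "\<forall>\<^sub>F y in at_infinity. f y > f x" by (rule order_tendstoD(1)[OF lim neg])
  then obtain b where b: "\<And>y. norm y \<ge> b \<Longrightarrow> f y > f x" by (auto simp: eventually_at_infinity)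
  define K where "K = {y::'a. R \<le> norm y} \<inter> cball 0 (max b (norm x))"
  have "compact K" unfolding K_def
    by (rule closed_Int_compact) (intro closed_Collect_le continuous_intros compact_cball)+
  moreover have "x \<in> K" using x by (auto simp: K_def)
  moreover have "continuous_on K f" by (rule continuous_on_subset[OF c]) (auto simp: K_def)
  ultimately obtain y where y: "y \<in> K" "\<And>z. z \<in> K \<Longrightarrow> f y \<le> f z"
    using continuous_attains_inf[of K f] by auto
  have fy: "f y \<le> f x" using y \<open>x \<in> K\<close> by auto
  have yR: "norm y > R"
    using y(1) bd[of y] fy neg by (cases "norm y = R") (auto simp: K_def)
  have "f y \<le> f z" if "norm z > R" for z
  proof (cases "z \<in> K")
    case False
    then have "norm z \<ge> b" using that by (auto simp: K_def)
    then show ?thesis using b[of z] fy by simp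
  qed (use y in auto)
  then have "lin_trace (H y) \<ge> 0"
    by (intro local_min_lin_trace[OF h]) (auto simp: yR intro!: open_Collect_less continuous_intros)
  then show False using pos[OF yR] fy neg by linarith
qed

section \<open>Integration on Euclidean space\<close>

text \<open>A stand-in for polar coordinates: f is dominated by a sum of constants on concentric
  balls whose contributions form a geometric series. Growing radii handle decay at infinity,
  shrinking radii a singularity at z.\<close>

lemma dyadic_nn_integral_le:
  fixes f :: "'a::euclidean_space \<Rightarrow> real"
  assumes f: "\<And>x. f x \<noteq> 0 \<Longrightarrow> \<exists>k. dist z x < r k \<and> f x \<le> c k"
    and c: "\<And>k. 0 \<le> c k" and r: "\<And>k. 0 \<le> r k"
    and geo: "\<And>k. c k * r k ^ DIM('a) = A * q ^ k" and A: "0 \<le> A" and q: "0 \<le> q" "q < 1"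
  shows "(\<integral>\<^sup>+x. ennreal (f x) \<partial>lborel) \<le> ennreal (unit_ball_vol (real DIM('a)) * A / (1 - q))"
proof -
  define V where "V = unit_ball_vol (real DIM('a))"
  have V: "0 \<le> V" by (simp add: V_def)
  have "ennreal (f x) \<le> (\<Sum>k. ennreal (c k) * indicator (ball z (r k)) x)" for x
  proof (cases "f x = 0")
    case False
    then obtain k where k: "dist z x < r k" "f x \<le> c k" using f by blast
    have "ennreal (f x) \<le> ennreal (c k) * indicator (ball z (r k)) x"
      using k by (simp add: ennreal_leI)
    also have "\<dots> = (\<Sum>j\<in>{k}. ennreal (c j) * indicator (ball z (r j)) x)"
      by (simp del: mem_ball sum_mult_indicator)
    also have "\<dots> \<le> (\<Sum>j. ennreal (c j) * indicator (ball z (r j)) x)"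
      by (rule sum_le_suminf) auto
    finally show ?thesis .
  qed auto
  then have "(\<integral>\<^sup>+x. ennreal (f x) \<partial>lborel) \<le>
      (\<integral>\<^sup>+x. (\<Sum>k. ennreal (c k) * indicator (ball z (r k)) x) \<partial>lborel)"
    by (intro nn_integral_mono) auto
  also have "\<dots> = (\<Sum>k. \<integral>\<^sup>+x. ennreal (c k) * indicator (ball z (r k)) x \<partial>lborel)"
  proof (rule nn_integral_suminf)
    have [measurable]: "ball z (r k) \<in> sets borel" for k by simp
    show "(\<lambda>x. ennreal (c k) * indicator (ball z (r k)) x) \<in> borel_measurable lborel" for k
      by (simp del: mem_ball, measurable)
  qed
  also have "\<dots> = (\<Sum>k. ennreal (V * A * q ^ k))"
  proof (intro suminf_cong)
    fix k
    have "(\<integral>\<^sup>+x. ennreal (c k) * indicator (ball z (r k)) x \<partial>lborel) = ennreal (c k * (V * r k ^ DIM('a)))"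
      using c[of k] r[of k] V
      by (simp add: nn_integral_cmult_indicator emeasure_ball V_def ennreal_mult)
    also have "c k * (V * r k ^ DIM('a)) = V * A * q ^ k"
      using geo[of k] by (simp add: mult.commute mult.left_commute)
    finally show "(\<integral>\<^sup>+x. ennreal (c k) * indicator (ball z (r k)) x \<partial>lborel) = ennreal (V * A * q ^ k)" .
  qed
  also have "\<dots> = ennreal (\<Sum>k. V * A * q ^ k)"
    using V A q by (intro suminf_ennreal2 summable_mult summable_geometric) auto
  also have "(\<Sum>k. V * A * q ^ k) = V * A / (1 - q)"
    using q by (subst suminf_mult) (auto simp: suminf_geometric summable_geometric)
  finally show ?thesis by (simp add: V_def)
qed

lemma integrable_powr_decay:
  assumes "real DIM('a) < 2 * a"
  shows "integrable lborel (\<lambda>x::'a::euclidean_space. (1 + x \<bullet> x) powr (- a))"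
proof (rule integrableI_bounded)
  define q where "q = 2 powr (real DIM('a) - 2 * a)"
  have a: "a > 0" using assms by (smt (verit) DIM_positive of_nat_0_less_iff)
  have q: "0 \<le> q" "q < 1" using assms by (auto simp: q_def powr_less_one)
  have "(\<integral>\<^sup>+(x::'a). ennreal ((1 + x \<bullet> x) powr (- a)) \<partial>lborel)
      \<le> ennreal (unit_ball_vol (real DIM('a)) * 4 powr a / (1 - q))"
  proof (rule dyadic_nn_integral_le)
    fix x :: 'a
    define k where "k = (LEAST k::nat. norm x < 2 ^ k)"
    obtain k0 :: nat where "norm x < 2 ^ k0" using real_arch_pow[of 2 "norm x"] by auto
    then have k: "norm x < 2 ^ k" unfolding k_def by (rule LeastI)
    \<comment> \<open>For k > 0 minimality of k gives \<open>norm x \<ge> 2 ^ (k - 1)\<close>. For k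
      = 0 the shifted exponent makes the left side 1/4, so the bound holds there too.\<close>
    have "(4 powr (real k - 1)) \<le> 1 + x \<bullet> x"
    proof (cases k)
      case (Suc j)
      then have "\<not> norm x < 2 ^ j" unfolding k_def using not_less_Least[of j] by (metis lessI)
      then have "(2 ^ j)\<^sup>2 \<le> (norm x)\<^sup>2" by (intro power_mono) auto
      moreover have "(2 ^ j)\<^sup>2 = ((2::real)\<^sup>2) ^ j" by (simp only: power_mult[symmetric] mult.commute)
      ultimately have "4 ^ j \<le> x \<bullet> x" by (simp add: power2_norm_eq_inner)
      then show ?thesis using Suc by (simp add: powr_realpow)
    next
      case 0
      have "(4::real) powr (-1) \<le> 1" by (simp add: powr_minus)
      also have "\<dots> \<le> 1 + x \<bullet> x" by simp
      finally show ?thesis using 0 by simp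
    qed
    then have "(1 + x \<bullet> x) powr (- a) \<le> (4 powr (real k - 1)) powr (- a)"
      using a by (intro powr_mono2') auto
    also have "\<dots> = 4 powr a * 4 powr (- (a * real k))"
      by (simp add: powr_powr powr_add[symmetric] algebra_simps)
    finally show "\<exists>k. dist 0 x < 2 ^ k \<and> (1 + x \<bullet> x) powr (- a) \<le> 4 powr a * 4 powr (- (a * real k))"
      using k by auto
    show "4 powr a * 4 powr (- (a * real k)) * (2 ^ k) ^ DIM('a) = 4 powr a * q ^ k" for k :: nat
    proof -
      have "(4::real) powr y = (2 powr 2) powr y" for y by simp
      then have "(4::real) powr y = 2 powr (2 * y)" for y by (simp only: powr_powr)
      moreover have "((2::real) ^ k) ^ DIM('a) = 2 powr (real k * real DIM('a))"
        using powr_realpow[of 2 "k * DIM('a)"] by (simp add: power_mult)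
      ultimately have "4 powr (- (a * real k)) * (2 ^ k) ^ DIM('a) = 2 powr (- (2 * a * real k)) * 2 powr (real k * real DIM('a))"
        by (simp add: algebra_simps)
      also have "\<dots> = q ^ k"
        by (simp add: q_def powr_add[symmetric] powr_realpow[symmetric] powr_powr algebra_simps)
      finally show ?thesis by simp
    qed
  qed (use q in auto)
  then show "(\<integral>\<^sup>+(x::'a). ennreal (norm ((1 + x \<bullet> x) powr (- a))) \<partial>lborel) < \<infinity>"
    using ennreal_less_top le_less_trans by fastforce
qed auto

text \<open>The exponent 1 - n is that of the gradient of the Newtonian kernel. The shell between
  radii r / 2^(k+1) and r / 2^k contributes at most a constant times r / 2^k, so the total is linear
  in r.\<close>

lemma nn_integral_riesz_ball_le:
  obtains K where "0 \<le> K" "\<And>(z::'a::euclidean_space) r. 0 < r \<Longrightarrow>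
    (\<integral>\<^sup>+x. ennreal (indicator (ball z r) x * norm (x - z) powr (1 - real DIM('a))) \<partial>lborel) \<le> ennreal (K * r)"
proof (rule that)
  define K where "K = unit_ball_vol (real DIM('a)) * 2 powr (real DIM('a) - 1) * 2"
  show "0 \<le> K" by (simp add: K_def)
  fix z :: 'a and r :: real assume r: "0 < r"
  let ?n = "real DIM('a)"
  have "(\<integral>\<^sup>+x. ennreal (indicator (ball z r) x * norm (x - z) powr (1 - ?n)) \<partial>lborel)
     \<le> ennreal (unit_ball_vol ?n * (2 powr (?n - 1) * r) / (1 - 1 / 2))"
  proof (rule dyadic_nn_integral_le)
    fix x assume "indicator (ball z r) x * norm (x - z) powr (1 - ?n) \<noteq> 0"
    \<comment> \<open>The centre drops out because \<open>0 powr a = 0\<close>.\<close>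
    then have x: "0 < norm (x - z)" "norm (x - z) < r"
      by (auto simp: indicator_def dist_norm norm_minus_commute split: if_splits)
    define P where "P k \<longleftrightarrow> r / 2 ^ Suc k \<le> norm (x - z)" for k :: nat
    obtain k0 :: nat where "(1 / 2) ^ k0 < norm (x - z) / r"
      using real_arch_pow_inv[of "norm (x - z) / r" "1 / 2"] x r by auto
    then have "r / 2 ^ k0 < norm (x - z)" using r by (simp add: field_simps power_divide)
    moreover have "r / 2 ^ Suc k0 \<le> r / 2 ^ k0" using r by (intro divide_left_mono) auto
    ultimately have "P k0" by (simp add: P_def)
    define k where "k = (LEAST k. P k)"
    have k: "r / 2 ^ Suc k \<le> norm (x - z)" using LeastI[of P, OF \<open>P k0\<close>] by (simp add: k_def P_def)
    have k': "norm (x - z) < r / 2 ^ k"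
    proof (cases k)
      case (Suc j)
      then have "\<not> P j" using not_less_Least[of j P] by (simp add: k_def)
      then show ?thesis using Suc by (simp add: P_def)
    qed (use x in simp)
    have "norm (x - z) powr (1 - ?n) \<le> (r / 2 ^ Suc k) powr (1 - ?n)"
      using k r DIM_positive[where 'a='a] by (intro powr_mono2') (auto simp: Suc_le_eq)
    then show "\<exists>k. dist z x < r / 2 ^ k \<and> indicator (ball z r) x * norm (x - z) powr (1 - ?n)
        \<le> (r / 2 ^ Suc k) powr (1 - ?n)"
      using k' by (intro exI[of _ k]) (auto simp: dist_norm norm_minus_commute indicator_def)
  next
    show "(r / 2 ^ Suc k) powr (1 - ?n) * (r / 2 ^ k) ^ DIM('a) = 2 powr (?n - 1) * r * (1 / 2) ^ k" for k :: nat
    proof -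
      define s where "s = r / 2 ^ k"
      have s: "s > 0" using r by (simp add: s_def)
      have "(r / 2 ^ Suc k) powr (1 - ?n) * (r / 2 ^ k) ^ DIM('a) = (s / 2) powr (1 - ?n) * s powr ?n"
        using s by (simp add: powr_realpow s_def mult.commute)
      also have "\<dots> = 2 powr (?n - 1) * (s powr (1 - ?n) * s powr ?n)"
        using s by (simp add: powr_divide powr_diff field_simps)
      also have "s powr (1 - ?n) * s powr ?n = s" using s by (simp add: powr_add[symmetric])
      finally show ?thesis by (simp add: s_def power_divide)
    qed
  qed (use r in auto)
  then show "(\<integral>\<^sup>+x. ennreal (indicator (ball z r) x * norm (x - z) powr (1 - ?n)) \<partial>lborel) \<le> ennreal (K * r)"
    by (simp add: K_def mult.assoc mult.commute mult.left_commute)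
qed

section \<open>Translation, scaling and Green's identity\<close>

lemma lborel_integral_shift:
  fixes f :: "'a::euclidean_space \<Rightarrow> real"
  assumes "f \<in> borel_measurable borel"
  shows "(\<integral>x. f (c + x) \<partial>lborel) = (\<integral>x. f x \<partial>lborel)"
    and "integrable lborel (\<lambda>x. f (c + x)) \<longleftrightarrow> integrable lborel f"
proof -
  have "(\<integral>x. f x \<partial>lborel) = (\<integral>x. f x \<partial>distr lborel borel ((+) c))" by (simp add: lborel_distr_plus)
  also have "\<dots> = (\<integral>x. f (c + x) \<partial>lborel)" using assms by (subst integral_distr) auto
  finally show "(\<integral>x. f (c + x) \<partial>lborel) = (\<integral>x. f x \<partial>lborel)" ..
  have "integrable lborel f \<longleftrightarrow> integrable (distr lborel borel ((+) c)) f" by (simp add: lborel_distr_plus)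
  also have "\<dots> \<longleftrightarrow> integrable lborel (\<lambda>x. f (c + x))" using assms by (subst integrable_distr_eq) auto
  finally show "integrable lborel (\<lambda>x. f (c + x)) \<longleftrightarrow> integrable lborel f" ..
qed

lemma lborel_integral_scale:
  fixes f :: "'a::euclidean_space \<Rightarrow> real"
  assumes "f \<in> borel_measurable borel" "c > 0"
  shows "(\<integral>x. f x \<partial>lborel) = c ^ DIM('a) * (\<integral>x. f (c *\<^sub>R x) \<partial>lborel)"
proof -
  have "(\<integral>x. f x \<partial>lborel) = (\<integral>x. f x \<partial>density (distr lborel borel (\<lambda>x. 0 + c *\<^sub>R x)) (\<lambda>_. ennreal (c ^ DIM('a))))"
    using assms(2) lborel_affine[of c "0::'a"] by simp
  also have "\<dots> = (\<integral>x. c ^ DIM('a) *\<^sub>R f x \<partial>distr lborel borel (\<lambda>x. 0 + c *\<^sub>R x))"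
    using assms by (subst integral_density) auto
  also have "\<dots> = (\<integral>x. c ^ DIM('a) *\<^sub>R f (c *\<^sub>R x) \<partial>lborel)"
    using assms by (subst integral_distr) auto
  finally show ?thesis by simp
qed

lemma integrable_continuous_compact_support:
  fixes f :: "'a::euclidean_space \<Rightarrow> real"
  assumes "continuous_on UNIV f" "\<And>x. norm x \<ge> R \<Longrightarrow> f x = 0"
  shows "integrable lborel f"
proof -
  have "integrable lborel (\<lambda>x. indicator (cball 0 R) x *\<^sub>R f x)"
    by (rule borel_integrable_compact) (auto intro: continuous_on_subset[OF assms(1)])
  moreover have "(\<lambda>x. indicator (cball 0 R) x *\<^sub>R f x) = f"
    using assms(2) by (auto simp: fun_eq_iff indicator_def)
  ultimately show ?thesis by simp
qed

text \<open>Translation invariance replaces the divergence theorem: every difference quotient of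
  \<psi> has integral 0, and the quotients converge to \<psi>'. By the mean value theorem they are
  dominated by a bound of \<psi>' on a ball enlarged by \<open>norm v\<close>, as the step sizes are
  at most 1.\<close>

lemma integral_directional_derivative_eq_0:
  fixes \<psi> \<psi>' :: "'a::euclidean_space \<Rightarrow> real"
  assumes der: "\<And>x t. ((\<lambda>t. \<psi> (x + t *\<^sub>R v)) has_real_derivative \<psi>' (x + t *\<^sub>R v)) (at t)"
    and c: "continuous_on UNIV \<psi>" and c': "continuous_on UNIV \<psi>'"
    and z: "\<And>x. norm x \<ge> R \<Longrightarrow> \<psi> x = 0" and z': "\<And>x. norm x \<ge> R \<Longrightarrow> \<psi>' x = 0"
  shows "(\<integral>x. \<psi>' x \<partial>lborel) = 0"
proof -
  have m[measurable]: "\<psi> \<in> borel_measurable borel" "\<psi>' \<in> borel_measurable borel"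
    using c c' by (auto intro: borel_measurable_continuous_onI)
  have "bounded (\<psi>' ` cball 0 R)"
    by (intro compact_imp_bounded compact_continuous_image continuous_on_subset[OF c']) auto
  then obtain B where B0: "\<And>x. norm x \<le> R \<Longrightarrow> \<bar>\<psi>' x\<bar> \<le> B"
    unfolding bounded_iff by (metis imageI mem_cball_0 real_norm_def)
  have B: "\<bar>\<psi>' x\<bar> \<le> max B 0" for x using B0[of x] z'[of x] by (cases "norm x \<le> R") auto
  define t where "t m = inverse (real (Suc m))" for m
  have t: "0 < t m" "t m \<le> 1" for m by (auto simp: t_def field_simps)
  have t0: "t \<longlonglongrightarrow> 0" unfolding t_def by (rule LIMSEQ_inverse_real_of_nat)
  define D where "D m x = (\<psi> (x + t m *\<^sub>R v) - \<psi> x) / t m" for m x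
  have "(\<lambda>m. \<integral>x. D m x \<partial>lborel) \<longlonglongrightarrow> (\<integral>x. \<psi>' x \<partial>lborel)"
  proof (rule integral_dominated_convergence)
    show "integrable lborel (\<lambda>x::'a. indicator (cball 0 (R + norm v)) x *\<^sub>R max B 0)"
      by (rule borel_integrable_compact) auto
    show "AE x in lborel. (\<lambda>m. D m x) \<longlonglongrightarrow> \<psi>' x"
    proof (rule AE_I2)
      fix x
      have "((\<lambda>h. (\<psi> (x + h *\<^sub>R v) - \<psi> x) / h) \<longlongrightarrow> \<psi>' x) (at 0)"
        using der[of x 0] by (simp add: DERIV_def)
      moreover have "filterlim t (at 0) sequentially"
        using t0 t(1) by (auto simp: filterlim_at intro!: always_eventually) (metis less_irrefl)
      ultimately show "(\<lambda>m. D m x) \<longlonglongrightarrow> \<psi>' x" unfolding D_def by (rule filterlim_compose)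
    qed
    show "AE x in lborel. norm (D m x) \<le> indicator (cball 0 (R + norm v)) x *\<^sub>R max B 0" for m
    proof (rule AE_I2)
      fix x :: 'a
      show "norm (D m x) \<le> indicator (cball 0 (R + norm v)) x *\<^sub>R max B 0"
      proof (cases "norm x \<le> R + norm v")
        case True
        obtain s where "\<psi> (x + t m *\<^sub>R v) - \<psi> (x + 0 *\<^sub>R v) = (t m - 0) * \<psi>' (x + s *\<^sub>R v)"
          using MVT2[OF t(1)[of m], of "\<lambda>t. \<psi> (x + t *\<^sub>R v)" "\<lambda>t. \<psi>' (x + t *\<^sub>R v)"] der by auto
        then have "D m x = \<psi>' (x + s *\<^sub>R v)" using t(1)[of m] by (simp add: D_def)
        then show ?thesis using B[of "x + s *\<^sub>R v"] True by simp
      next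
        case False
        have "t m * norm v \<le> norm v" using t[of m] by (simp add: mult_left_le_one_le)
        then have "norm (x + t m *\<^sub>R v) \<ge> R"
          using False t(1)[of m] norm_triangle_ineq4[of "x + t m *\<^sub>R v" "t m *\<^sub>R v"] by simp
        moreover have "norm x \<ge> R" using False norm_ge_zero[of v] by linarith
        ultimately show ?thesis using z by (simp add: D_def)
      qed
    qed
  qed (auto simp: D_def[abs_def])
  moreover have "(\<integral>x. D m x \<partial>lborel) = 0" for m
  proof -
    have i: "integrable lborel \<psi>" by (rule integrable_continuous_compact_support[OF c z])
    have i2: "integrable lborel (\<lambda>x. \<psi> (x + t m *\<^sub>R v))"
      using lborel_integral_shift(2)[of \<psi> "t m *\<^sub>R v"] i by (simp add: add.commute)
    have "(\<integral>x. D m x \<partial>lborel) = ((\<integral>x. \<psi> (x + t m *\<^sub>R v) \<partial>lborel) - (\<integral>x. \<psi> x \<partial>lborel)) / t m"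
      using i i2 by (simp add: D_def Bochner_Integration.integral_diff)
    then show ?thesis using lborel_integral_shift(1)[of \<psi> "t m *\<^sub>R v"] by (simp add: add.commute)
  qed
  ultimately show ?thesis by (simp add: LIMSEQ_const_iff)
qed

text \<open>In each direction i the field \<phi> w_i - w \<phi>_i has derivative \<phi> w_ii - w
  \<phi>_ii, since the mixed first-order products cancel. Its integral vanishes because \<phi> has
  compact support.\<close>

lemma integral_Green:
  fixes w \<phi> :: "'a::euclidean_space \<Rightarrow> real"
  assumes w: "has_hessian w g H UNIV" and \<phi>: "has_hessian \<phi> p Q UNIV"
    and cH: "\<And>i. i \<in> Basis \<Longrightarrow> continuous_on UNIV (\<lambda>x. H x i \<bullet> i)"
    and cQ: "\<And>i. i \<in> Basis \<Longrightarrow> continuous_on UNIV (\<lambda>x. Q x i \<bullet> i)"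
    and z: "\<And>x. norm x \<ge> R \<Longrightarrow> \<phi> x = 0" "\<And>x. norm x \<ge> R \<Longrightarrow> p x = 0" "\<And>x h. norm x \<ge> R \<Longrightarrow> Q x h = 0"
  shows "(\<integral>x. \<phi> x * lin_trace (H x) \<partial>lborel) = (\<integral>x. w x * lin_trace (Q x) \<partial>lborel)"
proof -
  have cw: "continuous_on UNIV w" and c\<phi>: "continuous_on UNIV \<phi>"
    using has_hessian_continuous_on w \<phi> by blast+
  have cg: "continuous_on UNIV g" and cp: "continuous_on UNIV p"
    using w \<phi> by (auto simp: has_hessian_def intro!: continuous_at_imp_continuous_on has_derivative_continuous)
  have tH: "continuous_on UNIV (\<lambda>x. lin_trace (H x))" and tQ: "continuous_on UNIV (\<lambda>x. lin_trace (Q x))"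
    unfolding lin_trace_def by (auto intro!: continuous_on_sum cH cQ)
  have zt: "lin_trace (Q x) = 0" if "norm x \<ge> R" for x using z(3)[OF that] by (simp add: lin_trace_def)
  define \<psi> where "\<psi> i x = \<phi> x * (g x \<bullet> i) - w x * (p x \<bullet> i)" for i x
  define \<psi>' where "\<psi>' i x = \<phi> x * (H x i \<bullet> i) - w x * (Q x i \<bullet> i)" for i x
  have c': "continuous_on UNIV (\<psi>' i)" if "i \<in> Basis" for i
    unfolding \<psi>'_def[abs_def] by (intro continuous_intros c\<phi> cw cH cQ that)
  have "(\<integral>x. \<psi>' i x \<partial>lborel) = 0" if "i \<in> Basis" for i
  proof (rule integral_directional_derivative_eq_0[where R = R])
    show "((\<lambda>t. \<psi> i (x + t *\<^sub>R i)) has_real_derivative \<psi>' i (x + t *\<^sub>R i)) (at t)" for x t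
      unfolding \<psi>_def \<psi>'_def
      by (rule derivative_eq_intros has_hessian_line[OF w] has_hessian_line[OF \<phi>] UNIV_I refl)+
        (simp add: algebra_simps)
    show "continuous_on UNIV (\<psi> i)"
      unfolding \<psi>_def[abs_def] by (intro continuous_intros c\<phi> cw cg cp)
  qed (use c'[OF that] in \<open>auto simp: \<psi>_def \<psi>'_def z\<close>)
  moreover have "integrable lborel (\<psi>' i)" if "i \<in> Basis" for i
    by (rule integrable_continuous_compact_support[OF c'[OF that], of R]) (auto simp: z \<psi>'_def)
  ultimately have "(\<integral>x. (\<Sum>i\<in>Basis. \<psi>' i x) \<partial>lborel) = 0"
    by (subst Bochner_Integration.integral_sum) auto
  moreover have "(\<Sum>i\<in>Basis. \<psi>' i x) = \<phi> x * lin_trace (H x) - w x * lin_trace (Q x)" for x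
    by (simp add: \<psi>'_def lin_trace_def sum_subtractf sum_distrib_left)
  ultimately have "(\<integral>x. \<phi> x * lin_trace (H x) - w x * lin_trace (Q x) \<partial>lborel) = 0" by simp
  moreover have "integrable lborel (\<lambda>x. \<phi> x * lin_trace (H x))"
    by (rule integrable_continuous_compact_support[where R = R]) (auto intro!: continuous_intros c\<phi> tH simp: z)
  moreover have "integrable lborel (\<lambda>x. w x * lin_trace (Q x))"
    by (rule integrable_continuous_compact_support[where R = R])
      (auto intro!: continuous_intros cw tQ simp: zt)
  ultimately show ?thesis by (simp add: Bochner_Integration.integral_diff)
qed

section \<open>Newtonian representation\<close>

lemma DERIV_max_0_power:
  "((\<lambda>z::real. max 0 z ^ Suc (Suc m)) has_real_derivative (real (Suc (Suc m)) * max 0 z ^ Suc m)) (at z)"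
proof -
  consider "z > 0" | "z < 0" | "z = 0" by linarith
  then show ?thesis
  proof cases
    case 1
    have "((\<lambda>z. z ^ Suc (Suc m)) has_real_derivative real (Suc (Suc m)) * z ^ Suc m) (at z)"
      by (rule derivative_eq_intros refl)+ simp
    then have "((\<lambda>z::real. max 0 z ^ Suc (Suc m)) has_real_derivative real (Suc (Suc m)) * z ^ Suc m) (at z)"
      by (rule has_field_derivative_transform_within_open[where S = "{0<..}"]) (use 1 in auto)
    then show ?thesis using 1 by (simp del: power_Suc of_nat_Suc)
  next
    case 2
    have "((\<lambda>z. 0) has_real_derivative 0) (at z)" by simp
    then have "((\<lambda>z::real. max 0 z ^ Suc (Suc m)) has_real_derivative 0) (at z)"
      by (rule has_field_derivative_transform_within_open[where S = "{..<0}"]) (use 2 in auto)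
    then show ?thesis using 2 by simp
  next
    case 3
    have "((\<lambda>h::real. max 0 h ^ Suc m) \<longlongrightarrow> max 0 0 ^ Suc m) (at 0)"
      by (intro tendsto_intros)
    then have "((\<lambda>h::real. max 0 h ^ Suc m) \<longlongrightarrow> 0) (at 0)" by simp
    moreover have "\<forall>\<^sub>F h::real in at 0. max 0 h ^ Suc m = max 0 h ^ Suc (Suc m) / h"
      by (auto simp: eventually_at max_def intro!: exI[of _ 1])
    ultimately have "((\<lambda>h::real. max 0 h ^ Suc (Suc m) / h) \<longlongrightarrow> 0) (at 0)"
      by (rule Lim_transform_eventually)
    then show ?thesis using 3 by (simp add: DERIV_def)
  qed
qed

text \<open>
  With \<open>q = (n - 2) / 2\<close> and \<open>s = |y|\<^sup>2\<close>, \<open>reg_kernel q \<epsilon> s\<close> regularises \<open>|y|\<^bsup>2 - n\<^esup>\<close>, a multiple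
  of the fundamental solution; minus its Laplacian is, up to normalisation, an approximate identity
  as \<open>\<epsilon>\<close> tends to \<open>0\<close>. The factor \<open>cutoff k s ^ 3\<close> with \<open>k = 1 / R\<^sup>2\<close> is a compactly supported function of class \<open>C\<^sup>2\<close>.
\<close>

definition reg_kernel :: "real \<Rightarrow> real \<Rightarrow> real \<Rightarrow> real" where
  "reg_kernel q \<epsilon> s = (s + \<epsilon>\<^sup>2) powr (- q)"

definition cutoff :: "real \<Rightarrow> real \<Rightarrow> real" where
  "cutoff k s = max 0 (1 - k * s)"

definition cut_kernel :: "real \<Rightarrow> real \<Rightarrow> real \<Rightarrow> real \<Rightarrow> real" where
  "cut_kernel q \<epsilon> k s = reg_kernel q \<epsilon> s * cutoff k s ^ 3"

definition cut_kernel' :: "real \<Rightarrow> real \<Rightarrow> real \<Rightarrow> real \<Rightarrow> real" where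
  "cut_kernel' q \<epsilon> k s = - (q * (reg_kernel q \<epsilon> s / (s + \<epsilon>\<^sup>2)) * cutoff k s ^ 3)
     - 3 * k * reg_kernel q \<epsilon> s * cutoff k s ^ 2"

definition cut_kernel'' :: "real \<Rightarrow> real \<Rightarrow> real \<Rightarrow> real \<Rightarrow> real" where
  "cut_kernel'' q \<epsilon> k s = q * (q + 1) * (reg_kernel q \<epsilon> s / (s + \<epsilon>\<^sup>2)\<^sup>2) * cutoff k s ^ 3
     + 6 * k * q * (reg_kernel q \<epsilon> s / (s + \<epsilon>\<^sup>2)) * cutoff k s ^ 2
     + 6 * k\<^sup>2 * reg_kernel q \<epsilon> s * cutoff k s"

lemma DERIV_reg_kernel:
  assumes "s + \<epsilon>\<^sup>2 > 0"
  shows "(reg_kernel q \<epsilon> has_real_derivative - (q * (reg_kernel q \<epsilon> s / (s + \<epsilon>\<^sup>2)))) (at s)"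
  unfolding reg_kernel_def[abs_def]
  using assms by (auto intro!: derivative_eq_intros simp: powr_diff)

lemma DERIV_cutoff:
  "((\<lambda>s. cutoff k s ^ 3) has_real_derivative - (3 * k * cutoff k s ^ 2)) (at s)"
  "((\<lambda>s. cutoff k s ^ 2) has_real_derivative - (2 * k * cutoff k s)) (at s)"
proof -
  have l: "((\<lambda>s. 1 - k * s) has_real_derivative - k) (at s)"
    by (auto intro!: derivative_eq_intros)
  show "((\<lambda>s. cutoff k s ^ 3) has_real_derivative - (3 * k * cutoff k s ^ 2)) (at s)"
    using DERIV_chain'[OF l DERIV_max_0_power[of 1]]
    by (simp add: cutoff_def[abs_def] numeral_eq_Suc algebra_simps)
  show "((\<lambda>s. cutoff k s ^ 2) has_real_derivative - (2 * k * cutoff k s)) (at s)"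
    using DERIV_chain'[OF l DERIV_max_0_power[of 0]]
    by (simp add: cutoff_def[abs_def] numeral_eq_Suc algebra_simps)
qed

lemma DERIV_cut_kernel:
  assumes "s + \<epsilon>\<^sup>2 > 0"
  shows "(cut_kernel q \<epsilon> k has_real_derivative cut_kernel' q \<epsilon> k s) (at s)"
  unfolding cut_kernel_def[abs_def] cut_kernel'_def
  by (rule derivative_eq_intros DERIV_reg_kernel DERIV_cutoff assms refl)+ (simp add: algebra_simps)

lemma DERIV_cut_kernel':
  assumes "s + \<epsilon>\<^sup>2 > 0"
  shows "(cut_kernel' q \<epsilon> k has_real_derivative cut_kernel'' q \<epsilon> k s) (at s)"
proof -
  define N where "N = s + \<epsilon>\<^sup>2"
  define G where "G = reg_kernel q \<epsilon> s"
  define X where "X = cutoff k s"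
  have N: "N \<noteq> 0" using assms by (simp add: N_def)
  have dN: "((\<lambda>s. s + \<epsilon>\<^sup>2) has_real_derivative 1) (at s)" by (auto intro!: derivative_eq_intros)
  have dG: "((\<lambda>s. reg_kernel q \<epsilon> s / (s + \<epsilon>\<^sup>2)) has_real_derivative - ((q + 1) * (G / N\<^sup>2))) (at s)"
  proof -
    have "((\<lambda>s. reg_kernel q \<epsilon> s / (s + \<epsilon>\<^sup>2)) has_real_derivative
        (- (q * (G / N)) * N - G * 1) / (N * N)) (at s)"
      using DERIV_divide[OF DERIV_reg_kernel[OF assms, of q] dN] N by (simp add: N_def G_def)
    moreover have "(- (q * (G / N)) * N - G * 1) / (N * N) = - ((q + 1) * (G / N\<^sup>2))"
      using N by (simp add: field_simps power2_eq_square)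
    ultimately show ?thesis by simp
  qed
  have "(cut_kernel' q \<epsilon> k has_real_derivative
     - (q * (- ((q + 1) * (G / N\<^sup>2)) * X ^ 3 + (G / N) * (- (3 * k * X ^ 2))))
     - 3 * k * (- (q * (G / N)) * X ^ 2 + G * (- (2 * k * X)))) (at s)"
    unfolding cut_kernel'_def[abs_def] N_def G_def X_def
    by (rule derivative_eq_intros dG[unfolded N_def G_def] DERIV_reg_kernel DERIV_cutoff assms refl)+
      (simp add: algebra_simps)
  moreover have "- (q * (- ((q + 1) * (G / N\<^sup>2)) * X ^ 3 + (G / N) * (- (3 * k * X ^ 2))))
     - 3 * k * (- (q * (G / N)) * X ^ 2 + G * (- (2 * k * X))) = cut_kernel'' q \<epsilon> k s"
    unfolding cut_kernel''_def N_def[symmetric] G_def[symmetric] X_def[symmetric]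
    by (simp add: algebra_simps power2_eq_square)
  ultimately show ?thesis by simp
qed

text \<open>For \<epsilon> \<le> 1 the weight 1 + s is comparable with
  \<open>s + \<epsilon>\<^sup>2\<close>. The constants blow up with \<epsilon>, which is harmless:
  they serve while \<epsilon> is fixed and the cutoff is removed.\<close>

lemma reg_kernel_le:
  assumes "0 \<le> s" "0 < \<epsilon>" "\<epsilon> \<le> 1" "0 \<le> q"
  shows "reg_kernel q \<epsilon> s \<le> reg_kernel q \<epsilon> 0 * (1 + s) powr (- q)"
    and "reg_kernel q \<epsilon> s / (s + \<epsilon>\<^sup>2) \<le> reg_kernel q \<epsilon> 0 / \<epsilon>\<^sup>2 * (1 + s) powr (- q - 1)"
proof -
  have e: "0 < \<epsilon>\<^sup>2" "\<epsilon>\<^sup>2 \<le> 1" using assms by (auto simp: power_le_one)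
  then have N: "\<epsilon>\<^sup>2 * (1 + s) \<le> s + \<epsilon>\<^sup>2" using assms mult_right_mono[of "\<epsilon>\<^sup>2" 1 s] by (simp add: algebra_simps)
  have "reg_kernel q \<epsilon> s \<le> (\<epsilon>\<^sup>2 * (1 + s)) powr (- q)"
    unfolding reg_kernel_def using N e assms by (intro powr_mono2') auto
  also have "\<dots> = reg_kernel q \<epsilon> 0 * (1 + s) powr (- q)"
    using e assms by (simp add: reg_kernel_def powr_mult)
  finally show 1: "reg_kernel q \<epsilon> s \<le> reg_kernel q \<epsilon> 0 * (1 + s) powr (- q)" .
  have "reg_kernel q \<epsilon> s / (s + \<epsilon>\<^sup>2) \<le> (reg_kernel q \<epsilon> 0 * (1 + s) powr (- q)) / (\<epsilon>\<^sup>2 * (1 + s))"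
    using 1 N e assms by (intro frac_le) (auto simp: reg_kernel_def)
  also have "\<dots> = reg_kernel q \<epsilon> 0 / \<epsilon>\<^sup>2 * (1 + s) powr (- q - 1)"
    using assms by (simp add: powr_diff)
  finally show "reg_kernel q \<epsilon> s / (s + \<epsilon>\<^sup>2) \<le> reg_kernel q \<epsilon> 0 / \<epsilon>\<^sup>2 * (1 + s) powr (- q - 1)" .
qed

text \<open>The left side is the Laplacian of the cut kernel in dimension n = 2 q + 2, in terms of s
  = |y|^2. The bound does not depend on k, so it yields a dominating function for k tending to
  0.\<close>

lemma cut_kernel_laplacian_bound:
  assumes s: "0 \<le> s" and e: "0 < \<epsilon>" "\<epsilon> \<le> 1" and k: "0 < k" "k \<le> 1" and q: "0 < q"
  shows "\<bar>2 * (2 * q + 2) * cut_kernel' q \<epsilon> k s + 4 * s * cut_kernel'' q \<epsilon> k s\<bar>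
    \<le> reg_kernel q \<epsilon> 0 * (4 * q * (q + 1) / \<epsilon>\<^sup>2 + 12 * (2 * q + 2) + 48 * q + 48) * (1 + s) powr (- q - 1)"
    (is "\<bar>?L\<bar> \<le> ?R")
proof -
  define N where "N = s + \<epsilon>\<^sup>2"
  define G where "G = reg_kernel q \<epsilon> s"
  define X where "X = cutoff k s"
  define P where "P = (1 + s) powr (- q - 1)"
  define E where "E = reg_kernel q \<epsilon> 0"
  have N: "N > 0" "s \<le> N" "\<epsilon>\<^sup>2 \<le> N" using s e by (auto simp: N_def intro: add_nonneg_pos)
  have E: "E > 0" "G > 0" "P > 0" using s e N by (auto simp: E_def G_def P_def reg_kernel_def N_def)
  \<comment> \<open>In the terms where the cutoff is not differentiated, the two leading
    contributions combine to a factor 1 - s / N, which is \<open>\<epsilon>\<^sup>2 / N\<close>.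
    This is the harmonicity of |y|^(2 - n), spoilt only by the regularisation.\<close>
  have "?L = X ^ 3 * (- (4 * q * (q + 1) * (G / N) * (\<epsilon>\<^sup>2 / N))) - 6 * (2 * q + 2) * k * G * X\<^sup>2
     + 24 * k * q * G * (s / N) * X\<^sup>2 + 24 * k * (k * s) * G * X"
  proof -
    define h where "h = G / N\<^sup>2"
    have s_eq: "s = N - \<epsilon>\<^sup>2" by (simp add: N_def)
    have G: "G = h * N * N" "G / N = h * N" "G / N\<^sup>2 = h" using N by (auto simp: h_def power2_eq_square)
    have 1: "4 * q * (q + 1) * (G / N) * (\<epsilon>\<^sup>2 / N) = 4 * q * (q + 1) * h * (N - s)"
      unfolding G(2) using N by (simp add: N_def[symmetric]) (simp add: N_def)
    have 2: "24 * k * q * G * (s / N) * X\<^sup>2 = 24 * k * q * h * N * s * X\<^sup>2"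
      unfolding G(1) using N by simp
    show ?thesis
      unfolding 1 2 cut_kernel'_def cut_kernel''_def N_def[symmetric] G_def[symmetric] X_def[symmetric] G(2,3)
      unfolding G(1) s_eq using N(1) by (simp add: algebra_simps power2_eq_square power3_eq_cube)
  qed
  also have "\<bar>\<dots>\<bar> \<le> 4 * q * (q + 1) * (E / \<epsilon>\<^sup>2 * P) + (12 * (2 * q + 2) + 48 * q + 48) * (E * P)"
  proof (cases "X = 0")
    case True
    then show ?thesis using E q e by simp
  next
    case False
    then have X: "0 < X" "X \<le> 1" "k * s \<le> 1" using k s by (auto simp: X_def cutoff_def max_def split: if_splits)
    have X': "0 \<le> X ^ 3" "X ^ 3 \<le> 1" "0 \<le> X\<^sup>2" "X\<^sup>2 \<le> 1" using X by (auto simp: power_le_one)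
    have kG: "k * G \<le> 2 * (E * P)"
    proof -
      \<comment> \<open>On the support of the cutoff k s \<le> 1, and k \<le> 1, hence k (1 + s)
        \<le> 2. Each factor k thus supplies the missing power of 1 + s.\<close>
      have "k \<le> 2 / (1 + s)" using X k s by (simp add: field_simps)
      moreover have "G \<le> E * (1 + s) powr (- q)"
        using reg_kernel_le(1)[of s \<epsilon> q] s e q by (simp add: G_def E_def)
      ultimately have "k * G \<le> 2 / (1 + s) * (E * (1 + s) powr (- q))"
        using E k s by (intro mult_mono) auto
      also have "\<dots> = 2 * (E * P)" using s by (simp add: P_def powr_diff)
      finally show ?thesis .
    qed
    have GN: "G / N \<le> E / \<epsilon>\<^sup>2 * P"
      using reg_kernel_le(2)[of s \<epsilon> q] s e q by (simp add: G_def E_def N_def P_def)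
    have r1: "0 \<le> \<epsilon>\<^sup>2 / N" "\<epsilon>\<^sup>2 / N \<le> 1" "0 \<le> s / N" "s / N \<le> 1" using N s by auto
    have 1: "\<bar>X ^ 3 * (- (4 * q * (q + 1) * (G / N) * (\<epsilon>\<^sup>2 / N)))\<bar> \<le> 4 * q * (q + 1) * (E / \<epsilon>\<^sup>2 * P)"
    proof -
      have "\<bar>X ^ 3 * (- (4 * q * (q + 1) * (G / N) * (\<epsilon>\<^sup>2 / N)))\<bar> = X ^ 3 * (4 * q * (q + 1) * (G / N) * (\<epsilon>\<^sup>2 / N))"
        using X' q E N r1 by (simp add: abs_mult)
      also have "\<dots> \<le> 1 * (4 * q * (q + 1) * (E / \<epsilon>\<^sup>2 * P) * 1)"
        using X' q E N r1 GN by (intro mult_mono) auto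
      finally show ?thesis by simp
    qed
    have 2: "\<bar>6 * (2 * q + 2) * k * G * X\<^sup>2\<bar> \<le> 12 * (2 * q + 2) * (E * P)"
    proof -
      have "(k * G) * X\<^sup>2 \<le> (2 * (E * P)) * 1" by (rule mult_mono[OF kG X'(4)]) (use E in auto)
      then have "6 * (2 * q + 2) * ((k * G) * X\<^sup>2) \<le> 6 * (2 * q + 2) * (2 * (E * P))"
        using q by (intro mult_left_mono) auto
      moreover have "\<bar>6 * (2 * q + 2) * k * G * X\<^sup>2\<bar> = 6 * (2 * q + 2) * ((k * G) * X\<^sup>2)"
        using k E q by (simp add: abs_mult)
      ultimately show ?thesis by (simp add: algebra_simps)
    qed
    have 3: "\<bar>24 * k * q * G * (s / N) * X\<^sup>2\<bar> \<le> 48 * q * (E * P)"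
    proof -
      have "(k * G) * ((s / N) * X\<^sup>2) \<le> (2 * (E * P)) * (1 * 1)"
        by (rule mult_mono[OF kG mult_mono[OF r1(4) X'(4)]]) (use E r1 N s in auto)
      then have "24 * q * ((k * G) * ((s / N) * X\<^sup>2)) \<le> 24 * q * (2 * (E * P))"
        using q by (intro mult_left_mono) auto
      moreover have "\<bar>24 * k * q * G * (s / N) * X\<^sup>2\<bar> = 24 * q * ((k * G) * ((s / N) * X\<^sup>2))"
        using k E q r1 N s by (simp add: abs_mult)
      ultimately show ?thesis by (simp add: algebra_simps)
    qed
    have 4: "\<bar>24 * k * (k * s) * G * X\<bar> \<le> 48 * (E * P)"
    proof -
      have "(k * G) * ((k * s) * X) \<le> (2 * (E * P)) * (1 * 1)"
        by (rule mult_mono[OF kG mult_mono[OF X(3,2)]]) (use E X k s in auto)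
      then show ?thesis using k E q r1 X s by (simp add: abs_mult mult_ac)
    qed
    have "(12 * (2 * q + 2) + 48 * q + 48) * (E * P) = 12 * (2 * q + 2) * (E * P) + 48 * q * (E * P) + 48 * (E * P)"
      by (simp add: algebra_simps)
    then show ?thesis using 1 2 3 4 by linarith
  qed
  also have "\<dots> = ?R" by (simp add: E_def P_def algebra_simps)
  finally show ?thesis .
qed

text \<open>Green's identity with the cut kernel, then removal of the cutoff on both sides by
  dominated convergence. The assumed decay of w of order 1 / |y| is what |y|^(2 - n) gives in the
  worst case n = 3, and it suffices for domination in every dimension.\<close>

lemma integral_reg_kernel_lin_trace:
  fixes w :: "'a::euclidean_space \<Rightarrow> real"
  assumes dim: "DIM('a) \<ge> 3" and w: "has_hessian w g H UNIV"
    and cH: "\<And>i. i \<in> Basis \<Longrightarrow> continuous_on UNIV (\<lambda>x. H x i \<bullet> i)"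
    and A: "\<And>y. \<bar>w y\<bar> \<le> A * (1 + y \<bullet> y) powr (- 1 / 2)"
    and int: "integrable lborel (\<lambda>y. lin_trace (H y))"
    and q: "q = (real DIM('a) - 2) / 2" and e: "0 < \<epsilon>" "\<epsilon> \<le> 1"
  shows "(\<integral>y. reg_kernel q \<epsilon> (y \<bullet> y) * lin_trace (H y) \<partial>lborel)
    = - (\<integral>y. 4 * q * (q + 1) * \<epsilon>\<^sup>2 * (reg_kernel q \<epsilon> (y \<bullet> y) / (y \<bullet> y + \<epsilon>\<^sup>2)\<^sup>2) * w y \<partial>lborel)"
proof -
  have q0: "q > 0" using dim q by simp
  have n: "real DIM('a) = 2 * q + 2" using q by simp
  define k where "k m = (1 / real (Suc m))\<^sup>2" for m
  have k: "0 < k m" "k m \<le> 1" for m by (auto simp: k_def power_le_one)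
  have k0: "k \<longlonglongrightarrow> 0"
  proof -
    have "(\<lambda>m. (inverse (real (Suc m)))\<^sup>2) \<longlonglongrightarrow> 0\<^sup>2"
      by (intro tendsto_power LIMSEQ_inverse_real_of_nat)
    then show ?thesis unfolding k_def by (simp only: inverse_eq_divide zero_power2)
  qed
  have pos: "y \<bullet> y + \<epsilon>\<^sup>2 > 0" for y :: 'a using e by (simp add: add_nonneg_pos)
  define p where "p m y = (2 * cut_kernel' q \<epsilon> (k m) (y \<bullet> y)) *\<^sub>R y" for m and y :: 'a
  define Q where "Q m y h = (2 * cut_kernel' q \<epsilon> (k m) (y \<bullet> y)) *\<^sub>R h +
     (4 * cut_kernel'' q \<epsilon> (k m) (y \<bullet> y) * (y \<bullet> h)) *\<^sub>R y" for m and y h :: 'a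
  have hess: "has_hessian (\<lambda>y. cut_kernel q \<epsilon> (k m) (y \<bullet> y)) (p m) (Q m) UNIV" for m
  proof -
    have "has_hessian (\<lambda>y. cut_kernel q \<epsilon> (k m) ((y - 0) \<bullet> (y - 0)))
       (\<lambda>y. (2 * cut_kernel' q \<epsilon> (k m) ((y - 0) \<bullet> (y - 0))) *\<^sub>R (y - 0))
       (\<lambda>y h. (2 * cut_kernel' q \<epsilon> (k m) ((y - 0) \<bullet> (y - 0))) *\<^sub>R h +
          (4 * cut_kernel'' q \<epsilon> (k m) ((y - 0) \<bullet> (y - 0)) * ((y - 0) \<bullet> h)) *\<^sub>R (y - 0)) (UNIV :: 'a set)"
      by (rule has_hessian_radial) (rule DERIV_cut_kernel DERIV_cut_kernel', simp only: pos)+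
    then show ?thesis by (simp add: p_def[abs_def] Q_def[abs_def])
  qed
  have cQ: "continuous_on UNIV (\<lambda>y. Q m y i \<bullet> i)" for m i
    unfolding Q_def cut_kernel'_def cut_kernel''_def reg_kernel_def cutoff_def
    using pos by (intro continuous_intros) (auto simp: less_imp_neq[symmetric])
  have tQ: "lin_trace (Q m y) = 2 * (2 * q + 2) * cut_kernel' q \<epsilon> (k m) (y \<bullet> y) + 4 * (y \<bullet> y) * cut_kernel'' q \<epsilon> (k m) (y \<bullet> y)" for m y
    unfolding Q_def lin_trace_radial by (simp add: n)
  have X0: "cutoff (k m) (y \<bullet> y) = 0" if "norm y \<ge> real (Suc m)" for m and y :: 'a
  proof -
    have "(real (Suc m))\<^sup>2 \<le> (norm y)\<^sup>2" using that by (intro power_mono) auto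
    then have "k m * (y \<bullet> y) \<ge> 1"
      by (simp add: k_def power2_norm_eq_inner power_divide del: of_nat_Suc)
    then show ?thesis by (simp add: cutoff_def)
  qed
  have Green: "(\<integral>y. cut_kernel q \<epsilon> (k m) (y \<bullet> y) * lin_trace (H y) \<partial>lborel) = (\<integral>y. w y * lin_trace (Q m y) \<partial>lborel)" for m
    by (rule integral_Green[OF w hess cH cQ, of "real (Suc m)"])
      (use X0 in \<open>auto simp: cut_kernel_def p_def Q_def cut_kernel'_def cut_kernel''_def simp del: of_nat_Suc\<close>)
  have cw: "continuous_on UNIV w" using w by (rule has_hessian_continuous_on)
  have tH: "continuous_on UNIV (\<lambda>x. lin_trace (H x))"
    unfolding lin_trace_def by (auto intro!: continuous_on_sum cH)
  have ctQ: "continuous_on UNIV (\<lambda>y. lin_trace (Q m y))" for m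
    unfolding lin_trace_def by (auto intro!: continuous_on_sum cQ)
  have cG: "continuous_on UNIV (\<lambda>y::'a. reg_kernel q \<epsilon> (y \<bullet> y))"
    unfolding reg_kernel_def using pos by (intro continuous_intros) (auto simp: less_imp_neq[symmetric])
  have X1: "(\<lambda>m. cutoff (k m) s) \<longlonglongrightarrow> 1" for s
  proof -
    have "(\<lambda>m. cutoff (k m) s) \<longlonglongrightarrow> max 0 (1 - 0 * s)"
      unfolding cutoff_def by (intro tendsto_intros k0)
    then show ?thesis by simp
  qed
  have Xb: "0 \<le> cutoff (k m) (y \<bullet> y)" "cutoff (k m) (y \<bullet> y) \<le> 1" for m and y :: 'a
    using k[of m] by (auto simp: cutoff_def)
  have L: "(\<lambda>m. \<integral>y. cut_kernel q \<epsilon> (k m) (y \<bullet> y) * lin_trace (H y) \<partial>lborel)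
      \<longlonglongrightarrow> (\<integral>y. reg_kernel q \<epsilon> (y \<bullet> y) * lin_trace (H y) \<partial>lborel)"
  proof (rule integral_dominated_convergence)
    show "integrable lborel (\<lambda>y. reg_kernel q \<epsilon> 0 * \<bar>lin_trace (H y)\<bar>)" using int by simp
    show "(\<lambda>y. reg_kernel q \<epsilon> (y \<bullet> y) * lin_trace (H y)) \<in> borel_measurable lborel"
      using borel_measurable_continuous_onI[OF continuous_on_mult[OF cG tH]] by simp
    show "(\<lambda>y. cut_kernel q \<epsilon> (k m) (y \<bullet> y) * lin_trace (H y)) \<in> borel_measurable lborel" for m
      using borel_measurable_continuous_onI[OF continuous_on_mult[OF has_hessian_continuous_on[OF hess] tH]] by simp
    show "AE y in lborel. (\<lambda>m. cut_kernel q \<epsilon> (k m) (y \<bullet> y) * lin_trace (H y)) \<longlonglongrightarrow> reg_kernel q \<epsilon> (y \<bullet> y) * lin_trace (H y)"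
    proof (rule AE_I2)
      fix y :: 'a
      have "(\<lambda>m. reg_kernel q \<epsilon> (y \<bullet> y) * cutoff (k m) (y \<bullet> y) ^ 3 * lin_trace (H y)) \<longlonglongrightarrow> reg_kernel q \<epsilon> (y \<bullet> y) * 1 ^ 3 * lin_trace (H y)"
        by (intro tendsto_intros X1)
      then show "(\<lambda>m. cut_kernel q \<epsilon> (k m) (y \<bullet> y) * lin_trace (H y)) \<longlonglongrightarrow> reg_kernel q \<epsilon> (y \<bullet> y) * lin_trace (H y)"
        by (simp add: cut_kernel_def)
    qed
    show "AE y in lborel. norm (cut_kernel q \<epsilon> (k m) (y \<bullet> y) * lin_trace (H y)) \<le> reg_kernel q \<epsilon> 0 * \<bar>lin_trace (H y)\<bar>" for m
    proof (rule AE_I2)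
      fix y :: 'a
      have G: "reg_kernel q \<epsilon> (y \<bullet> y) \<le> reg_kernel q \<epsilon> 0"
        unfolding reg_kernel_def using e q0 by (intro powr_mono2') auto
      have "\<bar>cut_kernel q \<epsilon> (k m) (y \<bullet> y)\<bar> = reg_kernel q \<epsilon> (y \<bullet> y) * cutoff (k m) (y \<bullet> y) ^ 3"
        using Xb(1)[of m y] by (simp add: cut_kernel_def abs_mult reg_kernel_def)
      also have "\<dots> \<le> reg_kernel q \<epsilon> 0 * 1"
        using G Xb[of m y] by (intro mult_mono) (auto simp: reg_kernel_def power_le_one)
      finally show "norm (cut_kernel q \<epsilon> (k m) (y \<bullet> y) * lin_trace (H y)) \<le> reg_kernel q \<epsilon> 0 * \<bar>lin_trace (H y)\<bar>"
        by (simp add: abs_mult mult_right_mono)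
    qed
  qed
  define C where "C = reg_kernel q \<epsilon> 0 * (4 * q * (q + 1) / \<epsilon>\<^sup>2 + 12 * (2 * q + 2) + 48 * q + 48)"
  have A0: "A \<ge> 0" using order_trans[OF abs_ge_zero A[of 0]] by simp
  have R: "(\<lambda>m. \<integral>y. w y * lin_trace (Q m y) \<partial>lborel)
      \<longlonglongrightarrow> (\<integral>y. - (4 * q * (q + 1) * \<epsilon>\<^sup>2 * (reg_kernel q \<epsilon> (y \<bullet> y) / (y \<bullet> y + \<epsilon>\<^sup>2)\<^sup>2) * w y) \<partial>lborel)"
  proof (rule integral_dominated_convergence)
    \<comment> \<open>The kernel's Laplacian contributes q + 1 and the decay of w contributes 1/2;
      twice the sum is n + 1.\<close>
    have "integrable lborel (\<lambda>y::'a. (1 + y \<bullet> y) powr (- (q + 3 / 2)))"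
      by (rule integrable_powr_decay) (simp add: n)
    then show "integrable lborel (\<lambda>y::'a. A * C * (1 + y \<bullet> y) powr (- (q + 3 / 2)))" by simp
    have c: "continuous_on UNIV (\<lambda>y. - (4 * q * (q + 1) * \<epsilon>\<^sup>2 * (reg_kernel q \<epsilon> (y \<bullet> y) / (y \<bullet> y + \<epsilon>\<^sup>2)\<^sup>2) * w y))"
      using pos by (intro continuous_intros cG cw) (auto simp: less_imp_neq[symmetric])
    show "(\<lambda>y. - (4 * q * (q + 1) * \<epsilon>\<^sup>2 * (reg_kernel q \<epsilon> (y \<bullet> y) / (y \<bullet> y + \<epsilon>\<^sup>2)\<^sup>2) * w y)) \<in> borel_measurable lborel"
      using borel_measurable_continuous_onI[OF c] by simp
    show "(\<lambda>y. w y * lin_trace (Q m y)) \<in> borel_measurable lborel" for m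
      using borel_measurable_continuous_onI[OF continuous_on_mult[OF cw ctQ]] by simp
    show "AE y in lborel. (\<lambda>m. w y * lin_trace (Q m y)) \<longlonglongrightarrow>
       - (4 * q * (q + 1) * \<epsilon>\<^sup>2 * (reg_kernel q \<epsilon> (y \<bullet> y) / (y \<bullet> y + \<epsilon>\<^sup>2)\<^sup>2) * w y)"
    proof (rule AE_I2)
      fix y :: 'a
      define s where "s = y \<bullet> y"
      define N where "N = s + \<epsilon>\<^sup>2"
      define G where "G = reg_kernel q \<epsilon> s"
      have N: "N > 0" using pos[of y] by (simp add: N_def s_def)
      have "(\<lambda>m. w y * lin_trace (Q m y)) \<longlonglongrightarrow>
        w y * (2 * (2 * q + 2) * (- (q * (G / N) * 1 ^ 3) - 3 * 0 * G * 1 ^ 2)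
         + 4 * s * (q * (q + 1) * (G / N\<^sup>2) * 1 ^ 3 + 6 * 0 * q * (G / N) * 1 ^ 2 + 6 * 0\<^sup>2 * G * 1))"
        unfolding tQ cut_kernel'_def cut_kernel''_def s_def[symmetric] N_def[symmetric] G_def[symmetric]
        by (intro tendsto_intros X1 k0)
      also have "w y * (2 * (2 * q + 2) * (- (q * (G / N) * 1 ^ 3) - 3 * 0 * G * 1 ^ 2)
         + 4 * s * (q * (q + 1) * (G / N\<^sup>2) * 1 ^ 3 + 6 * 0 * q * (G / N) * 1 ^ 2 + 6 * 0\<^sup>2 * G * 1))
         = - (4 * q * (q + 1) * (N - s) * (G / N\<^sup>2) * w y)"
        using N by (simp add: field_simps power2_eq_square)
      also have "N - s = \<epsilon>\<^sup>2" by (simp add: N_def)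
      finally show "(\<lambda>m. w y * lin_trace (Q m y)) \<longlonglongrightarrow>
         - (4 * q * (q + 1) * \<epsilon>\<^sup>2 * (reg_kernel q \<epsilon> (y \<bullet> y) / (y \<bullet> y + \<epsilon>\<^sup>2)\<^sup>2) * w y)"
        by (simp add: N_def G_def s_def)
    qed
    show "AE y in lborel. norm (w y * lin_trace (Q m y)) \<le> A * C * (1 + y \<bullet> y) powr (- (q + 3 / 2))" for m
    proof (rule AE_I2)
      fix y :: 'a
      have "\<bar>lin_trace (Q m y)\<bar> \<le> C * (1 + y \<bullet> y) powr (- q - 1)"
        unfolding tQ C_def using e k q0 by (intro cut_kernel_laplacian_bound) auto
      then have "\<bar>w y\<bar> * \<bar>lin_trace (Q m y)\<bar> \<le> A * (1 + y \<bullet> y) powr (- 1 / 2) * (C * (1 + y \<bullet> y) powr (- q - 1))"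
        using A[of y] A0 by (intro mult_mono) auto
      also have "\<dots> = A * C * ((1 + y \<bullet> y) powr (- 1 / 2) * (1 + y \<bullet> y) powr (- q - 1))" by simp
      also have "(1 + y \<bullet> y) powr (- 1 / 2) * (1 + y \<bullet> y) powr (- q - 1) = (1 + y \<bullet> y) powr (- (q + 3 / 2))"
        by (simp add: powr_add[symmetric] algebra_simps)
      finally show "norm (w y * lin_trace (Q m y)) \<le> A * C * (1 + y \<bullet> y) powr (- (q + 3 / 2))"
        by (simp add: abs_mult)
    qed
  qed
  show ?thesis
    using LIMSEQ_unique[OF L R[folded Green]] by simp
qed

text \<open>The integral of minus the Laplacian of the kernel; it does not depend on \<open>\<epsilon>\<close>.\<close>

definition newton_mass :: "'a::euclidean_space itself \<Rightarrow> real" where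
  "newton_mass _ = (\<integral>(z::'a). 4 * ((real DIM('a) - 2) / 2) * (real DIM('a) / 2) *
     (1 + z \<bullet> z) powr (- (real DIM('a) + 2) / 2) \<partial>lborel)"

lemma newton_mass_pos:
  assumes "DIM('a::euclidean_space) \<ge> 3"
  shows "newton_mass TYPE('a) > 0"
proof -
  let ?f = "\<lambda>z::'a. 4 * ((real DIM('a) - 2) / 2) * (real DIM('a) / 2) * (1 + z \<bullet> z) powr (- (real DIM('a) + 2) / 2)"
  have pos: "?f z > 0" for z
  proof -
    have "1 + z \<bullet> z > 0" by (simp add: add_pos_nonneg)
    then show ?thesis using assms by (auto intro!: mult_pos_pos)
  qed
  have int: "integrable lborel ?f"
    using integrable_powr_decay[where 'a='a, of "(real DIM('a) + 2) / 2"] by (simp add: minus_divide_left)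
  have "(\<integral>z. ?f z \<partial>lborel) \<noteq> 0"
  proof
    assume "(\<integral>z. ?f z \<partial>lborel) = 0"
    then have "AE z in lborel. ?f z = 0"
      using integral_nonneg_eq_0_iff_AE[OF int] pos by (auto intro: less_imp_le)
    then have "AE z in (lborel::'a measure). False"
      by (rule eventually_mono) (metis pos less_irrefl)
    then show False using ae_filter_eq_bot_iff[of "lborel::'a measure"] by (simp add: trivial_limit_def)
  qed
  moreover have "(\<integral>z. ?f z \<partial>lborel) \<ge> 0" using pos by (intro integral_nonneg_AE) (auto intro: less_imp_le)
  ultimately show ?thesis by (simp add: newton_mass_def less_le)
qed

text \<open>Substituting y = \<epsilon> z makes the weight independent of \<epsilon> and moves
  \<epsilon> into the argument of w. The powers of \<epsilon> cancel because n + 2 - 2 (q + 2) = 0.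
  Continuity of w at 0 and its boundedness then give the limit.\<close>

lemma newton_representation_0:
  fixes w :: "'a::euclidean_space \<Rightarrow> real"
  assumes dim: "DIM('a) \<ge> 3" and w: "has_hessian w g H UNIV"
    and cH: "\<And>i. i \<in> Basis \<Longrightarrow> continuous_on UNIV (\<lambda>x. H x i \<bullet> i)"
    and A: "\<And>y. \<bar>w y\<bar> \<le> A * (1 + y \<bullet> y) powr (- 1 / 2)"
    and int: "integrable lborel (\<lambda>y. lin_trace (H y))"
  shows "(\<lambda>m. \<integral>y. reg_kernel ((real DIM('a) - 2) / 2) (1 / real (Suc m)) (y \<bullet> y) * - lin_trace (H y) \<partial>lborel)
    \<longlonglongrightarrow> newton_mass TYPE('a) * w 0"
proof -
  define q where "q = (real DIM('a) - 2) / 2"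
  define K where "K = 4 * q * (q + 1)"
  have q0: "q > 0" using dim by (simp add: q_def)
  have n: "real DIM('a) = 2 * q + 2" by (simp add: q_def diff_divide_distrib)
  have cw: "continuous_on UNIV w" using w by (rule has_hessian_continuous_on)
  have mw[measurable]: "w \<in> borel_measurable borel" using cw by (rule borel_measurable_continuous_onI)
  have eq: "(\<integral>y. reg_kernel q \<epsilon> (y \<bullet> y) * - lin_trace (H y) \<partial>lborel)
     = (\<integral>z. K * (1 + z \<bullet> z) powr (- (q + 2)) * w (\<epsilon> *\<^sub>R z) \<partial>lborel)" if e: "0 < \<epsilon>" "\<epsilon> \<le> 1" for \<epsilon>
  proof -
    have "(\<integral>y. reg_kernel q \<epsilon> (y \<bullet> y) * - lin_trace (H y) \<partial>lborel) =
       (\<integral>y. K * \<epsilon>\<^sup>2 * (reg_kernel q \<epsilon> (y \<bullet> y) / (y \<bullet> y + \<epsilon>\<^sup>2)\<^sup>2) * w y \<partial>lborel)"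
      using integral_reg_kernel_lin_trace[OF dim w cH A int q_def e] by (simp add: K_def)
    also have "\<dots> = (\<integral>y. K * \<epsilon>\<^sup>2 * (y \<bullet> y + \<epsilon>\<^sup>2) powr (- (q + 2)) * w y \<partial>lborel)"
    proof (rule Bochner_Integration.integral_cong)
      fix y :: 'a
      have "y \<bullet> y + \<epsilon>\<^sup>2 > 0" using e by (simp add: add_nonneg_pos)
      then have "reg_kernel q \<epsilon> (y \<bullet> y) / (y \<bullet> y + \<epsilon>\<^sup>2)\<^sup>2 = (y \<bullet> y + \<epsilon>\<^sup>2) powr (- (q + 2))"
        by (simp add: reg_kernel_def powr_diff)
      then show "K * \<epsilon>\<^sup>2 * (reg_kernel q \<epsilon> (y \<bullet> y) / (y \<bullet> y + \<epsilon>\<^sup>2)\<^sup>2) * w y = K * \<epsilon>\<^sup>2 * (y \<bullet> y + \<epsilon>\<^sup>2) powr (- (q + 2)) * w y"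
        by simp
    qed simp
    also have "\<dots> = \<epsilon> ^ DIM('a) * (\<integral>z. K * \<epsilon>\<^sup>2 * ((\<epsilon> *\<^sub>R z) \<bullet> (\<epsilon> *\<^sub>R z) + \<epsilon>\<^sup>2) powr (- (q + 2)) * w (\<epsilon> *\<^sub>R z) \<partial>lborel)"
      using e by (intro lborel_integral_scale) measurable
    also have "\<dots> = (\<integral>z. \<epsilon> ^ DIM('a) * (K * \<epsilon>\<^sup>2 * ((\<epsilon> *\<^sub>R z) \<bullet> (\<epsilon> *\<^sub>R z) + \<epsilon>\<^sup>2) powr (- (q + 2)) * w (\<epsilon> *\<^sub>R z)) \<partial>lborel)"
      by simp
    also have "\<dots> = (\<integral>z. K * (1 + z \<bullet> z) powr (- (q + 2)) * w (\<epsilon> *\<^sub>R z) \<partial>lborel)"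
    proof (rule Bochner_Integration.integral_cong)
      fix z :: 'a
      have "((\<epsilon> *\<^sub>R z) \<bullet> (\<epsilon> *\<^sub>R z) + \<epsilon>\<^sup>2) = \<epsilon> powr 2 * (1 + z \<bullet> z)"
        using e by (simp add: algebra_simps power2_eq_square)
      moreover have "0 \<le> z \<bullet> z" by simp
      ultimately have "((\<epsilon> *\<^sub>R z) \<bullet> (\<epsilon> *\<^sub>R z) + \<epsilon>\<^sup>2) powr (- (q + 2)) = \<epsilon> powr (2 * - (q + 2)) * (1 + z \<bullet> z) powr (- (q + 2))"
        using e by (simp only: powr_mult powr_powr)
      moreover have "\<epsilon> ^ DIM('a) * \<epsilon>\<^sup>2 * \<epsilon> powr (2 * - (q + 2)) = 1"
      proof -
        have "\<epsilon> ^ DIM('a) = \<epsilon> powr (2 * q + 2)" using e by (simp add: powr_realpow[symmetric] n)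
        moreover have "\<epsilon>\<^sup>2 = \<epsilon> powr 2" using e by simp
        ultimately show ?thesis using e by (simp only: powr_add[symmetric]) simp
      qed
      ultimately have "\<epsilon> ^ DIM('a) * \<epsilon>\<^sup>2 * ((\<epsilon> *\<^sub>R z) \<bullet> (\<epsilon> *\<^sub>R z) + \<epsilon>\<^sup>2) powr (- (q + 2)) = (1 + z \<bullet> z) powr (- (q + 2))"
        by (simp only: mult.assoc[symmetric] mult_1)
      then have E: "(1 + z \<bullet> z) powr (- (q + 2)) = \<epsilon> ^ DIM('a) * \<epsilon>\<^sup>2 * ((\<epsilon> *\<^sub>R z) \<bullet> (\<epsilon> *\<^sub>R z) + \<epsilon>\<^sup>2) powr (- (q + 2))" ..
      show "\<epsilon> ^ DIM('a) * (K * \<epsilon>\<^sup>2 * ((\<epsilon> *\<^sub>R z) \<bullet> (\<epsilon> *\<^sub>R z) + \<epsilon>\<^sup>2) powr (- (q + 2)) * w (\<epsilon> *\<^sub>R z))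
         = K * (1 + z \<bullet> z) powr (- (q + 2)) * w (\<epsilon> *\<^sub>R z)"
        unfolding E by (simp only: mult_ac)
    qed simp
    finally show ?thesis .
  qed
  have A0: "A \<ge> 0" using order_trans[OF abs_ge_zero A[of 0]] by simp
  have wb: "\<bar>w y\<bar> \<le> A" for y
  proof -
    have "(1 + y \<bullet> y) powr (- 1 / 2) \<le> 1 powr (- 1 / 2)" by (intro powr_mono2') auto
    then show ?thesis using A[of y] A0 mult_left_mono[of "(1 + y \<bullet> y) powr (- 1 / 2)" 1 A] by simp
  qed
  have i: "integrable lborel (\<lambda>z::'a. (1 + z \<bullet> z) powr (- (q + 2)))"
    by (rule integrable_powr_decay) (simp add: n)
  have "(\<lambda>m. \<integral>z. K * (1 + z \<bullet> z) powr (- (q + 2)) * w ((1 / real (Suc m)) *\<^sub>R z) \<partial>lborel)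
    \<longlonglongrightarrow> (\<integral>(z::'a). K * (1 + z \<bullet> z) powr (- (q + 2)) * w 0 \<partial>lborel)"
  proof (rule integral_dominated_convergence)
    show "integrable lborel (\<lambda>z::'a. K * A * (1 + z \<bullet> z) powr (- (q + 2)))" using i by simp
    show "AE z in lborel. (\<lambda>m. K * (1 + z \<bullet> z) powr (- (q + 2)) * w ((1 / real (Suc m)) *\<^sub>R z))
      \<longlonglongrightarrow> K * (1 + z \<bullet> z) powr (- (q + 2)) * w 0"
    proof (rule AE_I2)
      fix z :: 'a
      have "(\<lambda>m. (1 / real (Suc m)) *\<^sub>R z) \<longlonglongrightarrow> 0 *\<^sub>R z"
        using LIMSEQ_inverse_real_of_nat by (intro tendsto_intros) (simp add: inverse_eq_divide)
      then have "(\<lambda>m. w ((1 / real (Suc m)) *\<^sub>R z)) \<longlonglongrightarrow> w 0"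
        using continuous_on_tendsto_compose[OF cw] by (simp del: of_nat_Suc)
      then show "(\<lambda>m. K * (1 + z \<bullet> z) powr (- (q + 2)) * w ((1 / real (Suc m)) *\<^sub>R z))
        \<longlonglongrightarrow> K * (1 + z \<bullet> z) powr (- (q + 2)) * w 0"
        by (intro tendsto_intros)
    qed
    show "AE z in lborel. norm (K * (1 + z \<bullet> z) powr (- (q + 2)) * w ((1 / real (Suc m)) *\<^sub>R z))
       \<le> K * A * (1 + z \<bullet> z) powr (- (q + 2))" for m
    proof (rule AE_I2)
      fix z :: 'a
      have "K * (1 + z \<bullet> z) powr (- (q + 2)) * \<bar>w ((1 / real (Suc m)) *\<^sub>R z)\<bar> \<le> K * (1 + z \<bullet> z) powr (- (q + 2)) * A"
        using wb q0 by (intro mult_left_mono) (auto simp: K_def)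
      then show "norm (K * (1 + z \<bullet> z) powr (- (q + 2)) * w ((1 / real (Suc m)) *\<^sub>R z))
       \<le> K * A * (1 + z \<bullet> z) powr (- (q + 2))"
        using q0 by (simp add: abs_mult K_def mult_ac)
    qed
  qed measurable
  moreover have "(\<integral>(z::'a). K * (1 + z \<bullet> z) powr (- (q + 2)) * w 0 \<partial>lborel) = newton_mass TYPE('a) * w 0"
  proof -
    have 1: "- (real DIM('a) + 2) / 2 = - (q + 2)" and 2: "4 * ((real DIM('a) - 2) / 2) * (real DIM('a) / 2) = K"
      by (auto simp: n K_def field_simps)
    show ?thesis unfolding newton_mass_def 1 2 by simp
  qed
  moreover have "(\<integral>y. reg_kernel q (1 / real (Suc m)) (y \<bullet> y) * - lin_trace (H y) \<partial>lborel)
    = (\<integral>z. K * (1 + z \<bullet> z) powr (- (q + 2)) * w ((1 / real (Suc m)) *\<^sub>R z) \<partial>lborel)" for m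
    by (rule eq) auto
  ultimately show ?thesis unfolding q_def[symmetric] by (simp only:)
qed

lemma newton_representation:
  fixes w :: "'a::euclidean_space \<Rightarrow> real"
  assumes dim: "DIM('a) \<ge> 3" and w: "has_hessian w g H UNIV"
    and cH: "\<And>i. i \<in> Basis \<Longrightarrow> continuous_on UNIV (\<lambda>x. H x i \<bullet> i)"
    and A: "\<And>y. \<bar>w y\<bar> \<le> A * (1 + y \<bullet> y) powr (- 1 / 2)"
    and int: "integrable lborel (\<lambda>y. lin_trace (H y))"
  shows "(\<lambda>m. \<integral>y. reg_kernel ((real DIM('a) - 2) / 2) (1 / real (Suc m)) ((y - x) \<bullet> (y - x)) * - lin_trace (H y) \<partial>lborel)
    \<longlonglongrightarrow> newton_mass TYPE('a) * w x"
proof -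
  have tH: "continuous_on UNIV (\<lambda>x. lin_trace (H x))"
    unfolding lin_trace_def by (auto intro!: continuous_on_sum cH)
  then have mt[measurable]: "(\<lambda>x. lin_trace (H x)) \<in> borel_measurable borel"
    by (rule borel_measurable_continuous_onI)
  have A0: "A \<ge> 0" using order_trans[OF abs_ge_zero A[of 0]] by simp
  have "(\<lambda>m. \<integral>y. reg_kernel ((real DIM('a) - 2) / 2) (1 / real (Suc m)) (y \<bullet> y) * - lin_trace (H (x + y)) \<partial>lborel)
    \<longlonglongrightarrow> newton_mass TYPE('a) * w (x + 0)"
  proof (rule newton_representation_0[OF dim has_hessian_shift[OF w]])
    show "continuous_on UNIV (\<lambda>y. H (x + y) i \<bullet> i)" if "i \<in> Basis" for i
      by (rule continuous_on_compose2[OF cH[OF that]]) (auto intro!: continuous_intros)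
    show "integrable lborel (\<lambda>y. lin_trace (H (x + y)))"
      using int lborel_integral_shift(2)[of "\<lambda>y. lin_trace (H y)" x] by simp
    show "\<bar>w (x + y)\<bar> \<le> A * (2 * (1 + x \<bullet> x)) powr (1 / 2) * (1 + y \<bullet> y) powr (- 1 / 2)" for y
    proof -
      have pp: "1 + z \<bullet> z > 0" for z :: 'a by (simp add: add_pos_nonneg)
      \<comment> \<open>This is |y|^2 \<le> 2 |x|^2 + 2 |x + y|^2. Consequently a translation by x
        costs only the constant factor 2 (1 + |x|^2) in the weight.\<close>
      have "0 \<le> (x + (x + y)) \<bullet> (x + (x + y))" by simp
      then have "y \<bullet> y \<le> 2 * (x \<bullet> x) + 2 * ((x + y) \<bullet> (x + y))"
        by (simp add: inner_add_left inner_add_right inner_commute)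
      moreover have "0 \<le> (x \<bullet> x) * ((x + y) \<bullet> (x + y))" by simp
      moreover have gen: "2 * (1 + a) * (1 + b) = 2 + 2 * a + 2 * b + 2 * (a * b)" for a b :: real
        by (simp add: algebra_simps)
      have "2 * (1 + x \<bullet> x) * (1 + (x + y) \<bullet> (x + y))
          = 2 + 2 * (x \<bullet> x) + 2 * ((x + y) \<bullet> (x + y)) + 2 * ((x \<bullet> x) * ((x + y) \<bullet> (x + y)))"
        by (rule gen)
      ultimately have "1 + y \<bullet> y \<le> 2 * (1 + x \<bullet> x) * (1 + (x + y) \<bullet> (x + y))"
        by linarith
      then have "(2 * (1 + x \<bullet> x) * (1 + (x + y) \<bullet> (x + y))) powr (- 1 / 2) \<le> (1 + y \<bullet> y) powr (- 1 / 2)"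
        using pp by (intro powr_mono2') auto
      moreover have "(2 * (1 + x \<bullet> x) * (1 + (x + y) \<bullet> (x + y))) powr (- 1 / 2)
         = (2 * (1 + x \<bullet> x)) powr (- 1 / 2) * (1 + (x + y) \<bullet> (x + y)) powr (- 1 / 2)"
        using pp[of x] pp[of "x + y"] by (intro powr_mult) 
      ultimately have "(2 * (1 + x \<bullet> x)) powr (1 / 2) * ((2 * (1 + x \<bullet> x)) powr (- 1 / 2) * (1 + (x + y) \<bullet> (x + y)) powr (- 1 / 2))
         \<le> (2 * (1 + x \<bullet> x)) powr (1 / 2) * (1 + y \<bullet> y) powr (- 1 / 2)"
        by (intro mult_left_mono) auto
      moreover have "(2 * (1 + x \<bullet> x)) powr (1 / 2) * (2 * (1 + x \<bullet> x)) powr (- 1 / 2) = 1"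
        using pp[of x] by (simp add: powr_add[symmetric])
      ultimately have "(1 + (x + y) \<bullet> (x + y)) powr (- 1 / 2) \<le> (2 * (1 + x \<bullet> x)) powr (1 / 2) * (1 + y \<bullet> y) powr (- 1 / 2)"
        by (simp add: mult.assoc[symmetric])
      then have "A * (1 + (x + y) \<bullet> (x + y)) powr (- 1 / 2) \<le> A * ((2 * (1 + x \<bullet> x)) powr (1 / 2) * (1 + y \<bullet> y) powr (- 1 / 2))"
        using A0 by (rule mult_left_mono)
      then show ?thesis using A[of "x + y"] by (simp add: mult.assoc)
    qed
  qed
  moreover have "(\<integral>y. reg_kernel ((real DIM('a) - 2) / 2) e (y \<bullet> y) * - lin_trace (H (x + y)) \<partial>lborel)
     = (\<integral>y. reg_kernel ((real DIM('a) - 2) / 2) e ((y - x) \<bullet> (y - x)) * - lin_trace (H y) \<partial>lborel)" for e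
    using lborel_integral_shift(1)[of "\<lambda>y. reg_kernel ((real DIM('a) - 2) / 2) e ((y - x) \<bullet> (y - x)) * - lin_trace (H y)" x]
    by (simp add: reg_kernel_def)
  ultimately show ?thesis by simp
qed

section \<open>Potential expansion at infinity\<close>

lemma DERIV_inner_powr:
  fixes a b :: "'a::euclidean_space"
  assumes "\<epsilon> > 0"
  shows "((\<lambda>t. ((a + t *\<^sub>R b) \<bullet> (a + t *\<^sub>R b) + \<epsilon>\<^sup>2) powr p) has_real_derivative
    2 * p * ((a + t *\<^sub>R b) \<bullet> b) * ((a + t *\<^sub>R b) \<bullet> (a + t *\<^sub>R b) + \<epsilon>\<^sup>2) powr (p - 1)) (at t)"
proof -
  have l: "((\<lambda>t. a + t *\<^sub>R b) has_derivative (\<lambda>h. h *\<^sub>R b)) (at t)"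
    by (auto intro!: derivative_eq_intros)
  have "((\<lambda>t. (a + t *\<^sub>R b) \<bullet> (a + t *\<^sub>R b) + \<epsilon>\<^sup>2) has_derivative
      (\<lambda>h. h * (2 * ((a + t *\<^sub>R b) \<bullet> b)))) (at t)"
    by (rule derivative_eq_intros l refl)+ (auto simp: inner_commute algebra_simps)
  then have "((\<lambda>t. (a + t *\<^sub>R b) \<bullet> (a + t *\<^sub>R b) + \<epsilon>\<^sup>2) has_real_derivative 2 * ((a + t *\<^sub>R b) \<bullet> b)) (at t)"
    by (simp add: has_field_derivative_def mult_commute_abs)
  moreover have "(a + t *\<^sub>R b) \<bullet> (a + t *\<^sub>R b) + \<epsilon>\<^sup>2 > 0" using assms by (simp add: add_nonneg_pos)
  ultimately show ?thesis
    by (rule DERIV_fun_powr[THEN DERIV_cong]) simp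
qed

lemma DERIV_line_inner:
  "((\<lambda>t. (a + t *\<^sub>R b) \<bullet> y) has_real_derivative (b \<bullet> y)) (at t)"
  by (auto intro!: derivative_eq_intros simp: inner_add_left)

text \<open>Mean value theorem; the derivative at the intermediate point is bounded by its value at
  the smaller end, and summing both ends keeps the bound symmetric.\<close>

lemma powr_diff_le:
  fixes \<alpha> \<beta> q :: real
  assumes "0 < \<alpha>" "0 < \<beta>" "0 \<le> q"
  shows "\<bar>\<alpha> powr (- (2 * q)) - \<beta> powr (- (2 * q))\<bar> \<le> 2 * q * \<bar>\<alpha> - \<beta>\<bar> * (\<alpha> powr (- (2 * q) - 1) + \<beta> powr (- (2 * q) - 1))"
proof -
  have *: "\<bar>\<alpha> powr (- (2 * q)) - \<beta> powr (- (2 * q))\<bar> \<le> 2 * q * \<bar>\<alpha> - \<beta>\<bar> * (\<alpha> powr (- (2 * q) - 1) + \<beta> powr (- (2 * q) - 1))"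
    if "0 < \<alpha>" "\<alpha> < \<beta>" for \<alpha> \<beta>
  proof -
    have "((\<lambda>t. t powr (- (2 * q))) has_real_derivative (- (2 * q) * t powr (- (2 * q) - 1))) (at t)" if "t > 0" for t :: real
      using that by (auto intro!: derivative_eq_intros)
    then obtain z where z: "\<alpha> < z" "z < \<beta>"
      "\<beta> powr (- (2 * q)) - \<alpha> powr (- (2 * q)) = (\<beta> - \<alpha>) * (- (2 * q) * z powr (- (2 * q) - 1))"
      using MVT2[OF \<open>\<alpha> < \<beta>\<close>, of "\<lambda>t. t powr (- (2 * q))" "\<lambda>t. - (2 * q) * t powr (- (2 * q) - 1)"] \<open>0 < \<alpha>\<close> by auto
    have "z powr (- (2 * q) - 1) \<le> \<alpha> powr (- (2 * q) - 1)" using z that assms by (intro powr_mono2') auto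
    then have zz: "z powr (- (2 * q) - 1) \<le> \<alpha> powr (- (2 * q) - 1) + \<beta> powr (- (2 * q) - 1)"
      by (simp add: add_increasing2)
    have "\<bar>\<alpha> powr (- (2 * q)) - \<beta> powr (- (2 * q))\<bar> = \<bar>(\<beta> - \<alpha>) * (- (2 * q) * z powr (- (2 * q) - 1))\<bar>"
      unfolding z(3)[symmetric] by (rule abs_minus_commute)
    also have "\<dots> = 2 * q * \<bar>\<alpha> - \<beta>\<bar> * z powr (- (2 * q) - 1)" using assms that by (simp add: abs_mult)
    also have "\<dots> \<le> 2 * q * \<bar>\<alpha> - \<beta>\<bar> * (\<alpha> powr (- (2 * q) - 1) + \<beta> powr (- (2 * q) - 1))"
      using zz assms by (intro mult_left_mono) auto
    finally show ?thesis .
  qed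
  consider "\<alpha> < \<beta>" | "\<alpha> = \<beta>" | "\<beta> < \<alpha>" by linarith
  then show ?thesis
    by cases (use *[of \<alpha> \<beta>] *[of \<beta> \<alpha>] assms in \<open>auto simp: abs_minus_commute add.commute\<close>)
qed

text \<open>In one more dimension the regularised kernel is a pure power of the norm of (a,
  \<epsilon>). Estimates for pure powers apply, and \<open>norm (a, \<epsilon>) \<ge> norm a\<close>
  removes \<epsilon> from them.\<close>

lemma reg_kernel_norm_Pair:
  assumes "\<epsilon> > 0"
  shows "reg_kernel q \<epsilon> (a \<bullet> a) = norm (a::'a::euclidean_space, \<epsilon>) powr (- (2 * q))"
proof -
  have p: "a \<bullet> a + \<epsilon>\<^sup>2 > 0" using assms by (simp add: add_nonneg_pos)
  have "norm (a, \<epsilon>) = (a \<bullet> a + \<epsilon>\<^sup>2) powr (1 / 2)"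
    using p by (simp add: norm_Pair power2_norm_eq_inner powr_half_sqrt)
  then show ?thesis using p by (simp add: reg_kernel_def powr_powr)
qed

lemma reg_kernel_lipschitz:
  fixes a b :: "'a::euclidean_space"
  assumes "\<epsilon> > 0" "q \<ge> 0" "a \<noteq> 0" "b \<noteq> 0"
  shows "\<bar>reg_kernel q \<epsilon> (a \<bullet> a) - reg_kernel q \<epsilon> (b \<bullet> b)\<bar>
    \<le> 2 * q * norm (a - b) * (norm a powr (- (2 * q) - 1) + norm b powr (- (2 * q) - 1))"
proof -
  have pos: "norm (c, \<epsilon>) > 0" for c :: 'a using assms by (simp add: norm_Pair add_nonneg_pos)
  have "\<bar>norm (a, \<epsilon>) - norm (b, \<epsilon>)\<bar> \<le> norm ((a, \<epsilon>) - (b, \<epsilon>))" by (rule norm_triangle_ineq3)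
  then have 1: "\<bar>norm (a, \<epsilon>) - norm (b, \<epsilon>)\<bar> \<le> norm (a - b)" by (simp add: norm_Pair)
  have 2: "norm (c, \<epsilon>) powr (- (2 * q) - 1) \<le> norm c powr (- (2 * q) - 1)" if "c \<noteq> 0" for c :: 'a
    using that assms by (intro powr_mono2') (auto simp: norm_Pair intro: real_le_rsqrt)
  have "\<bar>reg_kernel q \<epsilon> (a \<bullet> a) - reg_kernel q \<epsilon> (b \<bullet> b)\<bar> \<le>
    2 * q * \<bar>norm (a, \<epsilon>) - norm (b, \<epsilon>)\<bar> * (norm (a, \<epsilon>) powr (- (2 * q) - 1) + norm (b, \<epsilon>) powr (- (2 * q) - 1))"
    unfolding reg_kernel_norm_Pair[OF assms(1)] by (rule powr_diff_le[OF pos pos assms(2)])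
  also have "\<dots> \<le> 2 * q * norm (a - b) * (norm a powr (- (2 * q) - 1) + norm b powr (- (2 * q) - 1))"
    using 1 2 assms by (intro mult_mono add_mono) auto
  finally show ?thesis .
qed

text \<open>The first derivative at t = 0 of the kernel at \<xi> - t y, that is, the dipole term of
  its expansion in y. \<open>reg_kernel_d2\<close> is the second derivative, the quadrupole
  term.\<close>

definition reg_kernel_d1 :: "real \<Rightarrow> real \<Rightarrow> 'a::euclidean_space \<Rightarrow> 'a \<Rightarrow> real" where
  "reg_kernel_d1 q \<epsilon> y \<xi> = 2 * q * (\<xi> \<bullet> y) * (\<xi> \<bullet> \<xi> + \<epsilon>\<^sup>2) powr (- q - 1)"

definition reg_kernel_d2 :: "real \<Rightarrow> real \<Rightarrow> 'a::euclidean_space \<Rightarrow> 'a \<Rightarrow> real" where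
  "reg_kernel_d2 q \<epsilon> y \<xi> = 4 * q * (q + 1) * (\<xi> \<bullet> y)\<^sup>2 * (\<xi> \<bullet> \<xi> + \<epsilon>\<^sup>2) powr (- q - 2)
     - 2 * q * (y \<bullet> y) * (\<xi> \<bullet> \<xi> + \<epsilon>\<^sup>2) powr (- q - 1)"

lemma abs_inner_mult_le:
  fixes x y :: "'a::euclidean_space"
  shows "\<bar>x \<bullet> y\<bar> \<le> norm x * norm y"
  by (rule Cauchy_Schwarz_ineq2)

text \<open>Each factor |\<xi>| is absorbed by the square root of
  \<open>\<xi> \<bullet> \<xi> + \<epsilon>\<^sup>2\<close>, leaving the net homogeneity - p on a
  quantity at least \<rho>. The exponent k is given by an equation so that it can match the form
  produced by differentiation.\<close>

lemma mult_powr_le: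
  assumes "0 < \<rho>" "\<rho> \<le> norm (\<xi>::'a::euclidean_space)" "0 < \<epsilon>" "0 < p" "2 * k = - (p + real m)"
  shows "norm \<xi> ^ m * (\<xi> \<bullet> \<xi> + \<epsilon>\<^sup>2) powr k \<le> \<rho> powr (- p)"
proof -
  define N where "N = \<xi> \<bullet> \<xi> + \<epsilon>\<^sup>2"
  have k: "k = - (p + real m) / 2" using assms(5) by simp
  have N: "N > 0" "(norm \<xi>)\<^sup>2 \<le> N" using assms by (auto simp: N_def power2_norm_eq_inner add_nonneg_pos)
  have "norm \<xi> = ((norm \<xi>)\<^sup>2) powr (1 / 2)" by (simp add: powr_half_sqrt)
  also have "\<dots> \<le> N powr (1 / 2)" using N by (intro powr_mono2) auto
  finally have n: "norm \<xi> \<le> N powr (1 / 2)" .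
  have "norm \<xi> ^ m * N powr (- (p + real m) / 2) \<le> (N powr (1 / 2)) ^ m * N powr (- (p + real m) / 2)"
    using n by (intro mult_right_mono power_mono) auto
  also have "\<dots> = (N powr (1 / 2)) powr (- p)"
  proof -
    have "(N powr (1 / 2)) ^ m = N powr (real m / 2)" using N by (simp add: powr_realpow[symmetric] powr_powr)
    then show ?thesis using N by (simp add: powr_add[symmetric] powr_powr add_divide_distrib diff_divide_distrib)
  qed
  also have "\<dots> \<le> \<rho> powr (- p)" using assms n by (intro powr_mono2') auto
  finally show ?thesis by (simp add: N_def k)
qed

text \<open>Mean value theorem along the segment from x to x', which stays away from the origin. The
  aim is the factor \<open>norm (x' - x)\<close>: bounding both values separately would lose
  it.\<close>

lemma reg_kernel_d1_diff_le:
  fixes x x' y :: "'a::euclidean_space"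
  assumes e: "\<epsilon> > 0" and q: "q > 0" and \<rho>: "\<rho> > 0"
    and seg: "\<And>s. 0 \<le> s \<Longrightarrow> s \<le> 1 \<Longrightarrow> norm (x + s *\<^sub>R (x' - x)) \<ge> \<rho>"
  shows "\<bar>reg_kernel_d1 q \<epsilon> y x' - reg_kernel_d1 q \<epsilon> y x\<bar>
    \<le> (4 * q * (q + 1) + 2 * q) * norm (x' - x) * norm y * \<rho> powr (- (2 * q) - 2)"
proof -
  define d where "d = x' - x"
  define \<xi> where "\<xi> s = x + s *\<^sub>R d" for s
  define N where "N s = \<xi> s \<bullet> \<xi> s + \<epsilon>\<^sup>2" for s
  define D where "D s = 2 * q * (d \<bullet> y) * N s powr (- q - 1) + 2 * q * (\<xi> s \<bullet> y) * (2 * (- q - 1) * (\<xi> s \<bullet> d) * N s powr (- q - 1 - 1))" for s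
  have "((\<lambda>s. reg_kernel_d1 q \<epsilon> y (\<xi> s)) has_real_derivative D s) (at s)" for s
    unfolding reg_kernel_d1_def \<xi>_def D_def N_def
    by (rule derivative_eq_intros DERIV_line_inner DERIV_inner_powr e refl)+ (simp add: algebra_simps)
  then obtain s where s: "0 < s" "s < 1" "reg_kernel_d1 q \<epsilon> y (\<xi> 1) - reg_kernel_d1 q \<epsilon> y (\<xi> 0) = (1 - 0) * D s"
    using MVT2[of 0 1 "\<lambda>s. reg_kernel_d1 q \<epsilon> y (\<xi> s)" D] by auto
  have n: "\<rho> \<le> norm (\<xi> s)" using seg[of s] s by (simp add: \<xi>_def d_def)
  have i0: "N s powr (- q - 1) \<le> \<rho> powr (- (2 * q) - 2)"
    using mult_powr_le[OF \<rho> n e, of "2 * q + 2" "- q - 1" 0] q by (simp add: N_def)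
  have i1: "norm (\<xi> s) ^ 2 * N s powr (- q - 2) \<le> \<rho> powr (- (2 * q) - 2)"
    using mult_powr_le[OF \<rho> n e, of "2 * q + 2" "- q - 2" 2] q by (simp add: N_def)
  have "\<bar>D s\<bar> \<le> \<bar>2 * q * (d \<bullet> y) * N s powr (- q - 1)\<bar> + \<bar>2 * q * (\<xi> s \<bullet> y) * (2 * (- q - 1) * (\<xi> s \<bullet> d) * N s powr (- q - 1 - 1))\<bar>"
    unfolding D_def by (rule abs_triangle_ineq)
  also have "\<bar>2 * q * (d \<bullet> y) * N s powr (- q - 1)\<bar> \<le> 2 * q * (norm d * norm y) * \<rho> powr (- (2 * q) - 2)"
    unfolding abs_mult using q i0 abs_inner_mult_le[of d y] by (intro mult_mono) auto
  also have "\<bar>2 * q * (\<xi> s \<bullet> y) * (2 * (- q - 1) * (\<xi> s \<bullet> d) * N s powr (- q - 1 - 1))\<bar>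
      = 4 * q * (q + 1) * (\<bar>\<xi> s \<bullet> y\<bar> * \<bar>\<xi> s \<bullet> d\<bar> * N s powr (- q - 2))"
  proof -
    have "- q - 1 - 1 = - q - 2" "\<bar>- q - 1\<bar> = q + 1" using q by auto
    then show ?thesis using q by (simp only: abs_mult) simp
  qed
  also have "\<bar>\<xi> s \<bullet> y\<bar> * \<bar>\<xi> s \<bullet> d\<bar> * N s powr (- q - 2) \<le> (norm (\<xi> s) * norm y) * (norm (\<xi> s) * norm d) * N s powr (- q - 2)"
    by (intro mult_mono abs_inner_mult_le) auto
  also have "\<dots> = norm y * norm d * (norm (\<xi> s) ^ 2 * N s powr (- q - 2))" by (simp add: power2_eq_square)
  also have "\<dots> \<le> norm y * norm d * \<rho> powr (- (2 * q) - 2)" using i1 by (intro mult_left_mono) auto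
  finally have "\<bar>D s\<bar> \<le> 2 * q * (norm d * norm y) * \<rho> powr (- (2 * q) - 2) + 4 * q * (q + 1) * (norm y * norm d * \<rho> powr (- (2 * q) - 2))"
    using q by (simp add: mult_left_mono)
  also have "\<dots> = (4 * q * (q + 1) + 2 * q) * norm d * norm y * \<rho> powr (- (2 * q) - 2)" by (simp add: algebra_simps)
  finally show ?thesis using s by (simp add: \<xi>_def d_def)
qed

lemma reg_kernel_d2_diff_le:
  fixes x x' y :: "'a::euclidean_space"
  assumes e: "\<epsilon> > 0" and q: "q > 0" and \<rho>: "\<rho> > 0"
    and seg: "\<And>s. 0 \<le> s \<Longrightarrow> s \<le> 1 \<Longrightarrow> norm (x + s *\<^sub>R (x' - x)) \<ge> \<rho>"
  shows "\<bar>reg_kernel_d2 q \<epsilon> y x' - reg_kernel_d2 q \<epsilon> y x\<bar>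
    \<le> (8 * q * (q + 1) * (q + 2) + 12 * q * (q + 1)) * norm (x' - x) * (norm y)\<^sup>2 * \<rho> powr (- (2 * q) - 3)"
proof -
  define d where "d = x' - x"
  define \<xi> where "\<xi> s = x + s *\<^sub>R d" for s
  define N where "N s = \<xi> s \<bullet> \<xi> s + \<epsilon>\<^sup>2" for s
  define D1 where "D1 s = 8 * q * (q + 1) * ((\<xi> s \<bullet> y) * (d \<bullet> y) * N s powr (- q - 2))" for s
  define D2 where "D2 s = - (8 * q * (q + 1) * (q + 2)) * ((\<xi> s \<bullet> y)\<^sup>2 * (\<xi> s \<bullet> d) * N s powr (- q - 3))" for s
  define D3 where "D3 s = 4 * q * (q + 1) * ((y \<bullet> y) * (\<xi> s \<bullet> d) * N s powr (- q - 2))" for s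
  have "((\<lambda>s. reg_kernel_d2 q \<epsilon> y (\<xi> s)) has_real_derivative D1 s + D2 s + D3 s) (at s)" for s
    unfolding reg_kernel_d2_def \<xi>_def D1_def D2_def D3_def N_def
    by (rule derivative_eq_intros DERIV_line_inner DERIV_inner_powr e refl)+ (simp add: algebra_simps)
  then obtain s where s: "0 < s" "s < 1" "reg_kernel_d2 q \<epsilon> y (\<xi> 1) - reg_kernel_d2 q \<epsilon> y (\<xi> 0) = (1 - 0) * (D1 s + D2 s + D3 s)"
    using MVT2[of 0 1 "\<lambda>s. reg_kernel_d2 q \<epsilon> y (\<xi> s)" "\<lambda>s. D1 s + D2 s + D3 s"] by auto
  have n: "\<rho> \<le> norm (\<xi> s)" using seg[of s] s by (simp add: \<xi>_def d_def)
  let ?R = "\<rho> powr (- (2 * q) - 3)"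
  have i1: "norm (\<xi> s) * N s powr (- q - 2) \<le> ?R"
    using mult_powr_le[OF \<rho> n e, of "2 * q + 3" "- q - 2" 1] q by (simp add: N_def)
  have i3: "norm (\<xi> s) ^ 3 * N s powr (- q - 3) \<le> ?R"
    using mult_powr_le[OF \<rho> n e, of "2 * q + 3" "- q - 3" 3] q by (simp add: N_def)
  have 1: "\<bar>D1 s\<bar> \<le> 8 * q * (q + 1) * (norm d * (norm y)\<^sup>2 * ?R)"
  proof -
    have "\<bar>\<xi> s \<bullet> y\<bar> * \<bar>d \<bullet> y\<bar> * N s powr (- q - 2) \<le> (norm (\<xi> s) * norm y) * (norm d * norm y) * N s powr (- q - 2)"
      by (intro mult_mono abs_inner_mult_le) auto
    also have "\<dots> = norm d * (norm y)\<^sup>2 * (norm (\<xi> s) * N s powr (- q - 2))" by (simp add: power2_eq_square)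
    also have "\<dots> \<le> norm d * (norm y)\<^sup>2 * ?R" using i1 by (intro mult_left_mono) auto
    finally have "8 * q * (q + 1) * (\<bar>\<xi> s \<bullet> y\<bar> * \<bar>d \<bullet> y\<bar> * N s powr (- q - 2)) \<le> 8 * q * (q + 1) * (norm d * (norm y)\<^sup>2 * ?R)"
      using q by (intro mult_left_mono) auto
    then show ?thesis using q by (simp add: D1_def abs_mult)
  qed
  have 2: "\<bar>D2 s\<bar> \<le> 8 * q * (q + 1) * (q + 2) * (norm d * (norm y)\<^sup>2 * ?R)"
  proof -
    have "\<bar>\<xi> s \<bullet> y\<bar>\<^sup>2 * \<bar>\<xi> s \<bullet> d\<bar> * N s powr (- q - 3) \<le> (norm (\<xi> s) * norm y)\<^sup>2 * (norm (\<xi> s) * norm d) * N s powr (- q - 3)"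
      by (intro mult_mono power_mono abs_inner_mult_le) auto
    also have "\<dots> = norm d * (norm y)\<^sup>2 * (norm (\<xi> s) ^ 3 * N s powr (- q - 3))" by (simp add: power2_eq_square power3_eq_cube)
    also have "\<dots> \<le> norm d * (norm y)\<^sup>2 * ?R" using i3 by (intro mult_left_mono) auto
    finally have "8 * q * (q + 1) * (q + 2) * (\<bar>\<xi> s \<bullet> y\<bar>\<^sup>2 * \<bar>\<xi> s \<bullet> d\<bar> * N s powr (- q - 3)) \<le> 8 * q * (q + 1) * (q + 2) * (norm d * (norm y)\<^sup>2 * ?R)"
      using q by (intro mult_left_mono) auto
    then show ?thesis using q by (simp add: D2_def abs_mult)
  qed
  have 3: "\<bar>D3 s\<bar> \<le> 4 * q * (q + 1) * (norm d * (norm y)\<^sup>2 * ?R)"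
  proof -
    have "(y \<bullet> y) * \<bar>\<xi> s \<bullet> d\<bar> * N s powr (- q - 2) \<le> (norm y)\<^sup>2 * (norm (\<xi> s) * norm d) * N s powr (- q - 2)"
      by (intro mult_mono abs_inner_mult_le) (auto simp: power2_norm_eq_inner)
    also have "\<dots> = norm d * (norm y)\<^sup>2 * (norm (\<xi> s) * N s powr (- q - 2))" by (simp add: power2_eq_square)
    also have "\<dots> \<le> norm d * (norm y)\<^sup>2 * ?R" using i1 by (intro mult_left_mono) auto
    finally have "4 * q * (q + 1) * ((y \<bullet> y) * \<bar>\<xi> s \<bullet> d\<bar> * N s powr (- q - 2)) \<le> 4 * q * (q + 1) * (norm d * (norm y)\<^sup>2 * ?R)"
      using q by (intro mult_left_mono) auto
    then show ?thesis using q by (simp add: D3_def abs_mult)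
  qed
  have "\<bar>D1 s + D2 s + D3 s\<bar> \<le> (8 * q * (q + 1) * (q + 2) + 12 * q * (q + 1)) * (norm d * (norm y)\<^sup>2 * ?R)"
    unfolding distrib_right using 1 2 3 by linarith
  then show ?thesis using s by (simp add: \<xi>_def d_def mult.assoc)
qed

text \<open>Maclaurin's formula is applied to the difference of the two kernels as one function of
  t, so both second derivatives sit at the same intermediate t. Their difference is then covered by
  the Lipschitz bound and keeps the factor \<open>norm (x' - x)\<close>.\<close>

lemma reg_kernel_taylor:
  fixes x x' y :: "'a::euclidean_space"
  assumes e: "\<epsilon> > 0" and q: "q > 0" and \<rho>: "\<rho> > 0"
    and seg: "\<And>s t. 0 \<le> s \<Longrightarrow> s \<le> 1 \<Longrightarrow> 0 \<le> t \<Longrightarrow> t \<le> 1 \<Longrightarrow> norm (x + s *\<^sub>R (x' - x) - t *\<^sub>R y) \<ge> \<rho>"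
  shows "\<bar>reg_kernel q \<epsilon> ((y - x) \<bullet> (y - x)) - reg_kernel q \<epsilon> ((y - x') \<bullet> (y - x'))
      - (reg_kernel q \<epsilon> (x \<bullet> x) - reg_kernel q \<epsilon> (x' \<bullet> x')) - (reg_kernel_d1 q \<epsilon> y x - reg_kernel_d1 q \<epsilon> y x')\<bar>
    \<le> (4 * q * (q + 1) * (q + 2) + 6 * q * (q + 1)) * norm (x' - x) * (norm y)\<^sup>2 * \<rho> powr (- (2 * q) - 3)"
proof -
  define f0 where "f0 z t = reg_kernel q \<epsilon> ((z + t *\<^sub>R (- y)) \<bullet> (z + t *\<^sub>R (- y)))" for z t
  define f1 where "f1 z t = reg_kernel_d1 q \<epsilon> y (z + t *\<^sub>R (- y))" for z t
  define f2 where "f2 z t = reg_kernel_d2 q \<epsilon> y (z + t *\<^sub>R (- y))" for z t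
  have d0: "(f0 z has_real_derivative f1 z t) (at t)" for z t
    unfolding f0_def f1_def reg_kernel_def reg_kernel_d1_def
    by (rule DERIV_inner_powr[OF e, THEN DERIV_cong]) (simp add: inner_minus_right)
  have d1: "(f1 z has_real_derivative f2 z t) (at t)" for z t
    unfolding f1_def f2_def reg_kernel_d1_def reg_kernel_d2_def
    by (rule derivative_eq_intros DERIV_line_inner DERIV_inner_powr e refl)+
      (simp add: power2_eq_square algebra_simps)
  define df where "df m t = (if m = 0 then f0 x t - f0 x' t else if m = 1 then f1 x t - f1 x' t else f2 x t - f2 x' t)" for m :: nat and t
  have "\<exists>t>0. t < 1 \<and> df 0 1 = (\<Sum>m<2. df m 0 / fact m * 1 ^ m) + df 2 t / fact 2 * 1 ^ 2"
  proof (rule Maclaurin)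
    show "\<forall>m t. m < 2 \<and> 0 \<le> t \<and> t \<le> 1 \<longrightarrow> ((df m) has_real_derivative df (Suc m) t) (at t)"
    proof (intro allI impI)
      fix m :: nat and t :: real
      assume "m < 2 \<and> 0 \<le> t \<and> t \<le> 1"
      then consider "m = 0" | "m = 1" by linarith
      then show "((df m) has_real_derivative df (Suc m) t) (at t)"
        by cases (auto simp: df_def[abs_def] intro!: DERIV_diff d0 d1)
    qed
  qed auto
  then obtain t where t: "0 < t" "t < 1" "df 0 1 = (\<Sum>m<2. df m 0 / fact m * 1 ^ m) + df 2 t / fact 2 * 1 ^ 2" by auto
  have sq: "(z + 1 *\<^sub>R (- y)) \<bullet> (z + 1 *\<^sub>R (- y)) = (y - z) \<bullet> (y - z)" for z
    by (simp add: inner_diff_left inner_diff_right inner_commute)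
  have "reg_kernel q \<epsilon> ((y - x) \<bullet> (y - x)) - reg_kernel q \<epsilon> ((y - x') \<bullet> (y - x'))
      - (reg_kernel q \<epsilon> (x \<bullet> x) - reg_kernel q \<epsilon> (x' \<bullet> x')) - (reg_kernel_d1 q \<epsilon> y x - reg_kernel_d1 q \<epsilon> y x')
     = - (f2 x' t - f2 x t) / 2"
    using t(3) by (simp add: df_def f0_def f1_def sq[simplified] numeral_2_eq_2 field_simps)
  also have "\<bar>\<dots>\<bar> = \<bar>f2 x' t - f2 x t\<bar> / 2" by simp
  also have "\<bar>f2 x' t - f2 x t\<bar> \<le> (8 * q * (q + 1) * (q + 2) + 12 * q * (q + 1)) * norm ((x' + t *\<^sub>R (- y)) - (x + t *\<^sub>R (- y))) * (norm y)\<^sup>2 * \<rho> powr (- (2 * q) - 3)"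
    unfolding f2_def using seg[of _ t] t by (intro reg_kernel_d2_diff_le e q \<rho>) (auto simp: algebra_simps)
  finally show ?thesis by (simp add: algebra_simps)
qed

section \<open>Potentials of a density of order |y|^(- n - 2)\<close>

context
  fixes \<sigma> :: "'a::euclidean_space \<Rightarrow> real" and B q :: real
  assumes dim: "DIM('a) \<ge> 3" and q: "q = (real DIM('a) - 2) / 2"
    and cont: "continuous_on UNIV \<sigma>"
    and bound: "\<And>y. \<bar>\<sigma> y\<bar> \<le> B * (1 + y \<bullet> y) powr (- (q + 2))"
begin

lemma exponent_pos: "q > 0"
  using dim q by simp

lemma DIM_eq_exponent: "real DIM('a) = 2 * q + 2"
  using q by simp

lemma density_const_nonneg: "B \<ge> 0"
  using order_trans[OF abs_ge_zero bound[of 0]] by simp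

lemma density_measurable [measurable]: "\<sigma> \<in> borel_measurable borel"
  using cont by (rule borel_measurable_continuous_onI)

text \<open>The weight costs at most 3/4 in the exponent of 1 + |y|^2. What remains is q + 5/4, and
  twice that is n + 1/2.\<close>

lemma integrable_weight_density:
  assumes "0 \<le> k" "k \<le> 3 / 2"
  shows "integrable lborel (\<lambda>y. norm y powr k * \<bar>\<sigma> y\<bar>)"
proof (rule Bochner_Integration.integrable_bound)
  show "integrable lborel (\<lambda>y::'a. B * (1 + y \<bullet> y) powr (- (q + 5 / 4)))"
    by (intro integrable_mult_right integrable_powr_decay) (simp add: DIM_eq_exponent)
  have "norm y powr k * \<bar>\<sigma> y\<bar> \<le> B * (1 + y \<bullet> y) powr (- (q + 5 / 4))" for y
  proof -
    have p: "1 + y \<bullet> y \<ge> 1" by simp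
    have "norm y powr k = ((norm y)\<^sup>2 powr (1 / 2)) powr k" by (simp add: powr_half_sqrt)
    also have "\<dots> = (y \<bullet> y) powr (k / 2)" by (simp add: powr_powr power2_norm_eq_inner)
    also have "\<dots> \<le> (1 + y \<bullet> y) powr (k / 2)" using assms by (intro powr_mono2) auto
    also have "\<dots> \<le> (1 + y \<bullet> y) powr (3 / 4)" using assms p by (intro powr_mono) auto
    finally have "norm y powr k * \<bar>\<sigma> y\<bar> \<le> (1 + y \<bullet> y) powr (3 / 4) * (B * (1 + y \<bullet> y) powr (- (q + 2)))"
      using bound[of y] by (intro mult_mono) auto
    also have "\<dots> = B * ((1 + y \<bullet> y) powr (3 / 4) * (1 + y \<bullet> y) powr (- (q + 2)))" by simp
    also have "(1 + y \<bullet> y) powr (3 / 4) * (1 + y \<bullet> y) powr (- (q + 2)) = (1 + y \<bullet> y) powr (3 / 4 + - (q + 2))"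
      by (rule powr_add[symmetric])
    also have "3 / 4 + - (q + 2) = - (q + 5 / 4)" by simp
    finally show ?thesis .
  qed
  then show "AE y in lborel. norm (norm y powr k * \<bar>\<sigma> y\<bar>) \<le> norm (B * (1 + y \<bullet> y) powr (- (q + 5 / 4)))"
    using density_const_nonneg by (intro AE_I2) (simp add: abs_mult)
qed measurable

lemma integrable_density: "integrable lborel \<sigma>"
proof (rule Bochner_Integration.integrable_bound)
  show "integrable lborel (\<lambda>y::'a. B * (1 + y \<bullet> y) powr (- (q + 2)))"
    by (intro integrable_mult_right integrable_powr_decay) (simp add: DIM_eq_exponent)
  show "AE y in lborel. norm (\<sigma> y) \<le> norm (B * (1 + y \<bullet> y) powr (- (q + 2)))"
    using bound density_const_nonneg by (intro AE_I2) (simp add: abs_mult)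
qed measurable

lemma integrable_density_moment: "integrable lborel (\<lambda>y. \<sigma> y *\<^sub>R y)"
proof (rule Bochner_Integration.integrable_bound)
  show "integrable lborel (\<lambda>y. norm y powr 1 * \<bar>\<sigma> y\<bar>)" by (rule integrable_weight_density) auto
qed auto

text \<open>
  The weight \<open>|y|\<^bsup>3 / 2\<^esup>\<close> replaces the \<open>|y|\<^sup>2\<close> of the Taylor remainder, which need not be integrable
  against a density of order \<open>|y|\<^bsup>- n - 2\<^esup>\<close>.
\<close>

lemma kernel_remainder_bound:
  obtains C where "C \<ge> 0"
    "\<And>\<epsilon> \<rho> x x' y. \<lbrakk>\<epsilon> > 0; \<rho> > 0; norm x = 4 * \<rho>;
      \<And>s. 0 \<le> s \<Longrightarrow> s \<le> 1 \<Longrightarrow> norm (x + s *\<^sub>R (x' - x)) \<ge> 2 * \<rho>; y \<noteq> x; y \<noteq> x'\<rbrakk> \<Longrightarrow>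
      \<bar>reg_kernel q \<epsilon> ((y - x) \<bullet> (y - x)) - reg_kernel q \<epsilon> ((y - x') \<bullet> (y - x'))
      - (reg_kernel q \<epsilon> (x \<bullet> x) - reg_kernel q \<epsilon> (x' \<bullet> x')) - (reg_kernel_d1 q \<epsilon> y x - reg_kernel_d1 q \<epsilon> y x')\<bar>
      * \<bar>\<sigma> y\<bar> \<le> norm (x' - x) * (C * \<rho> powr (- (2 * q) - 5 / 2) * (norm y powr (3 / 2) * \<bar>\<sigma> y\<bar>)
       + 2 * q * B * \<rho> powr (- (2 * q) - 4) * (indicator (ball x (4 * \<rho>)) y * norm (y - x) powr (1 - real DIM('a))
         + indicator (ball x' (4 * \<rho>)) y * norm (y - x') powr (1 - real DIM('a))))"
proof -
  define Kt where "Kt = 4 * q * (q + 1) * (q + 2) + 6 * q * (q + 1)"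
  define Kd where "Kd = 4 * q * (q + 1) + 2 * q"
  have K: "Kt \<ge> 0" "Kd \<ge> 0" using exponent_pos by (auto simp: Kt_def Kd_def)
  have q0: "q > 0" by (rule exponent_pos)
  have n1: "1 - real DIM('a) = - (2 * q) - 1" using DIM_eq_exponent by simp
  show ?thesis
  \<comment> \<open>\<open>Kt\<close> comes from the Taylor remainder for small y. For large y,
    \<open>Kd\<close> comes from the dipole terms, and 8 q from two kernel differences with 4 q
    each.\<close>
  proof (rule that[of "Kt + Kd + 8 * q"])
    show "Kt + Kd + 8 * q \<ge> 0" using K q0 by simp
    fix \<epsilon> \<rho> :: real and x x' y :: 'a
    assume e: "\<epsilon> > 0" and \<rho>: "\<rho> > 0" and x: "norm x = 4 * \<rho>" and y: "y \<noteq> x" "y \<noteq> x'"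
      and seg: "\<And>s. 0 \<le> s \<Longrightarrow> s \<le> 1 \<Longrightarrow> norm (x + s *\<^sub>R (x' - x)) \<ge> 2 * \<rho>"
    define Tk where "Tk = \<bar>reg_kernel q \<epsilon> ((y - x) \<bullet> (y - x)) - reg_kernel q \<epsilon> ((y - x') \<bullet> (y - x'))
      - (reg_kernel q \<epsilon> (x \<bullet> x) - reg_kernel q \<epsilon> (x' \<bullet> x')) - (reg_kernel_d1 q \<epsilon> y x - reg_kernel_d1 q \<epsilon> y x')\<bar>"
    define d where "d = norm (x' - x)"
    define \<theta> where "\<theta> = \<rho> powr (- (2 * q) - 5 / 2) * norm y powr (3 / 2)"
    define I where "I z = indicator (ball z (4 * \<rho>)) y * norm (y - z) powr (- (2 * q) - 1)" for z
    have d: "d \<ge> 0" and \<theta>: "\<theta> \<ge> 0" and I: "I z \<ge> 0" for z by (auto simp: d_def \<theta>_def I_def)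
    have "Tk * \<bar>\<sigma> y\<bar> \<le> d * ((Kt + Kd + 8 * q) * \<theta> * \<bar>\<sigma> y\<bar> + 2 * q * B * \<rho> powr (- (2 * q) - 4) * (I x + I x'))"
    proof (cases "norm y \<le> \<rho>")
      case True
      \<comment> \<open>For |y| \<le> \<rho> the segment stays at distance \<rho> from every t y
        with t in [0, 1], so Taylor's formula applies. Half a power of |y| in the remainder is then
        traded for half a power of \<rho>, turning |y|^2 into the integrable weight.\<close>
      have "Tk \<le> Kt * d * (norm y)\<^sup>2 * \<rho> powr (- (2 * q) - 3)"
        unfolding Tk_def Kt_def d_def
      proof (rule reg_kernel_taylor[OF e q0 \<rho>])
        fix s t :: real assume st: "0 \<le> s" "s \<le> 1" "0 \<le> t" "t \<le> 1"
        have "norm (t *\<^sub>R y) \<le> \<rho>" using st True mult_mono[of t 1 "norm y" \<rho>] by simp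
        then show "\<rho> \<le> norm (x + s *\<^sub>R (x' - x) - t *\<^sub>R y)"
          using seg[OF st(1,2)] norm_triangle_ineq2[of "x + s *\<^sub>R (x' - x)" "t *\<^sub>R y"] by linarith
      qed
      also have "(norm y)\<^sup>2 * \<rho> powr (- (2 * q) - 3) \<le> \<theta>"
      proof (cases "y = 0")
        case False
        then have "(norm y)\<^sup>2 = norm y powr (1 / 2) * norm y powr (3 / 2)" by (simp add: powr_add[symmetric])
        also have "\<dots> \<le> \<rho> powr (1 / 2) * norm y powr (3 / 2)"
          using True by (intro mult_right_mono powr_mono2) auto
        finally have "(norm y)\<^sup>2 * \<rho> powr (- (2 * q) - 3) \<le> \<rho> powr (1 / 2) * norm y powr (3 / 2) * \<rho> powr (- (2 * q) - 3)"
          by (intro mult_right_mono) auto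
        also have "\<dots> = (\<rho> powr (1 / 2) * \<rho> powr (- (2 * q) - 3)) * norm y powr (3 / 2)" by simp
        also have "\<rho> powr (1 / 2) * \<rho> powr (- (2 * q) - 3) = \<rho> powr (1 / 2 + (- (2 * q) - 3))" by (rule powr_add[symmetric])
        also have "1 / 2 + (- (2 * q) - 3) = - (2 * q) - 5 / 2" by simp
        finally show ?thesis by (simp add: \<theta>_def)
      qed (use \<theta> in auto)
      then have "Kt * d * (norm y)\<^sup>2 * \<rho> powr (- (2 * q) - 3) \<le> Kt * d * \<theta>"
        using K d by (simp add: mult.assoc mult_left_mono)
      finally have "Tk \<le> Kt * d * \<theta>" .
      also have "\<dots> \<le> (Kt + Kd + 8 * q) * d * \<theta>" using K d \<theta> q0 by (intro mult_right_mono) auto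
      finally have "Tk * \<bar>\<sigma> y\<bar> \<le> (Kt + Kd + 8 * q) * d * \<theta> * \<bar>\<sigma> y\<bar>" by (rule mult_right_mono) simp
      also have "\<dots> \<le> d * ((Kt + Kd + 8 * q) * \<theta> * \<bar>\<sigma> y\<bar> + 2 * q * B * \<rho> powr (- (2 * q) - 4) * (I x + I x'))"
      proof -
        have "0 \<le> d * (2 * q * B * \<rho> powr (- (2 * q) - 4) * (I x + I x'))" using d q0 density_const_nonneg I by simp
        then show ?thesis by (simp add: algebra_simps)
      qed
      finally show ?thesis .
    next
      case False
      \<comment> \<open>For |y| > \<rho> no cancellation is available and the three differences are
        bounded one by one; powers of \<rho> are raised to powers of |y| until the weight 3/2 is
        reached. The singularities at x and x' are kept in \<open>I\<close>, where the density is of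
        order \<rho>^(- n - 2) because |y| > \<rho>.\<close>
      then have y\<rho>: "\<rho> < norm y" by simp
      have th1: "\<rho> powr (- (2 * q) - 1) \<le> \<theta>"
      proof -
        have "- (2 * q) - 1 = (- (2 * q) - 5 / 2) + 3 / 2" by simp
        then have "\<rho> powr (- (2 * q) - 1) = \<rho> powr ((- (2 * q) - 5 / 2) + 3 / 2)" by (rule arg_cong)
        also have "\<dots> = \<rho> powr (- (2 * q) - 5 / 2) * \<rho> powr (3 / 2)" by (rule powr_add)
        also have "\<dots> \<le> \<theta>" unfolding \<theta>_def using y\<rho> \<rho> by (intro mult_left_mono powr_mono2) auto
        finally show ?thesis .
      qed
      have th2: "norm y * \<rho> powr (- (2 * q) - 2) \<le> \<theta>"
      proof -
        have "- (2 * q) - 2 = (- (2 * q) - 5 / 2) + 1 / 2" by simp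
        then have "\<rho> powr (- (2 * q) - 2) = \<rho> powr ((- (2 * q) - 5 / 2) + 1 / 2)" by (rule arg_cong)
        also have "\<dots> = \<rho> powr (- (2 * q) - 5 / 2) * \<rho> powr (1 / 2)" by (rule powr_add)
        finally have "norm y * \<rho> powr (- (2 * q) - 2) = \<rho> powr (- (2 * q) - 5 / 2) * (norm y * \<rho> powr (1 / 2))" by simp
        also have "\<dots> \<le> \<rho> powr (- (2 * q) - 5 / 2) * (norm y * norm y powr (1 / 2))"
          using y\<rho> \<rho> by (intro mult_left_mono powr_mono2) auto
        also have "norm y * norm y powr (1 / 2) = norm y powr (1 + 1 / 2)" unfolding powr_add by simp
        finally show ?thesis by (simp add: \<theta>_def)
      qed
      have nx: "x \<noteq> 0" "norm x \<ge> \<rho>" using x \<rho> by auto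
      have nx': "x' \<noteq> 0" "norm x' \<ge> \<rho>" using seg[of 1] \<rho> by auto
      have far: "norm (y - z) powr (- (2 * q) - 1) \<le> \<theta> + I z" if "y \<noteq> z" for z
      proof (cases "y \<in> ball z (4 * \<rho>)")
        case True
        then show ?thesis using \<theta> by (simp add: I_def)
      next
        case False
        then have "norm (y - z) powr (- (2 * q) - 1) \<le> \<rho> powr (- (2 * q) - 1)"
          using \<rho> q0 by (intro powr_mono2') (auto simp: dist_norm norm_minus_commute)
        then show ?thesis using th1 I[of z] by linarith
      qed
      have 1: "\<bar>reg_kernel q \<epsilon> ((y - x) \<bullet> (y - x)) - reg_kernel q \<epsilon> ((y - x') \<bullet> (y - x'))\<bar> \<le> 2 * q * d * (2 * \<theta> + I x + I x')"
      proof -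
        have "\<bar>reg_kernel q \<epsilon> ((y - x) \<bullet> (y - x)) - reg_kernel q \<epsilon> ((y - x') \<bullet> (y - x'))\<bar>
          \<le> 2 * q * norm ((y - x) - (y - x')) * (norm (y - x) powr (- (2 * q) - 1) + norm (y - x') powr (- (2 * q) - 1))"
          using e q0 y by (intro reg_kernel_lipschitz) auto
        also have "(y - x) - (y - x') = x' - x" by simp
        also have "2 * q * norm (x' - x) * (norm (y - x) powr (- (2 * q) - 1) + norm (y - x') powr (- (2 * q) - 1))
          \<le> 2 * q * norm (x' - x) * (2 * \<theta> + I x + I x')"
          using far[OF y(1)] far[OF y(2)] q0 by (intro mult_left_mono) auto
        finally show ?thesis by (simp add: d_def)
      qed
      have 2: "\<bar>reg_kernel q \<epsilon> (x \<bullet> x) - reg_kernel q \<epsilon> (x' \<bullet> x')\<bar> \<le> 2 * q * d * (2 * \<theta>)"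
      proof -
        have "\<bar>reg_kernel q \<epsilon> (x \<bullet> x) - reg_kernel q \<epsilon> (x' \<bullet> x')\<bar>
          \<le> 2 * q * norm (x - x') * (norm x powr (- (2 * q) - 1) + norm x' powr (- (2 * q) - 1))"
          using e q0 nx nx' by (intro reg_kernel_lipschitz) auto
        also have "norm x powr (- (2 * q) - 1) + norm x' powr (- (2 * q) - 1) \<le> 2 * \<theta>"
          using powr_mono2'[of "- (2 * q) - 1" \<rho> "norm x"] powr_mono2'[of "- (2 * q) - 1" \<rho> "norm x'"] th1 nx nx' \<rho> q0 by simp
        then have "2 * q * norm (x - x') * (norm x powr (- (2 * q) - 1) + norm x' powr (- (2 * q) - 1)) \<le> 2 * q * norm (x - x') * (2 * \<theta>)"
          using q0 by (intro mult_left_mono) auto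
        finally show ?thesis by (simp add: d_def norm_minus_commute)
      qed
      have 3: "\<bar>reg_kernel_d1 q \<epsilon> y x' - reg_kernel_d1 q \<epsilon> y x\<bar> \<le> Kd * d * \<theta>"
      proof -
        have "\<bar>reg_kernel_d1 q \<epsilon> y x' - reg_kernel_d1 q \<epsilon> y x\<bar> \<le> Kd * d * norm y * \<rho> powr (- (2 * q) - 2)"
          unfolding Kd_def d_def using \<rho> by (intro reg_kernel_d1_diff_le e q0 order_trans[OF _ seg]) auto
        also have "\<dots> = Kd * d * (norm y * \<rho> powr (- (2 * q) - 2))" by simp
        also have "\<dots> \<le> Kd * d * \<theta>" using th2 K d by (intro mult_left_mono) auto
        finally show ?thesis .
      qed
      have "Tk \<le> 2 * q * d * (2 * \<theta> + I x + I x') + 2 * q * d * (2 * \<theta>) + Kd * d * \<theta>"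
        unfolding Tk_def using 1 2 3 by linarith
      also have "\<dots> = (Kd + 8 * q) * d * \<theta> + d * (2 * q * (I x + I x'))" by (simp add: algebra_simps)
      also have "\<dots> \<le> (Kt + Kd + 8 * q) * d * \<theta> + d * (2 * q * (I x + I x'))"
        using K d \<theta> by (intro add_right_mono mult_right_mono) auto
      finally have "Tk * \<bar>\<sigma> y\<bar> \<le> ((Kt + Kd + 8 * q) * d * \<theta> + d * (2 * q * (I x + I x'))) * \<bar>\<sigma> y\<bar>"
        by (rule mult_right_mono) simp
      also have "\<dots> = d * ((Kt + Kd + 8 * q) * \<theta> * \<bar>\<sigma> y\<bar>) + d * (2 * q * (I x + I x') * \<bar>\<sigma> y\<bar>)"
        by (simp add: algebra_simps)
      also have "d * (2 * q * (I x + I x') * \<bar>\<sigma> y\<bar>) \<le> d * (2 * q * (I x + I x') * (B * \<rho> powr (- (2 * q) - 4)))"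
      proof -
        have "(1 + y \<bullet> y) powr (- (q + 2)) \<le> (\<rho>\<^sup>2) powr (- (q + 2))"
        proof -
          have "\<rho>\<^sup>2 \<le> (norm y)\<^sup>2" using y\<rho> \<rho> by (intro power_mono) auto
          then show ?thesis using \<rho> q0 by (intro powr_mono2') (auto simp: power2_norm_eq_inner)
        qed
        also have "(\<rho>\<^sup>2) powr (- (q + 2)) = (\<rho> powr 2) powr (- (q + 2))" using \<rho> by simp
        also have "\<dots> = \<rho> powr (- (2 * q) - 4)" unfolding powr_powr by (simp add: algebra_simps)
        finally have "B * (1 + y \<bullet> y) powr (- (q + 2)) \<le> B * \<rho> powr (- (2 * q) - 4)"
          using density_const_nonneg by (rule mult_left_mono)
        then have "\<bar>\<sigma> y\<bar> \<le> B * \<rho> powr (- (2 * q) - 4)" using bound[of y] by linarith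
        then show ?thesis using d q0 I by (intro mult_left_mono) auto
      qed
      finally show ?thesis by (simp add: algebra_simps)
    qed
    then show "Tk * \<bar>\<sigma> y\<bar> \<le> norm (x' - x) * ((Kt + Kd + 8 * q) * \<rho> powr (- (2 * q) - 5 / 2) * (norm y powr (3 / 2) * \<bar>\<sigma> y\<bar>)
       + 2 * q * B * \<rho> powr (- (2 * q) - 4) * (indicator (ball x (4 * \<rho>)) y * norm (y - x) powr (1 - real DIM('a))
         + indicator (ball x' (4 * \<rho>)) y * norm (y - x') powr (1 - real DIM('a))))"
      by (simp add: n1 d_def \<theta>_def I_def mult.assoc)
  qed
qed

lemma riesz_ball_integral:
  obtains K where "0 \<le> K"
    "\<And>z r. 0 < r \<Longrightarrow> integrable lborel (\<lambda>y::'a. indicator (ball z r) y * norm (y - z) powr (1 - real DIM('a)))"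
    "\<And>z r. 0 < r \<Longrightarrow> (\<integral>y. indicator (ball (z::'a) r) y * norm (y - z) powr (1 - real DIM('a)) \<partial>lborel) \<le> K * r"
proof -
  obtain K where K: "0 \<le> K" "\<And>(z::'a) r. 0 < r \<Longrightarrow>
    (\<integral>\<^sup>+x. ennreal (indicator (ball z r) x * norm (x - z) powr (1 - real DIM('a))) \<partial>lborel) \<le> ennreal (K * r)"
    by (rule nn_integral_riesz_ball_le[where 'a='a]) (rule that; blast)
  show ?thesis
  proof (rule that[OF K(1)])
    fix z :: 'a and r :: real assume r: "0 < r"
    have [measurable]: "ball z r \<in> sets borel" by simp
    have m: "(\<lambda>y. indicator (ball z r) y * norm (y - z) powr (1 - real DIM('a))) \<in> borel_measurable lborel"
      by (simp del: mem_ball, measurable)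
    show i: "integrable lborel (\<lambda>y. indicator (ball z r) y * norm (y - z) powr (1 - real DIM('a)))"
      by (rule integrableI_nonneg[OF m]) (use K(2)[OF r, of z] in \<open>auto intro: le_less_trans\<close>)
    have "ennreal (\<integral>y. indicator (ball z r) y * norm (y - z) powr (1 - real DIM('a)) \<partial>lborel) \<le> ennreal (K * r)"
      using K(2)[OF r, of z] by (subst nn_integral_eq_integral[OF i, symmetric]) auto
    then show "(\<integral>y. indicator (ball z r) y * norm (y - z) powr (1 - real DIM('a)) \<partial>lborel) \<le> K * r"
      using K(1) r by (simp add: ennreal_le_iff)
  qed
qed

text \<open>Integrates the kernel estimate, uniformly in \<epsilon>. The dipole contributes only
  through the first moment of \<sigma>: for a centred density it disappears, and in general it still
  leaves a bound one power better than the monopole, which is used before centring is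
  possible.\<close>

lemma potential_difference_bound:
  obtains C where "C \<ge> 0"
    "\<And>\<epsilon> x x'. \<lbrakk>0 < \<epsilon>; 1 \<le> norm x;
      \<And>s. 0 \<le> s \<Longrightarrow> s \<le> 1 \<Longrightarrow> norm (x + s *\<^sub>R (x' - x)) \<ge> norm x / 2\<rbrakk> \<Longrightarrow>
      \<bar>(\<integral>y. reg_kernel q \<epsilon> ((y - x) \<bullet> (y - x)) * \<sigma> y \<partial>lborel) - (\<integral>y. reg_kernel q \<epsilon> ((y - x') \<bullet> (y - x')) * \<sigma> y \<partial>lborel)
        - (\<integral>y. \<sigma> y \<partial>lborel) * (reg_kernel q \<epsilon> (x \<bullet> x) - reg_kernel q \<epsilon> (x' \<bullet> x'))\<bar>
      \<le> C * norm (x' - x) * (norm (\<integral>y. \<sigma> y *\<^sub>R y \<partial>lborel) * norm x powr (- (2 * q) - 2) + norm x powr (- (2 * q) - 5 / 2))"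
proof -
  obtain C0 where C0: "C0 \<ge> 0"
    "\<And>\<epsilon> \<rho> x x' y. \<lbrakk>\<epsilon> > 0; \<rho> > 0; norm x = 4 * \<rho>;
      \<And>s. 0 \<le> s \<Longrightarrow> s \<le> 1 \<Longrightarrow> norm (x + s *\<^sub>R (x' - x)) \<ge> 2 * \<rho>; y \<noteq> x; y \<noteq> x'\<rbrakk> \<Longrightarrow>
      \<bar>reg_kernel q \<epsilon> ((y - x) \<bullet> (y - x)) - reg_kernel q \<epsilon> ((y - x') \<bullet> (y - x'))
      - (reg_kernel q \<epsilon> (x \<bullet> x) - reg_kernel q \<epsilon> (x' \<bullet> x')) - (reg_kernel_d1 q \<epsilon> y x - reg_kernel_d1 q \<epsilon> y x')\<bar>
      * \<bar>\<sigma> y\<bar> \<le> norm (x' - x) * (C0 * \<rho> powr (- (2 * q) - 5 / 2) * (norm y powr (3 / 2) * \<bar>\<sigma> y\<bar>)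
       + 2 * q * B * \<rho> powr (- (2 * q) - 4) * (indicator (ball x (4 * \<rho>)) y * norm (y - x) powr (1 - real DIM('a))
         + indicator (ball x' (4 * \<rho>)) y * norm (y - x') powr (1 - real DIM('a))))"
    by (rule kernel_remainder_bound) (rule that; blast)
  obtain K where K: "0 \<le> K"
    "\<And>z r. 0 < r \<Longrightarrow> integrable lborel (\<lambda>y::'a. indicator (ball z r) y * norm (y - z) powr (1 - real DIM('a)))"
    "\<And>z r. 0 < r \<Longrightarrow> (\<integral>y. indicator (ball (z::'a) r) y * norm (y - z) powr (1 - real DIM('a)) \<partial>lborel) \<le> K * r"
    by (rule riesz_ball_integral) (rule that; blast)
  define S where "S = (\<integral>y. norm y powr (3 / 2) * \<bar>\<sigma> y\<bar> \<partial>lborel)"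
  have S: "S \<ge> 0" by (simp add: S_def)
  have iW: "integrable lborel (\<lambda>y. norm y powr (3 / 2) * \<bar>\<sigma> y\<bar>)" by (rule integrable_weight_density) auto
  define Dm where "Dm = (\<integral>y. \<sigma> y *\<^sub>R y \<partial>lborel)"
  define m0 where "m0 = (\<integral>y. \<sigma> y \<partial>lborel)"
  define Kd where "Kd = 4 * q * (q + 1) + 2 * q"
  have q0: "q > 0" by (rule exponent_pos)
  have Kd: "Kd \<ge> 0" using q0 by (simp add: Kd_def)
  define C1 where "C1 = (C0 * S + 32 * q * B * K) * 4 powr (2 * q + 5 / 2)"
  define C2 where "C2 = Kd * 2 powr (2 * q + 2)"
  have C12: "C1 \<ge> 0" "C2 \<ge> 0" using C0 S q0 density_const_nonneg K Kd by (auto simp: C1_def C2_def)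
  show ?thesis
  proof (rule that[of "C1 + C2"])
    show "0 \<le> C1 + C2" using C12 by simp
    fix \<epsilon> :: real and x x' :: 'a
    assume e: "0 < \<epsilon>" and x: "1 \<le> norm x"
      and seg: "\<And>s. 0 \<le> s \<Longrightarrow> s \<le> 1 \<Longrightarrow> norm (x + s *\<^sub>R (x' - x)) \<ge> norm x / 2"
    \<comment> \<open>A quarter of \<open>norm x\<close>: the segment then avoids the ball of radius
      2 \<rho>, which leaves a margin of \<rho> for all y with |y| \<le> \<rho>.\<close>
    define \<rho> where "\<rho> = norm x / 4"
    have \<rho>: "\<rho> > 0" "norm x = 4 * \<rho>" "\<rho> \<ge> 1 / 4" using x by (auto simp: \<rho>_def)
    have seg': "norm (x + s *\<^sub>R (x' - x)) \<ge> 2 * \<rho>" if "0 \<le> s" "s \<le> 1" for s using seg[OF that] by (simp add: \<rho>_def)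
    define d where "d = norm (x' - x)"
    have d: "d \<ge> 0" by (simp add: d_def)
    define V where "V = (2 * q * (x \<bullet> x + \<epsilon>\<^sup>2) powr (- q - 1)) *\<^sub>R x - (2 * q * (x' \<bullet> x' + \<epsilon>\<^sup>2) powr (- q - 1)) *\<^sub>R x'"
    have V: "reg_kernel_d1 q \<epsilon> y x - reg_kernel_d1 q \<epsilon> y x' = V \<bullet> y" for y
      by (simp add: V_def reg_kernel_d1_def inner_diff_left)
    define G where "G z y = reg_kernel q \<epsilon> ((y - z) \<bullet> (y - z))" for z y :: 'a
    have Gb: "0 \<le> G z y" "G z y \<le> reg_kernel q \<epsilon> 0" for z y
      unfolding G_def reg_kernel_def using e q0 by (auto intro!: powr_mono2')
    have [measurable]: "G z \<in> borel_measurable borel" for z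
      unfolding G_def[abs_def] reg_kernel_def by measurable
    have iG: "integrable lborel (\<lambda>y. G z y * \<sigma> y)" for z
    proof (rule Bochner_Integration.integrable_bound)
      show "integrable lborel (\<lambda>y. reg_kernel q \<epsilon> 0 * \<sigma> y)" using integrable_density by simp
      show "AE y in lborel. norm (G z y * \<sigma> y) \<le> norm (reg_kernel q \<epsilon> 0 * \<sigma> y)"
        using Gb by (intro AE_I2) (auto simp: abs_mult reg_kernel_def intro!: mult_right_mono)
    qed measurable
    define g0 where "g0 = reg_kernel q \<epsilon> (x \<bullet> x) - reg_kernel q \<epsilon> (x' \<bullet> x')"
    define T where "T y = G x y - G x' y - g0 - V \<bullet> y" for y
    have iV: "integrable lborel (\<lambda>y. \<sigma> y * (V \<bullet> y))"
      using integrable_inner_right[of V lborel "\<lambda>y. \<sigma> y *\<^sub>R y"] integrable_density_moment by simp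
    have eqT: "T y * \<sigma> y = (G x y * \<sigma> y - G x' y * \<sigma> y - g0 * \<sigma> y) - \<sigma> y * (V \<bullet> y)" for y
      by (simp add: T_def algebra_simps)
    have iT: "integrable lborel (\<lambda>y. T y * \<sigma> y)"
      unfolding eqT using iG iV integrable_density by (intro Bochner_Integration.integrable_diff) auto
    have "(\<integral>y. \<sigma> y * (V \<bullet> y) \<partial>lborel) = V \<bullet> Dm"
      using integral_inner_right[of V lborel "\<lambda>y. \<sigma> y *\<^sub>R y"] integrable_density_moment by (simp add: Dm_def)
    then have intT: "(\<integral>y. T y * \<sigma> y \<partial>lborel) = (\<integral>y. G x y * \<sigma> y \<partial>lborel) - (\<integral>y. G x' y * \<sigma> y \<partial>lborel) - m0 * g0 - V \<bullet> Dm"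
      unfolding eqT using iG iV integrable_density by (simp add: m0_def)
    define I where "I z y = indicator (ball z (4 * \<rho>)) y * norm (y - z) powr (1 - real DIM('a))" for z y :: 'a
    have iI: "integrable lborel (I z)" "(\<integral>y. I z y \<partial>lborel) \<le> K * (4 * \<rho>)" for z
      unfolding I_def[abs_def] using K(2,3)[of "4 * \<rho>" z] \<rho> by auto
    define U where "U y = d * (C0 * \<rho> powr (- (2 * q) - 5 / 2) * (norm y powr (3 / 2) * \<bar>\<sigma> y\<bar>)
       + 2 * q * B * \<rho> powr (- (2 * q) - 4) * (I x y + I x' y))" for y
    have iU: "integrable lborel U"
      unfolding U_def[abs_def] using iW iI by (intro integrable_mult_right Bochner_Integration.integrable_add) auto
    have "\<bar>\<integral>y. T y * \<sigma> y \<partial>lborel\<bar> \<le> (\<integral>y. \<bar>T y * \<sigma> y\<bar> \<partial>lborel)" by (rule integral_abs_bound)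
    also have "\<dots> \<le> (\<integral>y. U y \<partial>lborel)"
    proof (rule integral_mono_AE)
      have "AE y in lborel. y \<noteq> x" "AE y in lborel. y \<noteq> x'" by (rule AE_lborel_singleton)+
      then show "AE y in lborel. \<bar>T y * \<sigma> y\<bar> \<le> U y"
      proof eventually_elim
        case (elim y)
        show ?case
          using C0(2)[OF e \<rho>(1,2) seg' elim]
          by (simp add: abs_mult T_def G_def g0_def V U_def d_def I_def)
      qed
    qed (use iT iU in auto)
    also have "(\<integral>y. U y \<partial>lborel) = d * (C0 * \<rho> powr (- (2 * q) - 5 / 2) * S
       + 2 * q * B * \<rho> powr (- (2 * q) - 4) * ((\<integral>y. I x y \<partial>lborel) + (\<integral>y. I x' y \<partial>lborel)))"
      unfolding U_def using iW iI by (simp add: S_def)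
    also have "\<dots> \<le> d * (C0 * \<rho> powr (- (2 * q) - 5 / 2) * S
       + 2 * q * B * \<rho> powr (- (2 * q) - 4) * (K * (4 * \<rho>) + K * (4 * \<rho>)))"
      using d q0 density_const_nonneg iI(2) by (intro mult_left_mono add_left_mono add_mono) auto
    also have "\<dots> = d * (C0 * S * \<rho> powr (- (2 * q) - 5 / 2) + 16 * q * B * K * (\<rho> powr (- (2 * q) - 4) * \<rho>))"
      by (simp add: algebra_simps)
    \<comment> \<open>The singular part is of order \<rho>^(- 2 q - 3). As \<rho> \<ge> 1/4, the
      surplus factor \<rho>^(- 1/2) is at most 2.\<close>
    also have "\<dots> \<le> d * (C0 * S * \<rho> powr (- (2 * q) - 5 / 2) + 16 * q * B * K * (2 * \<rho> powr (- (2 * q) - 5 / 2)))"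
    proof -
      have "\<rho> powr (- (2 * q) - 4) * \<rho> = \<rho> powr (- (2 * q) - 4 + 1)" unfolding powr_add using \<rho> by simp
      also have "- (2 * q) - 4 + 1 = (- (2 * q) - 5 / 2) + - (1 / 2)" by simp
      also have "\<rho> powr \<dots> = \<rho> powr (- (2 * q) - 5 / 2) * \<rho> powr (- (1 / 2))" by (rule powr_add)
      finally have eq: "\<rho> powr (- (2 * q) - 4) * \<rho> = \<rho> powr (- (2 * q) - 5 / 2) * \<rho> powr (- (1 / 2))" .
      have "\<rho> powr (- (1 / 2)) \<le> (1 / 4) powr (- (1 / 2))" using \<rho> by (intro powr_mono2') auto
      also have "(1 / 4) powr (- (1 / 2)) = (2::real)"
      proof -
        have "(1 / 4) powr (- (1 / 2)) = ((2::real) powr (-2)) powr (- (1 / 2))" by (simp add: powr_minus powr_numeral)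
        also have "\<dots> = 2 powr ((-2) * (- (1 / 2)))" by (rule powr_powr)
        finally show ?thesis by simp
      qed
      finally have "\<rho> powr (- (2 * q) - 5 / 2) * \<rho> powr (- (1 / 2)) \<le> \<rho> powr (- (2 * q) - 5 / 2) * 2"
        by (rule mult_left_mono) simp
      then have "\<rho> powr (- (2 * q) - 4) * \<rho> \<le> 2 * \<rho> powr (- (2 * q) - 5 / 2)" unfolding eq by simp
      then show ?thesis using d q0 density_const_nonneg K by (intro mult_left_mono add_left_mono) auto
    qed
    also have "\<dots> = (C0 * S + 32 * q * B * K) * d * \<rho> powr (- (2 * q) - 5 / 2)" by (simp add: algebra_simps)
    also have "\<rho> powr (- (2 * q) - 5 / 2) = 4 powr (2 * q + 5 / 2) * norm x powr (- (2 * q) - 5 / 2)"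
    proof -
      have "\<rho> powr (- (2 * q) - 5 / 2) = norm x powr (- (2 * q) - 5 / 2) / 4 powr (- (2 * q) - 5 / 2)"
        using x by (simp add: \<rho>_def powr_divide)
      also have "\<dots> = 4 powr (- (- (2 * q) - 5 / 2)) * norm x powr (- (2 * q) - 5 / 2)"
        unfolding powr_minus by (simp add: field_simps)
      also have "- (- (2 * q) - 5 / 2) = 2 * q + 5 / 2" by simp
      finally show ?thesis .
    qed
    finally have A: "\<bar>\<integral>y. T y * \<sigma> y \<partial>lborel\<bar> \<le> C1 * d * norm x powr (- (2 * q) - 5 / 2)"
      by (simp add: C1_def mult_ac)
    have Bd: "\<bar>V \<bullet> Dm\<bar> \<le> C2 * d * norm Dm * norm x powr (- (2 * q) - 2)"
    proof -
      have "\<bar>V \<bullet> Dm\<bar> = \<bar>reg_kernel_d1 q \<epsilon> Dm x' - reg_kernel_d1 q \<epsilon> Dm x\<bar>"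
        unfolding V[symmetric] by (rule abs_minus_commute)
      also have "\<dots> \<le> Kd * d * norm Dm * (norm x / 2) powr (- (2 * q) - 2)"
        unfolding Kd_def d_def using x by (intro reg_kernel_d1_diff_le e q0 seg) auto
      also have "(norm x / 2) powr (- (2 * q) - 2) = norm x powr (- (2 * q) - 2) / 2 powr (- (2 * q) - 2)"
        using x by (simp add: powr_divide)
      also have "\<dots> = 2 powr (- (- (2 * q) - 2)) * norm x powr (- (2 * q) - 2)"
        unfolding powr_minus by (simp add: field_simps)
      also have "- (- (2 * q) - 2) = 2 * q + 2" by simp
      finally show ?thesis by (simp add: C2_def mult_ac)
    qed
    have "\<bar>(\<integral>y. G x y * \<sigma> y \<partial>lborel) - (\<integral>y. G x' y * \<sigma> y \<partial>lborel) - m0 * g0\<bar>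
      \<le> C1 * d * norm x powr (- (2 * q) - 5 / 2) + C2 * d * norm Dm * norm x powr (- (2 * q) - 2)"
      using A Bd intT by linarith
    also have "\<dots> \<le> (C1 + C2) * d * (norm Dm * norm x powr (- (2 * q) - 2) + norm x powr (- (2 * q) - 5 / 2))"
    proof -
      have "0 \<le> C2 * d * norm x powr (- (2 * q) - 5 / 2)" "0 \<le> C1 * d * norm Dm * norm x powr (- (2 * q) - 2)"
        using C12 d by auto
      then show ?thesis by (simp add: algebra_simps)
    qed
    finally show "\<bar>(\<integral>y. reg_kernel q \<epsilon> ((y - x) \<bullet> (y - x)) * \<sigma> y \<partial>lborel) - (\<integral>y. reg_kernel q \<epsilon> ((y - x') \<bullet> (y - x')) * \<sigma> y \<partial>lborel)
        - (\<integral>y. \<sigma> y \<partial>lborel) * (reg_kernel q \<epsilon> (x \<bullet> x) - reg_kernel q \<epsilon> (x' \<bullet> x'))\<bar>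
      \<le> (C1 + C2) * norm (x' - x) * (norm (\<integral>y. \<sigma> y *\<^sub>R y \<partial>lborel) * norm x powr (- (2 * q) - 2) + norm x powr (- (2 * q) - 5 / 2))"
      by (simp add: G_def m0_def g0_def Dm_def d_def)
  qed
qed

end

section \<open>Decay and reflection at infinity\<close>

text \<open>The coefficient 2 p + 2 - n decides the use as a comparison function: it vanishes for p
  = q, the harmonic power |x|^(2 - n), and is positive for p = q + 1.\<close>

lemma has_hessian_inner_powr:
  fixes p R :: real
  assumes "R \<ge> 0"
  obtains g H where "has_hessian (\<lambda>x::'a::euclidean_space. (x \<bullet> x) powr (- p)) g H {x. norm x > R}"
    "\<And>x. norm x > R \<Longrightarrow> lin_trace (H x) = 2 * p * (2 * p + 2 - real DIM('a)) * (x \<bullet> x) powr (- p - 1)"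
proof -
  let ?F' = "\<lambda>s::real. - p * s powr (- p - 1)"
  let ?F'' = "\<lambda>s::real. p * (p + 1) * s powr (- p - 2)"
  let ?g = "\<lambda>y::'a. (2 * ?F' ((y - 0) \<bullet> (y - 0))) *\<^sub>R (y - 0)"
  let ?H = "\<lambda>y h::'a. (2 * ?F' ((y - 0) \<bullet> (y - 0))) *\<^sub>R h + (4 * ?F'' ((y - 0) \<bullet> (y - 0)) * ((y - 0) \<bullet> h)) *\<^sub>R (y - 0)"
  have pos: "x \<bullet> x > 0" if "norm x > R" for x :: 'a using that assms by auto
  have "has_hessian (\<lambda>y. ((y - 0) \<bullet> (y - 0)) powr (- p)) ?g ?H {x. norm x > R}"
  proof (rule has_hessian_radial)
    fix y :: 'a assume "y \<in> {x. norm x > R}"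
    then have s: "(y - 0) \<bullet> (y - 0) > 0" using pos by simp
    show "((\<lambda>s. s powr (- p)) has_real_derivative ?F' ((y - 0) \<bullet> (y - 0))) (at ((y - 0) \<bullet> (y - 0)))"
      using s by (auto intro!: derivative_eq_intros)
    have "((\<lambda>s. - p * s powr (- p - 1)) has_real_derivative - p * ((- p - 1) * ((y - 0) \<bullet> (y - 0)) powr (- p - 1 - 1))) (at ((y - 0) \<bullet> (y - 0)))"
      using s by (intro DERIV_cmult has_real_derivative_powr)
    moreover have "- p - 1 - 1 = - p - 2" by simp
    ultimately show "(?F' has_real_derivative ?F'' ((y - 0) \<bullet> (y - 0))) (at ((y - 0) \<bullet> (y - 0)))"
      by (simp only:) (simp add: algebra_simps)
  qed
  then have "has_hessian (\<lambda>x::'a. (x \<bullet> x) powr (- p)) ?g ?H {x. norm x > R}" by simp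
  moreover have "lin_trace (?H x) = 2 * p * (2 * p + 2 - real DIM('a)) * (x \<bullet> x) powr (- p - 1)" if "norm x > R" for x
  proof -
    have "(x \<bullet> x) powr (- p - 1) = (x \<bullet> x) powr (- p - 2 + 1)" by (intro arg_cong2[of _ _ _ _ "(powr)"]) auto
    also have "\<dots> = (x \<bullet> x) powr (- p - 2) * (x \<bullet> x)" using pos[OF that] unfolding powr_add by simp
    finally have "(x \<bullet> x) powr (- p - 1) = (x \<bullet> x) powr (- p - 2) * (x \<bullet> x)" .
    then show ?thesis unfolding lin_trace_radial by (simp add: algebra_simps)
  qed
  ultimately show ?thesis by (rule that)
qed

lemma continuous_on_inner_powr:
  "R > 0 \<Longrightarrow> continuous_on {x::'a::euclidean_space. norm x \<ge> R} (\<lambda>x. (x \<bullet> x) powr p)"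
  by (intro continuous_intros) auto

lemma tendsto_inner_powr_at_infinity:
  assumes "p > 0"
  shows "((\<lambda>x::'a::euclidean_space. (x \<bullet> x) powr (- p)) \<longlongrightarrow> 0) at_infinity"
proof -
  have "filterlim (\<lambda>x::'a. norm x) at_top at_infinity" by (rule filterlim_norm_at_top)
  then have "((\<lambda>x::'a. norm x powr (- (2 * p))) \<longlongrightarrow> 0) at_infinity"
    using assms by (intro tendsto_neg_powr) auto
  moreover have "(x \<bullet> x) powr (- p) = norm x powr (- (2 * p))" for x :: 'a
  proof (cases "x = 0")
    case False
    then have "x \<bullet> x = norm x powr 2" by (simp add: power2_norm_eq_inner)
    then show ?thesis by (simp only: powr_powr) simp
  qed simp
  ultimately show ?thesis by simp
qed

lemma inner_powr_eq_norm_powr: "(x \<bullet> x) powr p = norm (x::'a::euclidean_space) powr (2 * p)"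
proof (cases "x = 0")
  case False
  then have "x \<bullet> x = norm x powr 2" by (simp add: power2_norm_eq_inner)
  then show ?thesis by (simp only: powr_powr) 
qed simp

lemma compact_sphere_norm: "compact {x::'a::euclidean_space. norm x = R}"
  using compact_sphere[of "0::'a" R] by (simp add: sphere_def dist_norm)

text \<open>A multiple of the harmonic power that dominates w on the sphere of radius R dominates it
  outside, since the difference has negative Laplacian there and tends to 0.\<close>

lemma subharmonic_decay:
  fixes w :: "'a::euclidean_space \<Rightarrow> real"
  assumes q: "q = (real DIM('a) - 2) / 2" "q > 0" and R: "R > 0"
    and w: "has_hessian w g H UNIV" and lim: "(w \<longlongrightarrow> 0) at_infinity"
    and sub: "\<And>x. norm x > R \<Longrightarrow> lin_trace (H x) > 0"
  obtains A where "A \<ge> 0" "\<And>x. norm x \<ge> R \<Longrightarrow> w x \<le> A * norm x powr (- (2 * q))"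
proof -
  have n: "real DIM('a) = 2 * q + 2" using q by simp
  have cw: "continuous_on UNIV w" using w by (rule has_hessian_continuous_on)
  have "bounded (w ` {x. norm x = R})"
    by (intro compact_imp_bounded compact_continuous_image compact_sphere_norm continuous_on_subset[OF cw]) auto
  then obtain B where B: "\<And>x. norm x = R \<Longrightarrow> \<bar>w x\<bar> \<le> B"
    unfolding bounded_iff by (metis (mono_tags, lifting) imageI mem_Collect_eq real_norm_def)
  define A where "A = \<bar>B\<bar> * R powr (2 * q)"
  obtain gb Hb where b: "has_hessian (\<lambda>x::'a. (x \<bullet> x) powr (- q)) gb Hb {x. norm x > R}"
    "\<And>x. norm x > R \<Longrightarrow> lin_trace (Hb x) = 2 * q * (2 * q + 2 - real DIM('a)) * (x \<bullet> x) powr (- q - 1)"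
    by (rule has_hessian_inner_powr[OF less_imp_le[OF R], where 'a='a and p = q]) (rule that; blast)
  have main: "A * (x \<bullet> x) powr (- q) - w x \<ge> 0" if "norm x \<ge> R" for x
  proof (rule exterior_max_principle[OF has_hessian_diff[OF has_hessian_cmult[OF b(1)] has_hessian_subset[OF w]] _ _ _ _ that])
    show "continuous_on {x. norm x \<ge> R} (\<lambda>x. A * (x \<bullet> x) powr (- q) - w x)"
      by (rule continuous_on_diff[OF continuous_on_mult[OF continuous_on_const continuous_on_inner_powr[OF R]]
            continuous_on_subset[OF cw subset_UNIV]])
    show "((\<lambda>x. A * (x \<bullet> x) powr (- q) - w x) \<longlongrightarrow> 0) at_infinity"
      using tendsto_diff[OF tendsto_mult[OF tendsto_const tendsto_inner_powr_at_infinity[OF q(2)]] lim, of A] by simp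
    show "0 \<le> A * (x \<bullet> x) powr (- q) - w x" if "norm x = R" for x
      using B[OF that] R by (simp add: inner_powr_eq_norm_powr that A_def mult.assoc powr_add[symmetric])
    show "lin_trace (\<lambda>h. A *\<^sub>R Hb x h - H x h) < 0" if "R < norm x" for x
      using sub[OF that] b(2)[OF that] by (simp add: lin_trace_diff lin_trace_cmult n)
  qed auto
  show ?thesis
  proof (rule that[of A])
    show "w x \<le> A * norm x powr (- (2 * q))" if "norm x \<ge> R" for x
      using main[OF that] by (simp add: inner_powr_eq_norm_powr)
  qed (simp add: A_def)
qed

text \<open>The harmonic power alone is no lower barrier, as w may be strictly subharmonic. Adding K
  |x|^(- n) gives a barrier whose Laplacian outweighs the term K |x|^(- 4) w wherever w lies below
  it. The radius \<open>sqrt K\<close> makes the correction at most as large as the main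
  term.\<close>

lemma positive_lower_decay:
  fixes w :: "'a::euclidean_space \<Rightarrow> real"
  assumes q: "q = (real DIM('a) - 2) / 2" "q > 0" and R: "R > 0"
    and w: "has_hessian w g H UNIV" and lim: "(w \<longlongrightarrow> 0) at_infinity" and pos: "\<And>x. w x > 0"
    and K: "K > 0" "\<And>x. norm x > R \<Longrightarrow> lin_trace (H x) \<le> K * (x \<bullet> x) powr (- 2) * w x"
  obtains m R' where "m > 0" "\<And>x. norm x \<ge> R' \<Longrightarrow> w x \<ge> m * norm x powr (- (2 * q))"
proof -
  have n: "real DIM('a) = 2 * q + 2" using q by simp
  have cw: "continuous_on UNIV w" using w by (rule has_hessian_continuous_on)
  define R' where "R' = max R (sqrt K)"
  have R': "R' > 0" "R' \<ge> R" using R by (auto simp: R'_def)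
  have R'K: "K \<le> x \<bullet> x" if "norm x > R'" for x :: 'a
  proof -
    have "sqrt K \<le> norm x" using that by (simp add: R'_def)
    then have "(sqrt K)\<^sup>2 \<le> (norm x)\<^sup>2" using K by (intro power_mono) auto
    then show ?thesis using K by (simp add: power2_norm_eq_inner)
  qed
  have ne: "{x::'a. norm x = R'} \<noteq> {}" using vector_choose_size[of R'] R' by (metis (mono_tags, lifting) empty_iff less_imp_le mem_Collect_eq)
  obtain z where z: "norm z = R'" "\<And>x. norm x = R' \<Longrightarrow> w z \<le> w x"
    using continuous_attains_inf[OF compact_sphere_norm ne continuous_on_subset[OF cw]] by auto
  define c0 where "c0 x = (x \<bullet> x) powr (- q) + K * (x \<bullet> x) powr (- (q + 1))" for x :: 'a
  define c where "c = R' powr (2 * - q) + K * R' powr (2 * - (q + 1))"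
  have c: "c > 0" "\<And>x. norm x = R' \<Longrightarrow> c0 x = c"
    using R' K by (auto simp: c_def c0_def inner_powr_eq_norm_powr add_pos_pos)
  define m where "m = w z / c"
  have m: "m > 0" using pos c by (simp add: m_def)
  obtain gb Hb where b: "has_hessian (\<lambda>x::'a. (x \<bullet> x) powr (- q)) gb Hb {x. norm x > R'}"
    "\<And>x. norm x > R' \<Longrightarrow> lin_trace (Hb x) = 2 * q * (2 * q + 2 - real DIM('a)) * (x \<bullet> x) powr (- q - 1)"
    by (rule has_hessian_inner_powr[OF less_imp_le[OF R'(1)], where 'a='a and p = q]) (rule that; blast)
  obtain gc Hc where cc: "has_hessian (\<lambda>x::'a. (x \<bullet> x) powr (- (q + 1))) gc Hc {x. norm x > R'}"
    "\<And>x. norm x > R' \<Longrightarrow> lin_trace (Hc x) = 2 * (q + 1) * (2 * (q + 1) + 2 - real DIM('a)) * (x \<bullet> x) powr (- (q + 1) - 1)"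
    by (rule has_hessian_inner_powr[OF less_imp_le[OF R'(1)], where 'a='a and p = "q + 1"]) (rule that; blast)
  have main: "w x - m * c0 x \<ge> 0" if "norm x \<ge> R'" for x
  proof (rule exterior_max_principle[where R = R' and f = "\<lambda>x. w x - m * c0 x"])
    show "has_hessian (\<lambda>x. w x - m * c0 x) (\<lambda>x. g x - m *\<^sub>R (gb x + K *\<^sub>R gc x))
        (\<lambda>x h. H x h - m *\<^sub>R (Hb x h + K *\<^sub>R Hc x h)) {x. norm x > R'}"
      unfolding c0_def
      by (rule has_hessian_diff[OF has_hessian_subset[OF w subset_UNIV]
            has_hessian_cmult[OF has_hessian_add[OF b(1) has_hessian_cmult[OF cc(1)]]]])
    show "continuous_on {x. norm x \<ge> R'} (\<lambda>x. w x - m * c0 x)"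
      unfolding c0_def
      by (rule continuous_on_diff[OF continuous_on_subset[OF cw subset_UNIV]
            continuous_on_mult[OF continuous_on_const continuous_on_add[OF continuous_on_inner_powr[OF R'(1)]
              continuous_on_mult[OF continuous_on_const continuous_on_inner_powr[OF R'(1)]]]]])
    have "((\<lambda>x. w x - m * ((x \<bullet> x) powr (- q) + K * (x \<bullet> x) powr (- (q + 1)))) \<longlongrightarrow> 0 - m * (0 + K * 0)) at_infinity"
      using q by (intro tendsto_intros lim tendsto_inner_powr_at_infinity) auto
    then show "((\<lambda>x. w x - m * c0 x) \<longlongrightarrow> 0) at_infinity" by (simp add: c0_def)
    show "0 \<le> w x - m * c0 x" if "norm x = R'" for x
      using z(2)[OF that] c by (simp add: c(2)[OF that] m_def)
    show "lin_trace (\<lambda>h. H x h - m *\<^sub>R (Hb x h + K *\<^sub>R Hc x h)) < 0" if x: "R' < norm x" and neg: "w x - m * c0 x < 0" for x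
    proof -
      define s where "s = x \<bullet> x"
      have s: "s > 0" "K \<le> s" using R'K[OF x] K by (auto simp: s_def)
      have "lin_trace (H x) \<le> K * s powr (- 2) * w x" using K(2)[of x] x R' by (simp add: s_def)
      also have "\<dots> < K * s powr (- 2) * (m * c0 x)" using neg K s by (intro mult_strict_left_mono mult_pos_pos) auto
      also have "\<dots> = m * K * (s powr (- 2 + - q) + K * s powr (- 2 + - (q + 1)))"
        unfolding c0_def s_def[symmetric] powr_add by (simp add: algebra_simps)
      also have "\<dots> \<le> m * K * (2 * s powr (- q - 2))"
      proof -
        have "K * s powr (- 2 + - (q + 1)) \<le> s * s powr (- 2 + - (q + 1))" using s by (intro mult_right_mono) auto
        also have "\<dots> = s powr (1 + (- 2 + - (q + 1)))" using s unfolding powr_add[of s 1] by simp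
        also have "\<dots> = s powr (- q - 2)" by (intro arg_cong2[of _ _ _ _ "(powr)"]) auto
        finally have "s powr (- 2 + - q) + K * s powr (- 2 + - (q + 1)) \<le> 2 * s powr (- q - 2)"
          by (simp add: algebra_simps)
        then show ?thesis using m K by (intro mult_left_mono) auto
      qed
      also have "\<dots> \<le> m * (K * lin_trace (Hc x))"
      proof -
        have "2 * 1 * s powr (- q - 2) \<le> 4 * (q + 1) * s powr (- q - 2)" using q by (intro mult_right_mono) auto
        moreover have "lin_trace (Hc x) = 4 * (q + 1) * s powr (- q - 2)"
        proof -
          have "- (q + 1) - 1 = - q - 2" by simp
          then show ?thesis unfolding cc(2)[OF x] n s_def by (simp only:) simp
        qed
        ultimately have "2 * s powr (- q - 2) \<le> lin_trace (Hc x)" by simp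
        then show ?thesis using m K by (simp add: mult.assoc mult_left_mono)
      qed
      finally show ?thesis using b(2)[OF x] by (simp add: lin_trace_diff lin_trace_cmult lin_trace_add n)
    qed
  qed (rule that)
  show ?thesis
  proof (rule that[OF m])
    fix x :: 'a assume x: "norm x \<ge> R'"
    have "m * (x \<bullet> x) powr (- q) \<le> m * c0 x" using m K by (simp add: c0_def)
    then show "w x \<ge> m * norm x powr (- (2 * q))" using main[OF x] by (simp add: inner_powr_eq_norm_powr)
  qed
qed

text \<open>Telescoping along x, 2 x, 4 x, ... towards the limit 0. For b \<ge> 1 consecutive
  increments shrink by a factor of at most 1/2, hence the constant 2.\<close>

lemma dyadic_decay:
  fixes h :: "'a::euclidean_space \<Rightarrow> real"
  assumes lim: "(h \<longlongrightarrow> 0) at_infinity" and C: "C \<ge> 0" and b: "b \<ge> 1"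
    and step: "\<And>x. norm x \<ge> 1 \<Longrightarrow> \<bar>h x - h (2 *\<^sub>R x)\<bar> \<le> C * norm x powr (- b)"
    and x: "norm x \<ge> 1"
  shows "\<bar>h x\<bar> \<le> 2 * C * norm x powr (- b)"
proof -
  have ind: "norm x \<ge> 1 \<Longrightarrow> \<bar>h x\<bar> \<le> \<bar>h (2 ^ N *\<^sub>R x)\<bar> + 2 * C * norm x powr (- b)" for N and x :: 'a
  proof (induction N arbitrary: x)
    case 0
    then show ?case using C by simp
  next
    case (Suc N)
    have "\<bar>h x\<bar> \<le> C * norm x powr (- b) + \<bar>h (2 *\<^sub>R x)\<bar>" using step[OF Suc.prems] by linarith
    also have "\<bar>h (2 *\<^sub>R x)\<bar> \<le> \<bar>h (2 ^ N *\<^sub>R (2 *\<^sub>R x))\<bar> + 2 * C * norm (2 *\<^sub>R x) powr (- b)"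
      using Suc.prems by (intro Suc.IH) simp
    also have "2 * C * norm (2 *\<^sub>R x) powr (- b) \<le> C * norm x powr (- b)"
    proof -
      have "(2::real) powr (- b) \<le> 2 powr (- 1)" using b by (intro powr_mono) auto
      then have "2 * 2 powr (- b) \<le> (1::real)" by (simp add: powr_minus)
      then have "(2 * 2 powr (- b)) * (C * norm x powr (- b)) \<le> 1 * (C * norm x powr (- b))"
        using C by (intro mult_right_mono) auto
      then show ?thesis by (simp add: powr_mult mult_ac)
    qed
    finally show ?case by (simp add: mult.commute)
  qed
  have "filterlim (\<lambda>N::nat. (2::real) ^ N) at_top sequentially"
    using filterlim_compose[OF filterlim_norm_at_top filterlim_realpow_sequentially_gt1[of "2::real"]]
    by (simp add: norm_power)
  then have "filterlim (\<lambda>N::nat. norm x * 2 ^ N) at_top sequentially"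
    using x by (intro filterlim_tendsto_pos_mult_at_top[OF tendsto_const]) auto
  then have "filterlim (\<lambda>N::nat. 2 ^ N *\<^sub>R x) at_infinity sequentially"
    by (intro filterlim_norm_at_top_imp_at_infinity) (simp add: mult.commute)
  then have "(\<lambda>N. h (2 ^ N *\<^sub>R x)) \<longlonglongrightarrow> 0" by (rule filterlim_compose[OF lim])
  then have "(\<lambda>N. \<bar>h (2 ^ N *\<^sub>R x)\<bar> + 2 * C * norm x powr (- b)) \<longlonglongrightarrow> \<bar>0\<bar> + 2 * C * norm x powr (- b)"
    by (intro tendsto_intros)
  then have "\<bar>h x\<bar> \<le> \<bar>0\<bar> + 2 * C * norm x powr (- b)"
    by (rule LIMSEQ_le_const) (use ind[OF x] in auto)
  then show ?thesis by simp
qed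

section \<open>Comparison with the mirror image far from the origin\<close>

lemma norm_refl_plane_sq:
  assumes "norm e = 1"
  shows "(norm (refl_plane e \<mu> x))\<^sup>2 = (norm x)\<^sup>2 + 4 * \<mu> * (\<mu> - x \<bullet> e)"
proof -
  have e: "e \<bullet> e = 1" using assms by (simp add: norm_eq_1)
  show ?thesis
    unfolding power2_norm_eq_inner refl_plane_def
    by (simp add: inner_add_left inner_add_right e inner_commute[of e x] algebra_simps)
qed

lemma powr_gap_ge:
  fixes r \<rho> q :: real
  assumes "0 < r" "r \<le> \<rho>" "\<rho> \<le> 2 * r" "q > 0"
  shows "r powr (- (2 * q)) - \<rho> powr (- (2 * q)) \<ge> 2 * q * (\<rho> - r) * (2 * r) powr (- (2 * q) - 1)"
proof (cases "r = \<rho>")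
  case False
  then have "r < \<rho>" using assms by simp
  have "((\<lambda>t. t powr (- (2 * q))) has_real_derivative (- (2 * q) * t powr (- (2 * q) - 1))) (at t)" if "t > 0" for t :: real
    using that by (auto intro!: derivative_eq_intros)
  then obtain z where z: "r < z" "z < \<rho>"
    "\<rho> powr (- (2 * q)) - r powr (- (2 * q)) = (\<rho> - r) * (- (2 * q) * z powr (- (2 * q) - 1))"
    using MVT2[OF \<open>r < \<rho>\<close>, of "\<lambda>t. t powr (- (2 * q))" "\<lambda>t. - (2 * q) * t powr (- (2 * q) - 1)"] assms by auto
  have "(2 * r) powr (- (2 * q) - 1) \<le> z powr (- (2 * q) - 1)" using z assms by (intro powr_mono2') auto
  then have "2 * q * (\<rho> - r) * (2 * r) powr (- (2 * q) - 1) \<le> 2 * q * (\<rho> - r) * z powr (- (2 * q) - 1)"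
    using assms by (intro mult_left_mono) auto
  then show ?thesis using z(3) by (simp add: algebra_simps)
qed simp

text \<open>
  The monopole gains at least a multiple of \<open>d r\<^bsup>- n\<^esup>\<close> (as long as \<open>|x'| \<le> 2 r\<close>), with \<open>d\<close> the distance of \<open>x\<close> to the plane.
  The Lipschitz estimate \<open>E2\<close> handles points whose segment to the mirror image avoids the origin,
  the pointwise estimate \<open>E1\<close> all others.
\<close>

lemma reflection_gap_at_infinity:
  fixes w :: "'a::euclidean_space \<Rightarrow> real"
  assumes M: "M > 0" and m0: "m0 > 0" and C: "C \<ge> 0" and q: "q > 0"
    and E1: "\<And>x. norm x \<ge> 1 \<Longrightarrow> \<bar>M * w x - m0 * norm x powr (- (2 * q))\<bar> \<le> C * norm x powr (- (2 * q) - 3 / 2)"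
    and E2: "\<And>x x'. norm x \<ge> 1 \<Longrightarrow> (\<And>s. 0 \<le> s \<Longrightarrow> s \<le> 1 \<Longrightarrow> norm (x + s *\<^sub>R (x' - x)) \<ge> norm x / 2) \<Longrightarrow>
      \<bar>M * w x - M * w x' - m0 * (norm x powr (- (2 * q)) - norm x' powr (- (2 * q)))\<bar>
        \<le> C * norm (x' - x) * norm x powr (- (2 * q) - 5 / 2)"
    and lpos: "l0 > 0"
  obtains R where "\<And>\<mu> e x. \<mu> \<ge> l0 \<Longrightarrow> norm e = 1 \<Longrightarrow> norm x > R \<Longrightarrow> x \<bullet> e < \<mu> \<Longrightarrow> w (refl_plane e \<mu> x) < w x"
proof -
  \<comment> \<open>\<open>\<kappa>1\<close> measures the monopole gain when the image is more than
    twice as far out as x, \<open>\<kappa>2\<close> the gain per unit of distance to the plane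
    otherwise.\<close>
  define \<kappa>1 where "\<kappa>1 = 1 - 2 powr (- (2 * q))"
  define \<kappa>2 where "\<kappa>2 = 2 * q * l0 * 2 powr (- (2 * q) - 1)"
  define \<kappa> where "\<kappa> = m0 * min \<kappa>1 \<kappa>2"
  have "2 powr (- (2 * q)) < (1::real)" using q by (simp add: powr_less_one)
  then have \<kappa>12: "\<kappa>1 > 0" "\<kappa>2 > 0" using q lpos by (auto simp: \<kappa>1_def \<kappa>2_def)
  then have \<kappa>: "\<kappa> > 0" "\<kappa> \<le> m0 * \<kappa>1" "\<kappa> \<le> m0 * \<kappa>2" using m0 by (auto simp: \<kappa>_def)
  \<comment> \<open>Beyond this radius 4 C is less than \<kappa> times the square root of |x|, which
    is the half power separating the remainder from the gain in each case.\<close>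
  define R where "R = max 1 ((4 * C / \<kappa>)\<^sup>2)"
  show ?thesis
  proof (rule that[of R])
    fix \<mu> :: real and e x :: 'a
    assume \<mu>: "\<mu> \<ge> l0" and e: "norm e = 1" and xR: "norm x > R" and xe: "x \<bullet> e < \<mu>"
    define r where "r = norm x"
    define d where "d = \<mu> - x \<bullet> e"
    define x' where "x' = refl_plane e \<mu> x"
    define \<rho> where "\<rho> = norm x'"
    have r: "r > 1" "r > (4 * C / \<kappa>)\<^sup>2" using xR by (auto simp: r_def R_def)
    have d: "d > 0" using xe by (simp add: d_def)
    have sq: "\<rho>\<^sup>2 = r\<^sup>2 + 4 * \<mu> * d" unfolding \<rho>_def x'_def r_def d_def by (rule norm_refl_plane_sq[OF e])
    have \<rho>0: "\<rho> \<ge> 0" by (simp add: \<rho>_def)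
    have r\<rho>: "r \<le> \<rho>"
      by (rule power2_le_imp_le) (use sq \<rho>0 \<mu> lpos d in auto)
    have x'x: "x' - x = (2 * d) *\<^sub>R e" by (simp add: x'_def refl_plane_def d_def)
    define h where "h z = M * w z - m0 * norm z powr (- (2 * q))" for z
    have rC: "4 * C < \<kappa> * r powr (1 / 2)"
    proof -
      have "4 * C / \<kappa> < sqrt r" using r C \<kappa> by (intro real_less_rsqrt) auto
      then show ?thesis using \<kappa> r by (simp add: powr_half_sqrt field_simps)
    qed
    have h1: "\<bar>h x\<bar> + \<bar>h x'\<bar> \<le> 2 * C * r powr (- (2 * q) - 3 / 2)"
    proof -
      have "\<bar>h x\<bar> \<le> C * r powr (- (2 * q) - 3 / 2)" using E1[of x] r by (simp add: h_def r_def)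
      moreover have "\<bar>h x'\<bar> \<le> C * \<rho> powr (- (2 * q) - 3 / 2)" using E1[of x'] r r\<rho> by (simp add: h_def \<rho>_def)
      moreover have "C * \<rho> powr (- (2 * q) - 3 / 2) \<le> C * r powr (- (2 * q) - 3 / 2)"
        using C r r\<rho> q by (intro mult_left_mono powr_mono2') auto
      ultimately show ?thesis by linarith
    qed
    have split_powr: "r powr a = r powr (1 / 2) * r powr b" if "a = 1 / 2 + b" for a b
      unfolding that by (rule powr_add)
    have "\<bar>h x - h x'\<bar> < m0 * (r powr (- (2 * q)) - \<rho> powr (- (2 * q)))"
    proof (cases "\<rho> \<le> 2 * r")
      case False
      have "\<rho> powr (- (2 * q)) \<le> (2 * r) powr (- (2 * q))" using False r q by (intro powr_mono2') auto
      also have "\<dots> = 2 powr (- (2 * q)) * r powr (- (2 * q))" using r by (simp add: powr_mult)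
      finally have "\<kappa>1 * r powr (- (2 * q)) \<le> r powr (- (2 * q)) - \<rho> powr (- (2 * q))"
        by (simp add: \<kappa>1_def algebra_simps)
      then have g: "m0 * (\<kappa>1 * r powr (- (2 * q))) \<le> m0 * (r powr (- (2 * q)) - \<rho> powr (- (2 * q)))"
        using m0 by (intro mult_left_mono) auto
      have "\<bar>h x - h x'\<bar> \<le> 2 * C * r powr (- (2 * q) - 3 / 2)" using h1 by linarith
      also have "\<dots> \<le> 4 * C * r powr (- (2 * q) - 1 / 2)"
        using C r by (intro mult_mono powr_mono) auto
      also have "\<dots> < \<kappa> * r powr (1 / 2) * r powr (- (2 * q) - 1 / 2)"
        using rC r by (intro mult_strict_right_mono) auto
      also have "\<dots> = \<kappa> * r powr (- (2 * q))" using split_powr[of "- (2 * q)" "- (2 * q) - 1 / 2"] by simp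
      also have "\<dots> \<le> m0 * \<kappa>1 * r powr (- (2 * q))" using \<kappa> by (intro mult_right_mono) auto
      finally show ?thesis using g by simp
    next
      case True
      \<comment> \<open>\<open>\<rho>\<^sup>2 - r\<^sup>2 = 4 * \<mu> * d\<close> and \<rho> + r
        \<le> 3 r give \<rho> - r \<ge> l0 d / r. The mean value theorem for the power turns this
        into a gain proportional to d.\<close>
      have gap: "\<kappa>2 * d * r powr (- (2 * q) - 2) \<le> r powr (- (2 * q)) - \<rho> powr (- (2 * q))"
      proof -
        have "(\<rho> - r) * (\<rho> + r) = 4 * \<mu> * d" using sq by (simp add: algebra_simps power2_eq_square)
        moreover have "(\<rho> - r) * (\<rho> + r) \<le> (\<rho> - r) * (3 * r)" using True r\<rho> by (intro mult_left_mono) auto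
        ultimately have "4 * \<mu> * d \<le> 3 * ((\<rho> - r) * r)" by simp
        moreover have "l0 * d \<le> \<mu> * d" using \<mu> d by simp
        moreover have "0 \<le> (\<rho> - r) * r" using r\<rho> r by simp
        ultimately have "l0 * d \<le> (\<rho> - r) * r" by linarith
        then have gd: "l0 * d / r \<le> \<rho> - r" using r by (simp add: field_simps)
        have "- (2 * q) - 1 = 1 + (- (2 * q) - 2)" by simp
        then have "r powr (- (2 * q) - 1) = r powr (1 + (- (2 * q) - 2))" by (rule arg_cong)
        then have rr: "r powr (- (2 * q) - 1) = r * r powr (- (2 * q) - 2)" unfolding powr_add using r by simp
        have "\<kappa>2 * d * r powr (- (2 * q) - 2) = 2 * q * (l0 * d / r) * (2 * r) powr (- (2 * q) - 1)"
          using r by (simp add: \<kappa>2_def powr_mult rr)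
        also have "\<dots> \<le> 2 * q * (\<rho> - r) * (2 * r) powr (- (2 * q) - 1)"
          using gd q by (intro mult_right_mono mult_left_mono) auto
        also have "\<dots> \<le> r powr (- (2 * q)) - \<rho> powr (- (2 * q))"
          using r r\<rho> True q by (intro powr_gap_ge) auto
        finally show ?thesis .
      qed
      have g: "\<kappa> * d * r powr (- (2 * q) - 2) \<le> m0 * (r powr (- (2 * q)) - \<rho> powr (- (2 * q)))"
      proof -
        have "\<kappa> * (d * r powr (- (2 * q) - 2)) \<le> m0 * \<kappa>2 * (d * r powr (- (2 * q) - 2))"
          using \<kappa> d by (intro mult_right_mono) auto
        also have "\<dots> \<le> m0 * (r powr (- (2 * q)) - \<rho> powr (- (2 * q)))"
          using gap m0 by (simp add: mult.assoc mult_left_mono)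
        finally show ?thesis by (simp add: mult.assoc)
      qed
      show ?thesis
      \<comment> \<open>If x does not point too far against e, the segment x + t e keeps distance r
        / 2 from the origin, by completing the square in t, and the Lipschitz estimate
        applies.\<close>
      proof (cases "x \<bullet> e \<ge> - r / 2")
        case xe: True
        have "\<bar>h x - h x'\<bar> \<le> C * norm (x' - x) * r powr (- (2 * q) - 5 / 2)"
        proof -
          have "norm (x + s *\<^sub>R (x' - x)) \<ge> norm x / 2" if s: "0 \<le> s" "s \<le> 1" for s
          proof (rule power2_le_imp_le)
            define t where "t = s * (2 * d)"
            have t: "t \<ge> 0" using s d by (simp add: t_def)
            have ee: "e \<bullet> e = 1" using e by (simp add: norm_eq_1)
            have "(norm (x + s *\<^sub>R (x' - x)))\<^sup>2 = r\<^sup>2 + 2 * (t * (x \<bullet> e)) + t\<^sup>2"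
              unfolding power2_norm_eq_inner x'x r_def
              by (simp add: inner_add_left inner_add_right ee inner_commute[of e x] t_def power2_eq_square algebra_simps)
            moreover have "t * (x \<bullet> e) \<ge> t * (- r / 2)" using t xe by (intro mult_left_mono) auto
            moreover have "t * (- r / 2) = - (r * t) / 2" by simp
            moreover have "0 \<le> (r / 2 - t)\<^sup>2" by simp
            then have "0 \<le> r\<^sup>2 / 4 - r * t + t\<^sup>2" by (simp add: power2_diff power_divide)
            moreover have "0 \<le> r\<^sup>2" "(r / 2)\<^sup>2 = r\<^sup>2 / 4" by (auto simp: power_divide)
            ultimately have "(norm (x + s *\<^sub>R (x' - x)))\<^sup>2 \<ge> (r / 2)\<^sup>2" by linarith
            then show "(norm x / 2)\<^sup>2 \<le> (norm (x + s *\<^sub>R (x' - x)))\<^sup>2" by (simp add: r_def)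
          qed simp
          then show ?thesis using E2[of x x'] r by (simp add: h_def r_def algebra_simps)
        qed
        also have "norm (x' - x) = 2 * d" using d e by (simp add: x'x)
        also have "C * (2 * d) * r powr (- (2 * q) - 5 / 2) \<le> 4 * C * (d * r powr (- (2 * q) - 5 / 2))"
          using C d by (simp add: mult.assoc[symmetric] mult_right_mono)
        also have "\<dots> < \<kappa> * r powr (1 / 2) * (d * r powr (- (2 * q) - 5 / 2))"
          using rC r d by (intro mult_strict_right_mono mult_pos_pos) auto
        also have "\<dots> = \<kappa> * d * r powr (- (2 * q) - 2)" using split_powr[of "- (2 * q) - 2" "- (2 * q) - 5 / 2"] by simp
        finally show ?thesis using g by simp
      next
        case xe: False
        \<comment> \<open>Here the plane is far away, as \<mu> > 0, so the gain is already of order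
          r^(- 2 q - 1) and the pointwise remainder is smaller by half a power.\<close>
        then have dr: "d \<ge> r / 2" using \<mu> lpos by (simp add: d_def)
        have "\<bar>h x - h x'\<bar> \<le> 2 * C * r powr (- (2 * q) - 3 / 2)" using h1 by linarith
        also have "\<dots> = 4 * C * (r powr (- (2 * q) - 3 / 2) / 2)" by simp
        also have "\<dots> < \<kappa> * r powr (1 / 2) * (r powr (- (2 * q) - 3 / 2) / 2)"
          using rC r by (intro mult_strict_right_mono) auto
        also have "\<dots> = \<kappa> * (r powr (- (2 * q) - 1) / 2)" using split_powr[of "- (2 * q) - 1" "- (2 * q) - 3 / 2"] by simp
        also have "r powr (- (2 * q) - 1) / 2 = (r / 2) * r powr (- (2 * q) - 2)"
        proof -
          have "- (2 * q) - 1 = 1 + (- (2 * q) - 2)" by simp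
          then have "r powr (- (2 * q) - 1) = r powr (1 + (- (2 * q) - 2))" by (rule arg_cong)
          then show ?thesis unfolding powr_add using r by simp
        qed
        also have "\<kappa> * ((r / 2) * r powr (- (2 * q) - 2)) \<le> \<kappa> * (d * r powr (- (2 * q) - 2))"
          using dr \<kappa> by (intro mult_left_mono mult_right_mono) auto
        finally show ?thesis using g by simp
      qed
    qed
    then have "0 < M * w x - M * w x'" unfolding h_def r_def \<rho>_def by (simp add: algebra_simps)
    then show "w (refl_plane e \<mu> x) < w x" using M by (simp add: x'_def)
  qed
qed

section \<open>Moving planes\<close>

lemma has_hessian_cos_inner:
  "has_hessian (\<lambda>x. cos (k * (x \<bullet> e - \<mu>))) (\<lambda>x. (- k * sin (k * (x \<bullet> e - \<mu>))) *\<^sub>R e)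
     (\<lambda>x h. (- k\<^sup>2 * cos (k * (x \<bullet> e - \<mu>)) * (h \<bullet> e)) *\<^sub>R e) S"
proof -
  have c: "((\<lambda>x. cos (k * (x \<bullet> e - \<mu>))) has_derivative (\<lambda>h. ((- k * sin (k * (x \<bullet> e - \<mu>))) *\<^sub>R e) \<bullet> h)) (at x)" for x
    by (rule derivative_eq_intros refl)+ (auto simp: inner_commute algebra_simps)
  have s: "((\<lambda>x. (- k * sin (k * (x \<bullet> e - \<mu>))) *\<^sub>R e) has_derivative
      (\<lambda>h. (- k\<^sup>2 * cos (k * (x \<bullet> e - \<mu>)) * (h \<bullet> e)) *\<^sub>R e)) (at x)" for x
    by (rule derivative_eq_intros refl)+ (auto simp: power2_eq_square algebra_simps)
  show ?thesis unfolding has_hessian_def using c s by blast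
qed

lemma lin_trace_rank_one: "lin_trace (\<lambda>h. (c * (h \<bullet> e)) *\<^sub>R e) = c * (e \<bullet> e)"
proof -
  have "lin_trace (\<lambda>h. (c * (h \<bullet> e)) *\<^sub>R e) = (\<Sum>i\<in>Basis. c * ((e \<bullet> i) * (e \<bullet> i)))"
    unfolding lin_trace_def by (intro sum.cong) (auto simp: inner_commute)
  then show ?thesis by (simp add: sum_distrib_left[symmetric] sum_Basis_inner_mult)
qed

text \<open>Hopf's barrier: on an annulus around y the Gaussian exp (- \<alpha> |x - y|^2), lowered
  to vanish on the outer sphere, has a Laplacian so large that m times it cannot exceed z.
  Positivity thus spreads from the small ball to the large one.\<close>

lemma strong_max_principle_ball:
  fixes z :: "'a::euclidean_space \<Rightarrow> real"
  assumes z: "has_hessian z g H UNIV" and K: "K \<ge> 0" and \<rho>: "0 < \<rho>"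
    and nn: "\<And>x. dist y x < r \<Longrightarrow> z x \<ge> 0" and sup: "\<And>x. dist y x < r \<Longrightarrow> lin_trace (H x) \<le> K * z x"
    and pos: "\<And>x. dist y x \<le> \<rho> \<Longrightarrow> z x > 0" and x: "dist y x < r"
  shows "z x > 0"
proof (cases "dist y x \<le> \<rho>")
  case False
  have cz: "continuous_on UNIV z" using z by (rule has_hessian_continuous_on)
  \<comment> \<open>The outer sphere is taken strictly inside the open ball, where z is known to be
    nonnegative, and strictly beyond x, so that the barrier is positive at x.\<close>
  obtain r' where r': "dist y x < r'" "r' < r" using x dense by blast
  have "cball y \<rho> \<noteq> {}" using \<rho> by auto
  then obtain p where p: "p \<in> cball y \<rho>" "\<And>x. x \<in> cball y \<rho> \<Longrightarrow> z p \<le> z x"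
    using continuous_attains_inf[of "cball y \<rho>" z] continuous_on_subset[OF cz] by auto
  define m where "m = z p"
  have m: "m > 0" "\<And>x. dist y x \<le> \<rho> \<Longrightarrow> m \<le> z x" using p pos by (auto simp: m_def)
  define n where "n = real DIM('a)"
  \<comment> \<open>Makes \<open>4 * \<alpha> * \<rho>\<^sup>2 - 2 * n \<ge> K + 1\<close>, so the
    barrier's Laplacian exceeds K times the Gaussian throughout the annulus; \<alpha> \<ge> 1
    handles the remaining factor \<alpha>.\<close>
  define \<alpha> where "\<alpha> = max 1 ((2 * n + K + 1) / (4 * \<rho>\<^sup>2))"
  have \<alpha>: "\<alpha> \<ge> 1" "4 * \<alpha> * \<rho>\<^sup>2 \<ge> 2 * n + K + 1"
  proof -
    have "(2 * n + K + 1) / (4 * \<rho>\<^sup>2) \<le> \<alpha>" by (simp add: \<alpha>_def)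
    then show "4 * \<alpha> * \<rho>\<^sup>2 \<ge> 2 * n + K + 1" using \<rho> by (simp add: field_simps)
  qed (simp add: \<alpha>_def)
  define F where "F s = exp (- \<alpha> * s) - exp (- \<alpha> * r'\<^sup>2)" for s
  define gb where "gb x = (2 * (- \<alpha> * exp (- \<alpha> * ((x - y) \<bullet> (x - y))))) *\<^sub>R (x - y)" for x
  define Hb where "Hb x h = (2 * (- \<alpha> * exp (- \<alpha> * ((x - y) \<bullet> (x - y))))) *\<^sub>R h +
     (4 * (\<alpha>\<^sup>2 * exp (- \<alpha> * ((x - y) \<bullet> (x - y)))) * ((x - y) \<bullet> h)) *\<^sub>R (x - y)" for x h
  have hb: "has_hessian (\<lambda>x. F ((x - y) \<bullet> (x - y))) gb Hb UNIV"
    unfolding gb_def[abs_def] Hb_def[abs_def]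
  proof (rule has_hessian_radial)
    show "(F has_real_derivative - \<alpha> * exp (- \<alpha> * s)) (at s)" for s
      unfolding F_def[abs_def] by (auto intro!: derivative_eq_intros)
    show "((\<lambda>s. - \<alpha> * exp (- \<alpha> * s)) has_real_derivative \<alpha>\<^sup>2 * exp (- \<alpha> * s)) (at s)" for s
      by (auto intro!: derivative_eq_intros simp: power2_eq_square)
  qed
  have tb: "lin_trace (Hb x) = exp (- \<alpha> * ((x - y) \<bullet> (x - y))) * (\<alpha> * (4 * \<alpha> * ((x - y) \<bullet> (x - y)) - 2 * n))" for x
    unfolding Hb_def lin_trace_radial n_def by (simp add: algebra_simps power2_eq_square)
  define f where "f x = z x - m * F ((x - y) \<bullet> (x - y))" for x
  have hf: "has_hessian f (\<lambda>x. g x - m *\<^sub>R gb x) (\<lambda>x h. H x h - m *\<^sub>R Hb x h) UNIV"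
    unfolding f_def[abs_def] by (rule has_hessian_diff[OF z has_hessian_cmult[OF hb]])
  define A where "A = {x. \<rho> \<le> dist y x} \<inter> cball y r'"
  have "compact A" unfolding A_def
    by (rule closed_Int_compact) (intro closed_Collect_le continuous_intros compact_cball)+
  moreover have xA: "x \<in> A" using False r' by (simp add: A_def)
  moreover have "continuous_on A f"
    by (rule continuous_on_subset[OF has_hessian_continuous_on[OF hf]]) simp
  ultimately obtain q where q: "q \<in> A" "\<And>x. x \<in> A \<Longrightarrow> f q \<le> f x"
    using continuous_attains_inf[of A f] by auto
  have qd: "(q - y) \<bullet> (q - y) = (dist y q)\<^sup>2" for q
    by (simp add: dist_norm power2_norm_eq_inner norm_minus_commute)
  have "f q \<ge> 0"
  proof (rule ccontr)
    assume "\<not> f q \<ge> 0"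
    then have neg: "z q < m * F ((q - y) \<bullet> (q - y))" by (simp add: f_def)
    have dq: "dist y q < r" using q(1) r' by (simp add: A_def)
    have "dist y q \<noteq> r'"
      using neg nn[OF dq] by (auto simp: F_def qd)
    moreover have "dist y q \<noteq> \<rho>"
    proof
      assume a: "dist y q = \<rho>"
      have "F ((q - y) \<bullet> (q - y)) \<le> 1"
      proof -
        have "0 \<le> \<alpha> * ((q - y) \<bullet> (q - y))" using \<alpha>(1) by simp
        then have "exp (- \<alpha> * ((q - y) \<bullet> (q - y))) \<le> 1" by simp
        then show ?thesis using exp_gt_zero[of "- \<alpha> * r'\<^sup>2"] unfolding F_def by linarith
      qed
      then have "m * F ((q - y) \<bullet> (q - y)) \<le> m" using m(1) by simp
      then show False using neg m(2)[of q] a by simp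
    qed
    ultimately have qi: "\<rho> < dist y q" "dist y q < r'" using q(1) by (auto simp: A_def)
    define U where "U = {x. \<rho> < dist y x} \<inter> ball y r'"
    have "0 \<le> lin_trace (\<lambda>h. H q h - m *\<^sub>R Hb q h)"
    proof (rule local_min_lin_trace[where S = U])
      show "has_hessian f (\<lambda>x. g x - m *\<^sub>R gb x) (\<lambda>x h. H x h - m *\<^sub>R Hb x h) U"
        by (rule has_hessian_subset[OF hf]) simp
      show "open U" unfolding U_def by (intro open_Int open_Collect_less continuous_intros open_ball)
      show "q \<in> U" using qi by (simp add: U_def)
      show "f q \<le> f x" if "x \<in> U" for x using q(2)[of x] that by (simp add: A_def U_def)
    qed
    then have "m * lin_trace (Hb q) \<le> lin_trace (H q)" by (simp add: lin_trace_diff lin_trace_cmult)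
    also have "\<dots> \<le> K * z q" by (rule sup[OF dq])
    also have "\<dots> \<le> K * (m * exp (- \<alpha> * ((q - y) \<bullet> (q - y))))"
    proof -
      have "m * F ((q - y) \<bullet> (q - y)) \<le> m * exp (- \<alpha> * ((q - y) \<bullet> (q - y)))"
        using m by (intro mult_left_mono) (auto simp: F_def)
      then show ?thesis using neg K by (intro mult_left_mono) auto
    qed
    finally have "m * exp (- \<alpha> * ((q - y) \<bullet> (q - y))) * (\<alpha> * (4 * \<alpha> * ((q - y) \<bullet> (q - y)) - 2 * n))
       \<le> m * exp (- \<alpha> * ((q - y) \<bullet> (q - y))) * K" unfolding tb by (simp add: mult_ac)
    then have le: "\<alpha> * (4 * \<alpha> * ((q - y) \<bullet> (q - y)) - 2 * n) \<le> K" using m(1) by simp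
    have "\<rho>\<^sup>2 \<le> (q - y) \<bullet> (q - y)" unfolding qd using qi \<rho> by (intro power_mono) auto
    then have "4 * \<alpha> * \<rho>\<^sup>2 \<le> 4 * \<alpha> * ((q - y) \<bullet> (q - y))" using \<alpha> by (intro mult_left_mono) auto
    then have "K + 1 \<le> 4 * \<alpha> * ((q - y) \<bullet> (q - y)) - 2 * n" using \<alpha>(2) by linarith
    then have "1 * (K + 1) \<le> \<alpha> * (4 * \<alpha> * ((q - y) \<bullet> (q - y)) - 2 * n)" using \<alpha>(1) K by (intro mult_mono) auto
    then show False using le by simp
  qed
  then have "f x \<ge> 0" using q(2)[OF xA] by simp
  moreover have "F ((x - y) \<bullet> (x - y)) > 0"
  proof -
    have "(dist y x)\<^sup>2 < r'\<^sup>2" using r' by (intro power_strict_mono) auto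
    then show ?thesis using \<alpha> by (simp add: F_def qd)
  qed
  ultimately show ?thesis using m(1) by (simp add: f_def) (smt (verit) mult_pos_pos)
qed (use pos in auto)

lemma refl_plane_on_plane: "x \<bullet> e = \<mu> \<Longrightarrow> refl_plane e \<mu> x = x"
  by (simp add: refl_plane_def)

lemma continuous_on_refl_plane: "continuous_on S (refl_plane e \<mu>)"
  unfolding refl_plane_def by (intro continuous_intros)

text \<open>Since the Laplacian of w is a Lipschitz function of the value of w and commutes with
  reflections, the difference satisfies a linear inequality |Laplacian z| \<le> K |z|. The maximum
  principles below use nothing else of the equation.\<close>

lemma reflection_difference_hessian:
  assumes w: "has_hessian w g H UNIV" and e: "norm e = 1"
    and lip: "\<And>x y. \<bar>lin_trace (H x) - lin_trace (H y)\<bar> \<le> K * \<bar>w x - w y\<bar>"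
  obtains gz Hz where "has_hessian (\<lambda>x. w x - w (refl_plane e \<mu> x)) gz Hz UNIV"
    "\<And>x. \<bar>lin_trace (Hz x)\<bar> \<le> K * \<bar>w x - w (refl_plane e \<mu> x)\<bar>"
proof (rule that)
  show "has_hessian (\<lambda>x. w x - w (refl_plane e \<mu> x)) (\<lambda>x. g x - refl_vec e (g (refl_plane e \<mu> x)))
    (\<lambda>x h. H x h - refl_vec e (H (refl_plane e \<mu> x) (refl_vec e h))) UNIV"
    by (rule has_hessian_diff[OF w has_hessian_refl[OF w]])
  show "\<bar>lin_trace (\<lambda>h. H x h - refl_vec e (H (refl_plane e \<mu> x) (refl_vec e h)))\<bar> \<le> K * \<bar>w x - w (refl_plane e \<mu> x)\<bar>" for x
    using lip[of x "refl_plane e \<mu> x"] lin_trace_refl[OF has_hessian_linear[OF w UNIV_I] e]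
    by (simp add: lin_trace_diff)
qed

text \<open>
  A half-space contains a ball around \<open>x - t e\<close> that reaches \<open>x\<close>, and for large \<open>t\<close> the
  difference is already known to be positive near its centre.
\<close>

lemma moving_plane_positive:
  assumes w: "has_hessian w g H UNIV" and e: "norm e = 1" and K: "K \<ge> 0"
    and lip: "\<And>x y. \<bar>lin_trace (H x) - lin_trace (H y)\<bar> \<le> K * \<bar>w x - w y\<bar>"
    and nn: "\<And>x. x \<bullet> e < \<mu> \<Longrightarrow> w (refl_plane e \<mu> x) \<le> w x"
    and far: "\<And>x. norm x > R \<Longrightarrow> x \<bullet> e < \<mu> \<Longrightarrow> w (refl_plane e \<mu> x) < w x"
    and x: "x \<bullet> e < \<mu>"
  shows "w (refl_plane e \<mu> x) < w x"
proof -
  obtain gz Hz where z: "has_hessian (\<lambda>x. w x - w (refl_plane e \<mu> x)) gz Hz UNIV"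
    "\<And>x. \<bar>lin_trace (Hz x)\<bar> \<le> K * \<bar>w x - w (refl_plane e \<mu> x)\<bar>"
    by (rule reflection_difference_hessian[OF w e lip]) (rule that; blast)
  have ee: "e \<bullet> e = 1" using e by (simp add: norm_eq_1)
  \<comment> \<open>The unit ball around y = x - t e then lies outside the ball of radius R, where
    strict inequality is known. The radius r exceeds t by half the distance of x to the plane, so
    the large ball contains x and stays in the half-space.\<close>
  define t where "t = max 1 (R + norm x + 2)"
  define y where "y = x - t *\<^sub>R e"
  define r where "r = t + (\<mu> - x \<bullet> e) / 2"
  have t: "t \<ge> 1" "t \<ge> R + norm x + 2" by (auto simp: t_def)
  have ye: "y \<bullet> e = x \<bullet> e - t" by (simp add: y_def inner_diff_left ee)
  have pe: "p \<bullet> e \<le> y \<bullet> e + dist y p" for p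
    using abs_inner_mult_le[of "p - y" e] e by (simp add: dist_norm inner_diff_left norm_minus_commute)
  have "0 < w x - w (refl_plane e \<mu> x)"
  proof (rule strong_max_principle_ball[OF z(1) K, where \<rho> = 1 and y = y and r = r])
    show "dist y x < r" using t e x by (simp add: y_def r_def dist_norm)
    show 1: "0 \<le> w p - w (refl_plane e \<mu> p)" if "dist y p < r" for p
    proof -
      define s where "s = (\<mu> - x \<bullet> e) / 2"
      have "x \<bullet> e + s < \<mu>" using x by (simp add: s_def field_simps)
      moreover have "dist y p < t + s" using that by (simp add: r_def s_def)
      ultimately have "p \<bullet> e < \<mu>" using pe[of p] ye by linarith
      then show ?thesis using nn by simp
    qed
    show "lin_trace (Hz p) \<le> K * (w p - w (refl_plane e \<mu> p))" if "dist y p < r" for p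
      using z(2)[of p] 1[OF that] by simp
    show "0 < w p - w (refl_plane e \<mu> p)" if "dist y p \<le> 1" for p
    proof -
      have "t = norm (x - y)" using e t by (simp add: y_def)
      also have "\<dots> \<le> norm x + norm p + dist y p"
        using norm_triangle_ineq4[of x p] norm_triangle_ineq[of "x - p" "p - y"] by (simp add: dist_norm norm_minus_commute)
      finally have "norm p > R" using t that by linarith
      moreover have "p \<bullet> e < \<mu>" using pe[of p] ye t that x by linarith
      ultimately show ?thesis using far by simp
    qed
  qed simp
  then show ?thesis by simp
qed

text \<open>
  Dividing by the positive function \<open>cos (k (x \<bullet> e - \<mu>))\<close> with \<open>k\<^sup>2 > K\<close> makes the maximum principle
  insensitive to the sign of the zeroth order coefficient in a strip of width at most \<open>1 / k\<close>.
\<close>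

lemma narrow_strip:
  assumes w: "has_hessian w g H UNIV" and e: "norm e = 1" and K: "K \<ge> 0"
    and lip: "\<And>x y. \<bar>lin_trace (H x) - lin_trace (H y)\<bar> \<le> K * \<bar>w x - w y\<bar>"
    and far: "\<And>x. norm x > R \<Longrightarrow> x \<bullet> e < \<mu> \<Longrightarrow> w (refl_plane e \<mu> x) < w x"
    and narrow: "a < \<mu>" "(K + 1) * (\<mu> - a) \<le> 1"
    and left: "\<And>x. norm x \<le> R + 1 \<Longrightarrow> x \<bullet> e \<le> a \<Longrightarrow> w (refl_plane e \<mu> x) < w x"
    and x: "x \<bullet> e < \<mu>"
  shows "w (refl_plane e \<mu> x) \<le> w x"
proof (rule ccontr)
  assume "\<not> ?thesis"
  then have neg: "w x - w (refl_plane e \<mu> x) < 0" by simp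
  obtain gz Hz where z: "has_hessian (\<lambda>x. w x - w (refl_plane e \<mu> x)) gz Hz UNIV"
    "\<And>x. \<bar>lin_trace (Hz x)\<bar> \<le> K * \<bar>w x - w (refl_plane e \<mu> x)\<bar>"
    by (rule reflection_difference_hessian[OF w e lip]) (rule that; blast)
  define Z where "Z x = w x - w (refl_plane e \<mu> x)" for x
  \<comment> \<open>K + 1 is a simple number whose square exceeds K. In the strip the argument of
    the cosine is at most 1 in absolute value, hence below \<pi> / 2.\<close>
  define k where "k = K + 1"
  define \<phi> where "\<phi> x = cos (k * (x \<bullet> e - \<mu>))" for x
  have ee: "e \<bullet> e = 1" using e by (simp add: norm_eq_1)
  \<comment> \<open>The extra 1 in the radius keeps a negative minimum, which must lie in the ball
    of radius R, off the boundary of the large ball.\<close>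
  define Q where "Q = {x. a \<le> x \<bullet> e} \<inter> {x. x \<bullet> e \<le> \<mu>} \<inter> cball 0 (R + 1)"
  have xR: "norm x \<le> R" using far[of x] neg x by (cases "norm x \<le> R") auto
  have xQ: "x \<in> Q" using left[of x] neg x xR by (cases "x \<bullet> e \<le> a") (auto simp: Q_def)
  have \<phi>: "\<phi> p > 0" if "a \<le> p \<bullet> e" "p \<bullet> e \<le> \<mu>" for p
  proof -
    have "k * (\<mu> - p \<bullet> e) \<le> k * (\<mu> - a)" using that K by (intro mult_left_mono) (auto simp: k_def)
    then have "k * (\<mu> - p \<bullet> e) \<le> 1" using narrow by (simp add: k_def)
    moreover have "0 \<le> k * (\<mu> - p \<bullet> e)" using that K by (simp add: k_def)
    ultimately have "cos (k * (\<mu> - p \<bullet> e)) > 0" using pi_gt3 by (intro cos_gt_zero_pi) auto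
    moreover have "k * (\<mu> - p \<bullet> e) = - (k * (p \<bullet> e - \<mu>))" by (simp add: algebra_simps)
    ultimately show ?thesis unfolding \<phi>_def by (simp only: cos_minus)
  qed
  have cQ: "compact Q" unfolding Q_def
    by (rule closed_Int_compact) (intro closed_Int closed_Collect_le continuous_intros compact_cball)+
  have "continuous_on Q (\<lambda>p. Z p / \<phi> p)"
  proof (rule continuous_on_divide)
    show "continuous_on Q Z"
      using has_hessian_continuous_on[OF z(1)] unfolding Z_def[abs_def] by (rule continuous_on_subset) simp
    show "continuous_on Q \<phi>" unfolding \<phi>_def[abs_def] by (intro continuous_intros)
    show "\<forall>p\<in>Q. \<phi> p \<noteq> 0" using \<phi> by (auto simp: Q_def less_imp_neq[symmetric])
  qed
  \<comment> \<open>At the minimum of Z / \<phi> the function Z + m \<phi> touches 0 from above. Its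
    Laplacian there is at most m \<phi> (K - k^2) < 0, which no local minimum allows.\<close>
  then obtain q where q: "q \<in> Q" "\<And>p. p \<in> Q \<Longrightarrow> Z q / \<phi> q \<le> Z p / \<phi> p"
    using continuous_attains_inf[OF cQ] xQ by blast
  define m where "m = - (Z q / \<phi> q)"
  have \<phi>q: "\<phi> q > 0" using q(1) \<phi> by (auto simp: Q_def)
  have "Z x / \<phi> x < 0" using neg \<phi>[of x] xQ by (auto simp: Z_def Q_def divide_neg_pos)
  then have m: "m > 0" using q(2)[OF xQ] by (simp add: m_def)
  have Zq: "Z q = - m * \<phi> q" using \<phi>q by (simp add: m_def)
  then have Zneg: "Z q < 0" using m \<phi>q by simp
  have qmu: "q \<bullet> e < \<mu>"
    using Zneg q(1) refl_plane_on_plane[of q e \<mu>] by (cases "q \<bullet> e = \<mu>") (auto simp: Z_def Q_def)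
  have qR: "norm q \<le> R" using far[of q] Zneg qmu by (cases "norm q \<le> R") (auto simp: Z_def)
  have qa: "a < q \<bullet> e" using left[of q] Zneg qR by (cases "q \<bullet> e \<le> a") (auto simp: Z_def)
  define U where "U = {x. a < x \<bullet> e} \<inter> {x. x \<bullet> e < \<mu>} \<inter> ball 0 (R + 1)"
  let ?Hp = "\<lambda>x h. (- k\<^sup>2 * cos (k * (x \<bullet> e - \<mu>)) * (h \<bullet> e)) *\<^sub>R e"
  have "0 \<le> lin_trace (\<lambda>h. Hz q h + m *\<^sub>R ?Hp q h)"
  proof (rule local_min_lin_trace[where S = U and x = q and f = "\<lambda>x. Z x + m * \<phi> x" and H = "\<lambda>x h. Hz x h + m *\<^sub>R ?Hp x h"])
    show "has_hessian (\<lambda>x. Z x + m * \<phi> x) (\<lambda>x. gz x + m *\<^sub>R ((- k * sin (k * (x \<bullet> e - \<mu>))) *\<^sub>R e))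
        (\<lambda>x h. Hz x h + m *\<^sub>R ?Hp x h) U"
      unfolding Z_def \<phi>_def
      by (rule has_hessian_add[OF has_hessian_subset[OF z(1)] has_hessian_cmult[OF has_hessian_cos_inner]]) simp
    show "open U" unfolding U_def by (intro open_Int open_Collect_less continuous_intros open_ball)
    show "q \<in> U" using qa qmu qR by (simp add: U_def)
    show "Z q + m * \<phi> q \<le> Z p + m * \<phi> p" if "p \<in> U" for p
    proof -
      have p: "p \<in> Q" "\<phi> p > 0" using that \<phi>[of p] by (auto simp: U_def Q_def)
      have "- m \<le> Z p / \<phi> p" using q(2)[OF p(1)] by (simp add: m_def)
      then have "- m * \<phi> p \<le> Z p" using p(2) by (simp add: le_divide_eq)
      then show ?thesis using Zq by simp
    qed
  qed
  also have "\<dots> = lin_trace (Hz q) - m * k\<^sup>2 * \<phi> q"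
    unfolding lin_trace_add lin_trace_cmult lin_trace_rank_one \<phi>_def ee by simp
  also have "lin_trace (Hz q) \<le> K * (m * \<phi> q)"
    using z(2)[of q] Zneg Zq by (simp add: Z_def)
  finally have "m * \<phi> q * k\<^sup>2 \<le> m * \<phi> q * K" by (simp add: mult_ac)
  then have "k\<^sup>2 \<le> K" using m \<phi>q by simp
  moreover have "K < k\<^sup>2" using K by (simp add: k_def power2_eq_square algebra_simps) (smt (verit) mult_nonneg_nonneg)
  ultimately show False by simp
qed

text \<open>A failure at some \<mu> > 0 makes the critical level L at least \<mu>, hence positive.
  The estimate far out then holds with one radius for all planes above L / 2, and only a compact set
  is left in which to push the plane below L. The radius depends on the level, which is why each
  positive level is treated by contradiction.\<close>

lemma moving_plane:
  fixes w :: "'a::euclidean_space \<Rightarrow> real"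
  assumes w: "has_hessian w g H UNIV" and pos: "\<And>x. w x > 0" and lim: "(w \<longlongrightarrow> 0) at_infinity"
    and e: "norm e = 1" and K: "K \<ge> 0"
    and lip: "\<And>x y. \<bar>lin_trace (H x) - lin_trace (H y)\<bar> \<le> K * \<bar>w x - w y\<bar>"
    and gap: "\<And>l. l > 0 \<Longrightarrow> \<exists>R. \<forall>\<mu> x. \<mu> \<ge> l \<longrightarrow> norm x > R \<longrightarrow> x \<bullet> e < \<mu> \<longrightarrow> w (refl_plane e \<mu> x) < w x"
    and \<mu>: "\<mu> > 0" and x: "x \<bullet> e < \<mu>"
  shows "w (refl_plane e \<mu> x) \<le> w x"
proof (rule ccontr)
  assume bad: "\<not> ?thesis"
  have cw: "continuous_on UNIV w" using w by (rule has_hessian_continuous_on)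
  have xe: "\<bar>x \<bullet> e\<bar> \<le> norm x" for x using abs_inner_mult_le[of x e] e by simp
  define P where "P \<mu> \<longleftrightarrow> (\<forall>x. x \<bullet> e < \<mu> \<longrightarrow> w (refl_plane e \<mu> x) \<le> w x)" for \<mu>
  define S where "S = {l. l > 0 \<and> (\<forall>\<mu>\<ge>l. P \<mu>)}"
  have "S \<noteq> {}"
  proof -
    obtain R where R: "\<And>\<mu> x. \<mu> \<ge> 1 \<Longrightarrow> norm x > R \<Longrightarrow> x \<bullet> e < \<mu> \<Longrightarrow> w (refl_plane e \<mu> x) < w x"
      using gap[of 1] by auto
    obtain p where p: "\<And>x. norm x \<le> \<bar>R\<bar> \<Longrightarrow> w p \<le> w x"
    proof -
      have "cball (0::'a) \<bar>R\<bar> \<noteq> {}" by simp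
      then show ?thesis
        using continuous_attains_inf[OF compact_cball _ continuous_on_subset[OF cw subset_UNIV], of 0 "\<bar>R\<bar>"] that
        by (metis mem_cball_0)
    qed
    obtain b where b: "\<And>x. norm x \<ge> b \<Longrightarrow> w x < w p"
      using order_tendstoD(2)[OF lim pos[of p]] by (auto simp: eventually_at_infinity)
    \<comment> \<open>For such planes the image of a point of the ball of radius |R| has norm at
      least b, where w is below its minimum over that ball.\<close>
    define l where "l = max 1 (\<bar>R\<bar> + \<bar>b\<bar>)"
    have "P \<mu>" if "\<mu> \<ge> l" for \<mu>
      unfolding P_def
    proof (intro allI impI)
      fix x assume x: "x \<bullet> e < \<mu>"
      show "w (refl_plane e \<mu> x) \<le> w x"
      proof (cases "norm x > R")
        case True
        then show ?thesis using R[of \<mu> x] that x by (simp add: l_def)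
      next
        case False
        have "refl_plane e \<mu> x \<bullet> e = 2 * \<mu> - x \<bullet> e"
          using e by (simp add: refl_plane_def inner_add_left norm_eq_1)
        moreover have "x \<bullet> e \<le> \<bar>R\<bar>" using xe[of x] False by linarith
        moreover have "\<bar>R\<bar> + \<bar>b\<bar> \<le> \<mu>" "1 \<le> \<mu>" using that by (auto simp: l_def)
        ultimately have "b \<le> refl_plane e \<mu> x \<bullet> e" using abs_ge_self[of b] by linarith
        then have "b \<le> norm (refl_plane e \<mu> x)" using xe[of "refl_plane e \<mu> x"] by linarith
        then show ?thesis using b p[of x] False by fastforce
      qed
    qed
    then have "l \<in> S" by (auto simp: S_def l_def)
    then show ?thesis by auto
  qed
  have bdd: "bdd_below S" by (rule bdd_belowI[of _ 0]) (simp add: S_def)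
  define L where "L = Inf S"
  have "\<mu> \<le> s" if "s \<in> S" for s
  proof (rule ccontr)
    assume "\<not> \<mu> \<le> s"
    then have "P \<mu>" using that by (simp add: S_def)
    then show False using bad x by (simp add: P_def)
  qed
  then have "\<mu> \<le> L" unfolding L_def using \<open>S \<noteq> {}\<close> by (intro cInf_greatest)
  then have L0: "L > 0" using \<mu> by simp
  have PL': "P \<nu>" if \<nu>: "L < \<nu>" for \<nu>
  proof -
    obtain s where "s \<in> S" "s < \<nu>" using \<nu> cInf_lessD[OF \<open>S \<noteq> {}\<close>] unfolding L_def by blast
    then show ?thesis by (simp add: S_def)
  qed
  have cont_mu: "continuous_on UNIV (\<lambda>\<nu>. w (refl_plane e \<nu> x))" for x
    unfolding refl_plane_def by (intro continuous_on_compose2[OF cw] continuous_intros) auto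
  have PL: "P L"
    unfolding P_def
  proof (intro allI impI)
    fix x assume x: "x \<bullet> e < L"
    have "(\<lambda>k. L + inverse (real (Suc k))) \<longlonglongrightarrow> L + 0"
      by (intro tendsto_add tendsto_const LIMSEQ_inverse_real_of_nat)
    then have "(\<lambda>k. w (refl_plane e (L + inverse (real (Suc k))) x)) \<longlonglongrightarrow> w (refl_plane e L x)"
      using continuous_on_tendsto_compose[OF cont_mu] by simp
    moreover have "w (refl_plane e (L + inverse (real (Suc k))) x) \<le> w x" for k
    proof -
      have "inverse (real (Suc k)) > 0" by simp
      then have "L + inverse (real (Suc k)) > L" "x \<bullet> e < L + inverse (real (Suc k))" using x by linarith+
      then show ?thesis using PL' unfolding P_def by blast
    qed
    ultimately show "w (refl_plane e L x) \<le> w x" by (intro LIMSEQ_le_const2[where a = "w x"]) auto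
  qed
  \<comment> \<open>The level L / 2 leaves room for planes slightly below L to share this
    radius.\<close>
  obtain R0 where R0: "\<And>\<nu> x. \<nu> \<ge> L / 2 \<Longrightarrow> norm x > R0 \<Longrightarrow> x \<bullet> e < \<nu> \<Longrightarrow> w (refl_plane e \<nu> x) < w x"
    using gap[of "L / 2"] L0 by auto
  define R where "R = \<bar>R0\<bar>"
  have R: "w (refl_plane e \<nu> x) < w x" if "\<nu> \<ge> L / 2" "norm x > R" "x \<bullet> e < \<nu>" for \<nu> x
    using R0[of \<nu> x] that by (simp add: R_def)
  have strict: "w (refl_plane e L x) < w x" if "x \<bullet> e < L" for x
    by (rule moving_plane_positive[where R = R, OF w e K lip _ _ that]) (use PL R L0 in \<open>auto simp: P_def\<close>)
  define \<epsilon> where "\<epsilon> = 1 / (K + 1)"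
  have \<epsilon>: "\<epsilon> > 0" using K by (simp add: \<epsilon>_def)
  define C where "C = {x. x \<bullet> e \<le> L - \<epsilon>} \<inter> cball 0 (R + 1)"
  have cC: "compact C" unfolding C_def
    by (rule closed_Int_compact) (intro closed_Collect_le continuous_intros compact_cball)+
  obtain m where m: "m > 0" "\<And>x. x \<in> C \<Longrightarrow> m \<le> w x - w (refl_plane e L x)"
  proof (cases "C = {}")
    case True
    then show ?thesis using that[of 1] by simp
  next
    case False
    have "continuous_on C (\<lambda>x. w x - w (refl_plane e L x))"
      by (intro continuous_on_diff continuous_on_compose2[OF cw continuous_on_refl_plane] continuous_on_subset[OF cw]) auto
    then obtain p where p: "p \<in> C" "\<And>x. x \<in> C \<Longrightarrow> w p - w (refl_plane e L p) \<le> w x - w (refl_plane e L x)"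
      using continuous_attains_inf[OF cC False] by blast
    show ?thesis
      using that[of "w p - w (refl_plane e L p)"] p strict[of p] \<epsilon> by (auto simp: C_def)
  qed
  \<comment> \<open>Contains the images of the ball of radius R + 1 in all planes at levels from 0
    to L: a reflection moves p by twice its distance to the plane, which is at most L + R +
    1.\<close>
  define B where "B = cball (0::'a) (R + 1 + 2 * (L + (R + 1)))"
  have "uniformly_continuous_on B w"
    unfolding B_def by (intro compact_uniformly_continuous continuous_on_subset[OF cw]) auto
  then obtain d where d: "d > 0" "\<And>p q. p \<in> B \<Longrightarrow> q \<in> B \<Longrightarrow> dist q p < d \<Longrightarrow> dist (w q) (w p) < m"
    unfolding uniformly_continuous_on_def using m(1) by blast
  \<comment> \<open>The three bounds in turn: lowering the plane by \<eta> moves images by less than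
    d, keeps its level above L / 2, and keeps it to the right of L - \<epsilon>.\<close>
  define \<eta> where "\<eta> = min (d / 3) (min (L / 2) (\<epsilon> / 2))"
  have \<eta>: "\<eta> > 0" "2 * \<eta> < d" "\<eta> \<le> L / 2" "\<eta> < \<epsilon>" using d L0 \<epsilon> by (auto simp: \<eta>_def)
  have "P \<nu>" if \<nu>: "L - \<eta> \<le> \<nu>" "\<nu> \<le> L" for \<nu>
    unfolding P_def
  proof (intro allI impI)
    fix x assume x: "x \<bullet> e < \<nu>"
    show "w (refl_plane e \<nu> x) \<le> w x"
    proof (rule narrow_strip[OF w e K lip, where R = R and a = "L - \<epsilon>"])
      show "w (refl_plane e \<nu> p) < w p" if "norm p > R" "p \<bullet> e < \<nu>" for p
        using R[of \<nu> p] that \<nu> \<eta> by simp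
      show "L - \<epsilon> < \<nu>" using \<nu> \<eta> by simp
      have "(K + 1) * (\<nu> - (L - \<epsilon>)) \<le> (K + 1) * \<epsilon>" using \<nu> K by (intro mult_left_mono) auto
      then show "(K + 1) * (\<nu> - (L - \<epsilon>)) \<le> 1" using K by (simp add: \<epsilon>_def)
      show "w (refl_plane e \<nu> p) < w p" if p: "norm p \<le> R + 1" "p \<bullet> e \<le> L - \<epsilon>" for p
      proof -
        have inB: "refl_plane e \<tau> p \<in> B" if "0 \<le> \<tau>" "\<tau> \<le> L" for \<tau>
        proof -
          have "norm (refl_plane e \<tau> p) \<le> norm p + 2 * \<bar>\<tau> - p \<bullet> e\<bar>"
            unfolding refl_plane_def using norm_triangle_ineq[of p "(2 * (\<tau> - p \<bullet> e)) *\<^sub>R e"] e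
            by (simp only: norm_scaleR abs_mult abs_numeral mult_1_right)
          moreover have "\<bar>\<tau> - p \<bullet> e\<bar> \<le> L + (R + 1)" using that xe[of p] p by linarith
          ultimately have "norm (refl_plane e \<tau> p) \<le> norm p + 2 * (L + (R + 1))"
            by (meson add_left_mono mult_left_mono order_trans zero_le_numeral)
          then show ?thesis using p(1) unfolding B_def mem_cball_0 by linarith
        qed
        have "refl_plane e \<nu> p - refl_plane e L p = (2 * (\<nu> - L)) *\<^sub>R e"
          by (simp add: refl_plane_def scaleR_diff_left algebra_simps)
        then have "dist (refl_plane e \<nu> p) (refl_plane e L p) = 2 * \<bar>\<nu> - L\<bar>"
          using e by (simp only: dist_norm norm_scaleR abs_mult abs_numeral mult_1_right)
        also have "\<bar>\<nu> - L\<bar> = L - \<nu>" using \<nu> by simp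
        also have "2 * L - 2 * \<nu> < d" using \<nu> \<eta> by linarith
        then have "2 * (L - \<nu>) < d" by simp
        finally have "dist (w (refl_plane e \<nu> p)) (w (refl_plane e L p)) < m"
          using \<nu> \<eta> L0 by (intro d(2) inB) auto
        moreover have "m \<le> w p - w (refl_plane e L p)" using p by (intro m(2)) (simp add: C_def)
        ultimately show ?thesis by (simp add: dist_real_def)
      qed
    qed (rule x)
  qed
  then have "P \<nu>" if "L - \<eta> \<le> \<nu>" for \<nu>
    using PL' that by (cases "\<nu> \<le> L") auto
  then have "L - \<eta> \<in> S" using \<eta> L0 by (simp add: S_def)
  then have "L \<le> L - \<eta>" unfolding L_def using bdd by (rule cInf_lower)
  then show False using \<eta> by simp
qed

section \<open>Radial symmetry\<close>

lemma decay_bound_global: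
  fixes f :: "'a::euclidean_space \<Rightarrow> real"
  assumes f: "continuous_on UNIV f" and s: "s \<ge> 0" and R: "R \<ge> 1" and c: "c \<ge> 0"
    and far: "\<And>y. norm y > R \<Longrightarrow> \<bar>f y\<bar> \<le> c * norm y powr (- (2 * s))"
  obtains B where "\<And>y. \<bar>f y\<bar> \<le> B * (1 + y \<bullet> y) powr (- s)"
proof -
  have "bounded (f ` cball 0 R)"
    by (intro compact_imp_bounded compact_continuous_image continuous_on_subset[OF f]) auto
  then obtain B0 where B0: "\<And>y. norm y \<le> R \<Longrightarrow> \<bar>f y\<bar> \<le> B0"
    unfolding bounded_iff by (metis imageI mem_cball_0 real_norm_def)
  have B0': "B0 \<ge> 0" using B0[of 0] R by simp
  define B where "B = B0 * (1 + R\<^sup>2) powr s + c * 2 powr s"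
  show ?thesis
  proof (rule that[of B])
    fix y :: 'a
    have pos: "1 + y \<bullet> y > 0" by (simp add: add_pos_nonneg)
    have pp: "(1 + y \<bullet> y) powr s * (1 + y \<bullet> y) powr (- s) = 1"
      using pos by (simp add: powr_minus)
    have "\<bar>f y\<bar> * (1 + y \<bullet> y) powr s \<le> B"
    proof (cases "norm y \<le> R")
      case True
      then have "y \<bullet> y \<le> R\<^sup>2" by (metis norm_ge_zero power2_norm_eq_inner power_mono)
      then have "(1 + y \<bullet> y) powr s \<le> (1 + R\<^sup>2) powr s" using s by (intro powr_mono2) auto
      then have "\<bar>f y\<bar> * (1 + y \<bullet> y) powr s \<le> B0 * (1 + R\<^sup>2) powr s"
        using B0[OF True] B0' by (intro mult_mono) auto
      then show ?thesis using c by (simp add: B_def add_increasing2)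
    next
      case False
      then have y: "norm y > R" "norm y > 1" using R by auto
      have "1\<^sup>2 \<le> (norm y)\<^sup>2" using y by (intro power_mono) auto
      then have "1 + y \<bullet> y \<le> 2 * (y \<bullet> y)" by (simp add: power2_norm_eq_inner)
      then have "(1 + y \<bullet> y) powr s \<le> (2 * (y \<bullet> y)) powr s" using s by (intro powr_mono2) auto
      also have "\<dots> = 2 powr s * norm y powr (2 * s)" by (simp add: powr_mult inner_powr_eq_norm_powr)
      finally have "\<bar>f y\<bar> * (1 + y \<bullet> y) powr s \<le> (c * norm y powr (- (2 * s))) * (2 powr s * norm y powr (2 * s))"
        using far[OF y(1)] c by (intro mult_mono) auto
      also have "\<dots> = c * 2 powr s * (norm y powr (- (2 * s)) * norm y powr (2 * s))" by simp
      also have "norm y powr (- (2 * s)) * norm y powr (2 * s) = 1" proof -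
        have "norm y > 0" using y by linarith
        then show ?thesis by (simp add: powr_add[symmetric])
      qed
      finally show ?thesis using B0' by (simp add: B_def add_increasing)
    qed
    then have "\<bar>f y\<bar> * (1 + y \<bullet> y) powr s * (1 + y \<bullet> y) powr (- s) \<le> B * (1 + y \<bullet> y) powr (- s)"
      by (intro mult_right_mono) auto
    then show "\<bar>f y\<bar> \<le> B * (1 + y \<bullet> y) powr (- s)" using pp by (simp add: mult.assoc)
  qed
qed

lemma tendsto_reg_kernel:
  assumes "(x::'a::euclidean_space) \<noteq> 0"
  shows "(\<lambda>m. reg_kernel q (1 / real (Suc m)) (x \<bullet> x)) \<longlonglongrightarrow> norm x powr (- (2 * q))"
proof -
  have "(\<lambda>m. (x \<bullet> x + (inverse (real (Suc m)))\<^sup>2) powr (- q)) \<longlonglongrightarrow> (x \<bullet> x + 0\<^sup>2) powr (- q)"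
    using assms by (intro tendsto_intros LIMSEQ_inverse_real_of_nat) auto
  then show ?thesis by (simp add: reg_kernel_def inverse_eq_divide inner_powr_eq_norm_powr)
qed

text \<open>The equation is recorded only by inequalities between w and its Laplacian. They survive
  translation, which allows the origin to be moved to the centre of mass. The bound (q + 2) / q
  equals (n + 2) / (n - 2).\<close>

locale decaying_solution =
  fixes w :: "'a::euclidean_space \<Rightarrow> real" and g :: "'a \<Rightarrow> 'a" and H :: "'a \<Rightarrow> 'a \<Rightarrow> 'a"
    and q p \<delta> G K R :: real
  assumes dim: "DIM('a) \<ge> 3" and q: "q = (real DIM('a) - 2) / 2"
    and hess: "has_hessian w g H UNIV"
    and cH: "\<And>i. i \<in> Basis \<Longrightarrow> continuous_on UNIV (\<lambda>x. H x i \<bullet> i)"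
    and pos: "\<And>x. w x > 0" and lim: "(w \<longlongrightarrow> 0) at_infinity"
    and K: "K \<ge> 0" and lip: "\<And>x y. \<bar>lin_trace (H x) - lin_trace (H y)\<bar> \<le> K * \<bar>w x - w y\<bar>"
    and sub: "\<And>x. norm x > R \<Longrightarrow> lin_trace (H x) > 0"
    and p: "p \<ge> (q + 2) / q" and \<delta>: "\<delta> > 0" and G: "G \<ge> 0"
    and growth: "\<And>x. w x < \<delta> \<Longrightarrow> \<bar>lin_trace (H x)\<bar> \<le> G * w x powr p"
begin

lemma q_ge: "q \<ge> 1 / 2"
  using dim q by auto

lemma decay:
  obtains A R1 where "A \<ge> 0" "R1 \<ge> 1" "R1 \<ge> R"
    "\<And>x. norm x > R1 \<Longrightarrow> w x \<le> A * norm x powr (- (2 * q))" "\<And>x. norm x > R1 \<Longrightarrow> w x < \<delta>"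
proof -
  obtain b where b: "\<And>x. norm x \<ge> b \<Longrightarrow> w x < \<delta>"
    using order_tendstoD(2)[OF lim \<delta>] by (auto simp: eventually_at_infinity)
  define R1 where "R1 = max 1 (max R b)"
  have R1: "R1 \<ge> 1" "R1 \<ge> R" "R1 \<ge> b" "R1 > 0" by (auto simp: R1_def)
  have q0: "q > 0" using q_ge by simp
  obtain A where A: "A \<ge> 0" "\<And>x. norm x \<ge> R1 \<Longrightarrow> w x \<le> A * norm x powr (- (2 * q))"
    by (rule subharmonic_decay[OF q q0 R1(4) hess lim]) (use sub R1 in \<open>auto intro: that\<close>)
  show ?thesis
    by (rule that[OF A(1) R1(1,2)]) (use A(2) b R1 in auto)
qed

text \<open>With w = O(|x|^(- 2 q)), the first bound makes w^p of order |x|^(- n - 2), and the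
  second makes the coefficient w^(p - 1) in w^p = w^(p - 1) w of order |x|^(- 4).\<close>

lemma exponent_bounds: "2 * q * p \<ge> 2 * q + 4" "2 * q * (p - 1) \<ge> 4" "p \<ge> 1"
proof -
  have q0: "q > 0" using q_ge by simp
  have "q * ((q + 2) / q) \<le> q * p" using p q0 by (intro mult_left_mono) auto
  then show 1: "2 * q * p \<ge> 2 * q + 4" using q0 by simp
  then show "2 * q * (p - 1) \<ge> 4" by (simp add: algebra_simps)
  then have "p - 1 > 0" using q0 by (metis less_le_trans mult_pos_pos zero_less_mult_pos zero_less_numeral)
  then show "p \<ge> 1" by simp
qed

lemma w_bound: obtains A where "\<And>y. \<bar>w y\<bar> \<le> A * (1 + y \<bullet> y) powr (- 1 / 2)"
proof -
  obtain A R1 where A: "A \<ge> 0" "R1 \<ge> 1" "\<And>x. norm x > R1 \<Longrightarrow> w x \<le> A * norm x powr (- (2 * q))"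
    by (rule decay) (rule that; blast)
  have f: "\<bar>w y\<bar> \<le> A * norm y powr (- (2 * (1 / 2)))" if "norm y > R1" for y
  proof -
    have "norm y powr (- (2 * q)) \<le> norm y powr (- (2 * (1 / 2)))"
      using that A(2) q_ge by (intro powr_mono) auto
    then have "A * norm y powr (- (2 * q)) \<le> A * norm y powr (- (2 * (1 / 2)))" by (rule mult_left_mono) (rule A(1))
    then show ?thesis using A(3)[OF that] pos[of y] by linarith
  qed
  obtain B where "\<And>y. \<bar>w y\<bar> \<le> B * (1 + y \<bullet> y) powr (- (1 / 2))"
    by (rule decay_bound_global[OF has_hessian_continuous_on[OF hess] _ A(2,1) f]) (simp, assumption, rule that, blast)
  moreover have "- (1 / 2) = (- 1 / 2 :: real)" by simp
  ultimately show ?thesis using that[of B] by (simp only:)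
qed

lemma lin_trace_continuous: "continuous_on UNIV (\<lambda>x. lin_trace (H x))"
  unfolding lin_trace_def by (auto intro!: continuous_on_sum cH)

lemma density_bound: obtains B where "\<And>y. \<bar>- lin_trace (H y)\<bar> \<le> B * (1 + y \<bullet> y) powr (- (q + 2))"
proof -
  obtain A R1 where A: "A \<ge> 0" "R1 \<ge> 1" "\<And>x. norm x > R1 \<Longrightarrow> w x \<le> A * norm x powr (- (2 * q))"
     "\<And>x. norm x > R1 \<Longrightarrow> w x < \<delta>"
    by (rule decay) (rule that; blast)
  have f: "\<bar>- lin_trace (H y)\<bar> \<le> G * A powr p * norm y powr (- (2 * (q + 2)))" if y: "norm y > R1" for y
  proof -
    have "\<bar>lin_trace (H y)\<bar> \<le> G * w y powr p" by (rule growth[OF A(4)[OF y]])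
    also have "\<dots> \<le> G * (A * norm y powr (- (2 * q))) powr p"
      using A(3)[OF y] G pos[of y] exponent_bounds(3) by (intro mult_left_mono powr_mono2) auto
    also have "\<dots> = G * A powr p * norm y powr (- (2 * q) * p)"
      using A(1) by (simp add: powr_mult powr_powr)
    also have "\<dots> \<le> G * A powr p * norm y powr (- (2 * (q + 2)))"
      using G A(2) y exponent_bounds(1) by (intro mult_left_mono powr_mono) auto
    finally show ?thesis by simp
  qed
  have s0: "q + 2 \<ge> 0" and c0: "G * A powr p \<ge> 0" using q_ge G by auto
  obtain B where "\<And>y. \<bar>- lin_trace (H y)\<bar> \<le> B * (1 + y \<bullet> y) powr (- (q + 2))"
    by (rule decay_bound_global[OF continuous_on_minus[OF lin_trace_continuous] s0 A(2) c0 f])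
      (assumption, rule that, blast)
  then show ?thesis by (rule that)
qed

text \<open>Reads the growth bound as a linear inequality with a coefficient of order |x|^(- 4),
  integrable enough at infinity for w to decay no faster than the harmonic power. The summand 1 in
  \<open>L\<close> makes the constant strictly positive even if G = 0.\<close>

lemma w_lower: obtains m R' where "m > 0" "\<And>x. norm x \<ge> R' \<Longrightarrow> w x \<ge> m * norm x powr (- (2 * q))"
proof -
  obtain A R1 where A: "A \<ge> 0" "R1 \<ge> 1" "\<And>x. norm x > R1 \<Longrightarrow> w x \<le> A * norm x powr (- (2 * q))"
     "\<And>x. norm x > R1 \<Longrightarrow> w x < \<delta>"
    by (rule decay) (rule that; blast)
  define L where "L = G * A powr (p - 1) + 1"
  have L: "L > 0" using G by (simp add: L_def add_nonneg_pos)
  have f: "lin_trace (H y) \<le> L * (y \<bullet> y) powr (- 2) * w y" if y: "norm y > R1" for y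
  proof -
    have "lin_trace (H y) \<le> G * w y powr p" using growth[OF A(4)[OF y]] by simp
    also have "w y powr p = w y powr (p - 1) * w y" using pos[of y] powr_add[of "w y" "p - 1" 1] by simp
    also have "G * (w y powr (p - 1) * w y) \<le> G * (A powr (p - 1) * norm y powr (- 4) * w y)"
    proof -
      have "w y powr (p - 1) \<le> (A * norm y powr (- (2 * q))) powr (p - 1)"
        using A(3)[OF y] pos[of y] exponent_bounds(3) by (intro powr_mono2) auto
      also have "\<dots> = A powr (p - 1) * norm y powr (- (2 * q) * (p - 1))"
        using A(1) by (simp add: powr_mult powr_powr)
      also have "\<dots> \<le> A powr (p - 1) * norm y powr (- 4)"
        using A(2) y exponent_bounds(2) by (intro mult_left_mono powr_mono) auto
      finally show ?thesis using G pos[of y] by (intro mult_left_mono mult_right_mono) auto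
    qed
    also have "\<dots> = (G * A powr (p - 1)) * (norm y powr (- 4) * w y)" by simp
    also have "\<dots> \<le> L * (norm y powr (- 4) * w y)"
      using pos[of y] by (intro mult_right_mono) (auto simp: L_def)
    also have "norm y powr (- 4) = (y \<bullet> y) powr (- 2)" by (simp add: inner_powr_eq_norm_powr)
    finally show ?thesis by (simp add: mult.assoc)
  qed
  have q0: "q > 0" and R1: "R1 > 0" using q_ge A(2) by auto
  show ?thesis by (rule positive_lower_decay[OF q q0 R1 hess lim pos L f]) (assumption, rule that, assumption, blast)
qed

text \<open>The potential estimate is uniform in \<epsilon>, so it passes to the limit along
  \<epsilon> = 1 / (m + 1), where the regularised potentials tend to a multiple of w.\<close>

lemma w_difference_bound:
  obtains C where "C \<ge> 0"
    "\<And>x x'. 1 \<le> norm x \<Longrightarrow> (\<And>s. 0 \<le> s \<Longrightarrow> s \<le> 1 \<Longrightarrow> norm (x + s *\<^sub>R (x' - x)) \<ge> norm x / 2) \<Longrightarrow>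
      \<bar>newton_mass TYPE('a) * w x - newton_mass TYPE('a) * w x'
        - (\<integral>y. - lin_trace (H y) \<partial>lborel) * (norm x powr (- (2 * q)) - norm x' powr (- (2 * q)))\<bar>
      \<le> C * norm (x' - x) * (norm (\<integral>y. - lin_trace (H y) *\<^sub>R y \<partial>lborel) * norm x powr (- (2 * q) - 2)
           + norm x powr (- (2 * q) - 5 / 2))"
proof -
  obtain B where B: "\<And>y. \<bar>- lin_trace (H y)\<bar> \<le> B * (1 + y \<bullet> y) powr (- (q + 2))"
    by (rule density_bound) (rule that; blast)
  obtain A where A: "\<And>y. \<bar>w y\<bar> \<le> A * (1 + y \<bullet> y) powr (- 1 / 2)"
    by (rule w_bound) (rule that; blast)
  have cs: "continuous_on UNIV (\<lambda>y. - lin_trace (H y))" by (intro continuous_on_minus lin_trace_continuous)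
  have int: "integrable lborel (\<lambda>y. lin_trace (H y))"
    using integrable_density[OF dim q cs B] by simp
  define I where "I \<epsilon> x = (\<integral>y. reg_kernel q \<epsilon> ((y - x) \<bullet> (y - x)) * - lin_trace (H y) \<partial>lborel)" for \<epsilon> and x :: 'a
  define M where "M = newton_mass TYPE('a)"
  define m0 where "m0 = (\<integral>y. - lin_trace (H y) \<partial>lborel)"
  have lims: "(\<lambda>m. I (1 / real (Suc m)) x) \<longlonglongrightarrow> M * w x" for x
    using newton_representation[OF dim hess cH A int, of x] unfolding I_def M_def q[symmetric] .
  obtain C where C: "C \<ge> 0" "\<And>\<epsilon> x x'. \<lbrakk>0 < \<epsilon>; 1 \<le> norm x;
      \<And>s. 0 \<le> s \<Longrightarrow> s \<le> 1 \<Longrightarrow> norm (x + s *\<^sub>R (x' - x)) \<ge> norm x / 2\<rbrakk> \<Longrightarrow>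
      \<bar>I \<epsilon> x - I \<epsilon> x' - m0 * (reg_kernel q \<epsilon> (x \<bullet> x) - reg_kernel q \<epsilon> (x' \<bullet> x'))\<bar>
      \<le> C * norm (x' - x) * (norm (\<integral>y. - lin_trace (H y) *\<^sub>R y \<partial>lborel) * norm x powr (- (2 * q) - 2) + norm x powr (- (2 * q) - 5 / 2))"
  proof (rule potential_difference_bound[OF dim q cs B], goal_cases)
    case (1 C)
    show ?case by (rule 1(1)[unfolded I_def m0_def, OF 1(2)]) (rule 1(3); blast)
  qed
  show ?thesis
  proof (rule that[OF C(1)], fold M_def m0_def)
    fix x x' :: 'a
    assume x: "1 \<le> norm x" and seg: "\<And>s. 0 \<le> s \<Longrightarrow> s \<le> 1 \<Longrightarrow> norm (x + s *\<^sub>R (x' - x)) \<ge> norm x / 2"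
    have nz: "x \<noteq> 0" "x' \<noteq> 0" using x seg[of 1] by auto
    have "(\<lambda>m. \<bar>I (1 / real (Suc m)) x - I (1 / real (Suc m)) x'
        - m0 * (reg_kernel q (1 / real (Suc m)) (x \<bullet> x) - reg_kernel q (1 / real (Suc m)) (x' \<bullet> x'))\<bar>)
      \<longlonglongrightarrow> \<bar>M * w x - M * w x' - m0 * (norm x powr (- (2 * q)) - norm x' powr (- (2 * q)))\<bar>"
      by (intro tendsto_intros lims tendsto_reg_kernel nz)
    then show "\<bar>M * w x - M * w x' - m0 * (norm x powr (- (2 * q)) - norm x' powr (- (2 * q)))\<bar>
      \<le> C * norm (x' - x) * (norm (\<integral>y. - lin_trace (H y) *\<^sub>R y \<partial>lborel) * norm x powr (- (2 * q) - 2) + norm x powr (- (2 * q) - 5 / 2))"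
      by (rule LIMSEQ_le_const2) (use C(2)[OF _ x seg] in auto)
  qed
qed

lemma tendsto_expansion_remainder:
  "((\<lambda>x. newton_mass TYPE('a) * w x - m * norm x powr (- (2 * q))) \<longlongrightarrow> 0) at_infinity"
proof -
  have "((\<lambda>x. newton_mass TYPE('a) * w x - m * (x \<bullet> x) powr (- q)) \<longlongrightarrow> newton_mass TYPE('a) * 0 - m * 0) at_infinity"
    using q_ge by (intro tendsto_intros lim tendsto_inner_powr_at_infinity) auto
  then show ?thesis by (simp add: inner_powr_eq_norm_powr)
qed

lemma segment_double: "norm (x + s *\<^sub>R (2 *\<^sub>R x - x)) \<ge> norm x / 2" if "0 \<le> s" for x :: 'a
proof -
  have "x + s *\<^sub>R (2 *\<^sub>R x - x) = (1 + s) *\<^sub>R x" by (simp add: scaleR_2 scaleR_left_distrib)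
  then have "norm (x + s *\<^sub>R (2 *\<^sub>R x - x)) = (1 + s) * norm x" using that by simp
  also have "\<dots> \<ge> 1 / 2 * norm x" using that by (intro mult_right_mono) auto
  finally show ?thesis by simp
qed

text \<open>The Laplacian of w has no known sign in the inner ball, so the sign of this integral
  comes from the asymptotics: with a nonpositive monopole w would be O(|x|^(- 2 q - 1)), against its
  lower bound of order |x|^(- 2 q). The dipole is still present, because the centre of mass is
  defined only once the mass is known to be nonzero.\<close>

lemma mass_pos: "(\<integral>y. - lin_trace (H y) \<partial>lborel) > 0"
proof (rule ccontr)
  define m0 where "m0 = (\<integral>y. - lin_trace (H y) \<partial>lborel)"
  define M where "M = newton_mass TYPE('a)"
  assume "\<not> (\<integral>y. - lin_trace (H y) \<partial>lborel) > 0"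
  then have m0: "m0 \<le> 0" by (simp add: m0_def)
  have M: "M > 0" unfolding M_def by (rule newton_mass_pos[OF dim])
  define D where "D = norm (\<integral>y. - lin_trace (H y) *\<^sub>R y \<partial>lborel)"
  obtain C where C: "C \<ge> 0" "\<And>x x'. 1 \<le> norm x \<Longrightarrow> (\<And>s. 0 \<le> s \<Longrightarrow> s \<le> 1 \<Longrightarrow> norm (x + s *\<^sub>R (x' - x)) \<ge> norm x / 2) \<Longrightarrow>
      \<bar>M * w x - M * w x' - m0 * (norm x powr (- (2 * q)) - norm x' powr (- (2 * q)))\<bar>
      \<le> C * norm (x' - x) * (D * norm x powr (- (2 * q) - 2) + norm x powr (- (2 * q) - 5 / 2))"
  proof (rule w_difference_bound, goal_cases)
    case (1 C)
    show ?case by (rule 1(1)[unfolded M_def m0_def D_def, OF 1(2)]) (rule 1(3); blast)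
  qed
  define h where "h x = M * w x - m0 * norm x powr (- (2 * q))" for x
  have h: "\<bar>h x\<bar> \<le> 2 * (C * (D + 1)) * norm x powr (- (2 * q + 1))" if "1 \<le> norm x" for x
  proof (rule dyadic_decay)
    show "(h \<longlongrightarrow> 0) at_infinity" unfolding h_def[abs_def] M_def by (rule tendsto_expansion_remainder)
    show "0 \<le> C * (D + 1)" using C by (simp add: D_def)
    show "\<bar>h x - h (2 *\<^sub>R x)\<bar> \<le> C * (D + 1) * norm x powr (- (2 * q + 1))" if x: "1 \<le> norm x" for x
    proof -
      have "\<bar>h x - h (2 *\<^sub>R x)\<bar> \<le> C * norm (2 *\<^sub>R x - x) * (D * norm x powr (- (2 * q) - 2) + norm x powr (- (2 * q) - 5 / 2))"
        using C(2)[OF x segment_double] by (simp add: h_def algebra_simps)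
      also have "norm (2 *\<^sub>R x - x) = norm x" by (simp add: scaleR_2)
      also have "norm x powr (- (2 * q) - 5 / 2) \<le> norm x powr (- (2 * q) - 2)" using x by (intro powr_mono) auto
      then have "C * norm x * (D * norm x powr (- (2 * q) - 2) + norm x powr (- (2 * q) - 5 / 2))
        \<le> C * norm x * (D * norm x powr (- (2 * q) - 2) + norm x powr (- (2 * q) - 2))"
        using C by (intro mult_left_mono) auto
      also have "\<dots> = C * (D + 1) * (norm x powr 1 * norm x powr (- (2 * q) - 2))" by (simp add: algebra_simps)
      also have "norm x powr 1 * norm x powr (- (2 * q) - 2) = norm x powr (1 + (- (2 * q) - 2))" by (rule powr_add[symmetric])
      also have "1 + (- (2 * q) - 2) = - (2 * q + 1)" by simp
      finally show ?thesis .
    qed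
  qed (use q_ge that in auto)
  obtain m R' where m: "m > 0" "\<And>x. norm x \<ge> R' \<Longrightarrow> w x \<ge> m * norm x powr (- (2 * q))"
    by (rule w_lower) (rule that; blast)
  define E where "E = 2 * (C * (D + 1))"
  \<comment> \<open>Beyond E / (M m) the lower bound of M w exceeds the upper bound E r^(- 2 q - 1);
    the summand 1 makes this strict.\<close>
  define r where "r = max (max 1 R') (E / (M * m) + 1)"
  have r: "r \<ge> 1" "r \<ge> R'" "r \<ge> E / (M * m) + 1" by (auto simp: r_def)
  obtain x :: 'a where x: "norm x = r" using vector_choose_size[of r] r by auto
  have "m0 * r powr (- (2 * q)) \<le> 0" using m0 by (simp add: mult_nonpos_nonneg)
  then have "M * w x \<le> \<bar>h x\<bar>" by (simp add: h_def x)
  also have "\<dots> \<le> E * r powr (- (2 * q + 1))" using h[of x] r by (simp add: x E_def)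
  also have "r powr (- (2 * q + 1)) = r powr (- (2 * q)) / r"
    using r powr_add[of r "- (2 * q)" "- 1"] by (simp add: powr_minus divide_inverse)
  finally have "M * w x \<le> E / r * r powr (- (2 * q))" by simp
  moreover have "M * m * r powr (- (2 * q)) \<le> M * w x"
    using m(2)[of x] r M by (simp add: x mult.assoc)
  ultimately have "M * m * r powr (- (2 * q)) \<le> E / r * r powr (- (2 * q))" by simp
  moreover have "r powr (- (2 * q)) > 0" using r by simp
  ultimately have "M * m \<le> E / r" by (meson mult_le_cancel_right_pos)
  then have "r \<le> E / (M * m)" using M m r by (simp add: field_simps)
  then show False using r by simp
qed

text \<open>With the dipole gone, one difference estimate serves twice: for x and 2 x, summed
  dyadically, it gives the pointwise remainder, and for x and its mirror image it gives the
  Lipschitz remainder. The factor 2 of the dyadic sum is the reason for the common constant 2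
  C.\<close>

lemma reflection_gap:
  assumes centred: "(\<integral>y. - lin_trace (H y) *\<^sub>R y \<partial>lborel) = 0" and l: "l > 0"
  shows "\<exists>R. \<forall>\<mu> e x. \<mu> \<ge> l \<longrightarrow> norm e = 1 \<longrightarrow> norm x > R \<longrightarrow> x \<bullet> e < \<mu> \<longrightarrow> w (refl_plane e \<mu> x) < w x"
proof -
  define m0 where "m0 = (\<integral>y. - lin_trace (H y) \<partial>lborel)"
  define M where "M = newton_mass TYPE('a)"
  have M: "M > 0" unfolding M_def by (rule newton_mass_pos[OF dim])
  have m0: "m0 > 0" unfolding m0_def by (rule mass_pos)
  have q0: "q > 0" using q_ge by simp
  obtain C where C: "C \<ge> 0" "\<And>x x'. 1 \<le> norm x \<Longrightarrow> (\<And>s. 0 \<le> s \<Longrightarrow> s \<le> 1 \<Longrightarrow> norm (x + s *\<^sub>R (x' - x)) \<ge> norm x / 2) \<Longrightarrow>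
      \<bar>M * w x - M * w x' - m0 * (norm x powr (- (2 * q)) - norm x' powr (- (2 * q)))\<bar>
      \<le> C * norm (x' - x) * (norm (0::'a) * norm x powr (- (2 * q) - 2) + norm x powr (- (2 * q) - 5 / 2))"
  proof (rule w_difference_bound, goal_cases)
    case (1 C)
    show ?case by (rule 1(1)[unfolded M_def m0_def, OF 1(2)]) (rule 1(3)[unfolded centred]; blast)
  qed
  define h where "h x = M * w x - m0 * norm x powr (- (2 * q))" for x
  have h: "\<bar>h x\<bar> \<le> 2 * C * norm x powr (- (2 * q + 3 / 2))" if "1 \<le> norm x" for x
  proof (rule dyadic_decay)
    show "(h \<longlongrightarrow> 0) at_infinity" unfolding h_def[abs_def] M_def by (rule tendsto_expansion_remainder)
    show "\<bar>h x - h (2 *\<^sub>R x)\<bar> \<le> C * norm x powr (- (2 * q + 3 / 2))" if x: "1 \<le> norm x" for x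
    proof -
      have "\<bar>h x - h (2 *\<^sub>R x)\<bar> \<le> C * norm (2 *\<^sub>R x - x) * norm x powr (- (2 * q) - 5 / 2)"
        using C(2)[OF x segment_double] by (simp add: h_def algebra_simps)
      also have "norm (2 *\<^sub>R x - x) = norm x powr 1" by (simp add: scaleR_2)
      also have "C * norm x powr 1 * norm x powr (- (2 * q) - 5 / 2) = C * (norm x powr 1 * norm x powr (- (2 * q) - 5 / 2))" by simp
      also have "norm x powr 1 * norm x powr (- (2 * q) - 5 / 2) = norm x powr (1 + (- (2 * q) - 5 / 2))" by (rule powr_add[symmetric])
      also have "1 + (- (2 * q) - 5 / 2) = - (2 * q + 3 / 2)" by simp
      finally show ?thesis .
    qed
  qed (use q_ge that C in auto)
  show ?thesis
  proof (rule reflection_gap_at_infinity[of M m0 "2 * C" q w l])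
    show "\<bar>M * w x - m0 * norm x powr (- (2 * q))\<bar> \<le> 2 * C * norm x powr (- (2 * q) - 3 / 2)" if "1 \<le> norm x" for x
    proof -
      have "- (2 * q + 3 / 2) = - (2 * q) - 3 / 2" by simp
      then show ?thesis using h[OF that] unfolding h_def by (simp only:)
    qed
    show "\<bar>M * w x - M * w x' - m0 * (norm x powr (- (2 * q)) - norm x' powr (- (2 * q)))\<bar>
        \<le> 2 * C * norm (x' - x) * norm x powr (- (2 * q) - 5 / 2)"
      if x: "1 \<le> norm x" and seg: "\<And>s. 0 \<le> s \<Longrightarrow> s \<le> 1 \<Longrightarrow> norm (x + s *\<^sub>R (x' - x)) \<ge> norm x / 2" for x x'
    proof -
      have "0 \<le> C * norm (x' - x) * norm x powr (- (2 * q) - 5 / 2)" using C(1) by simp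
      then show ?thesis using C(2)[OF x seg] by simp
    qed
    show ?thesis
      if "\<And>\<mu> e x. \<mu> \<ge> l \<Longrightarrow> norm e = 1 \<Longrightarrow> norm x > R0 \<Longrightarrow> x \<bullet> e < \<mu> \<Longrightarrow> w (refl_plane e \<mu> x) < w x" for R0
      using that by blast
  qed (use M m0 C q0 l in auto)
qed

text \<open>Letting the level decrease to 0 gives an inequality on one half-space. The normals e and
  - e define the same reflection, so it holds everywhere, and applying it at x and at its image
  gives equality.\<close>

lemma reflection_invariant:
  assumes centred: "(\<integral>y. - lin_trace (H y) *\<^sub>R y \<partial>lborel) = 0" and e: "norm e = 1"
  shows "w (refl_plane e 0 x) = w x"
proof -
  have cw: "continuous_on UNIV w" using hess by (rule has_hessian_continuous_on)
  have half: "w (refl_plane e 0 x) \<le> w x" if e: "norm e = 1" and x: "x \<bullet> e \<le> 0" for e x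
  proof -
    have gap: "\<exists>R. \<forall>\<mu> x. \<mu> \<ge> l \<longrightarrow> norm x > R \<longrightarrow> x \<bullet> e < \<mu> \<longrightarrow> w (refl_plane e \<mu> x) < w x" if "l > 0" for l
      using reflection_gap[OF centred that] e by blast
    have "continuous_on UNIV (\<lambda>\<nu>. w (refl_plane e \<nu> x))"
      unfolding refl_plane_def by (intro continuous_on_compose2[OF cw] continuous_intros) auto
    then have "(\<lambda>k. w (refl_plane e (inverse (real (Suc k))) x)) \<longlonglongrightarrow> w (refl_plane e 0 x)"
      by (rule continuous_on_tendsto_compose[OF _ LIMSEQ_inverse_real_of_nat]) auto
    moreover have "w (refl_plane e (inverse (real (Suc k))) x) \<le> w x" for k
    proof -
      have "inverse (real (Suc k)) > 0" by simp
      then show ?thesis using x by (intro moving_plane[OF hess pos lim e K lip gap]) linarith+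
    qed
    ultimately show ?thesis by (intro LIMSEQ_le_const2[where a = "w x"]) auto
  qed
  have le: "w (refl_plane e 0 x) \<le> w x" for x
  proof (cases "x \<bullet> e \<le> 0")
    case False
    have "refl_plane (- e) 0 x = refl_plane e 0 x" by (simp add: refl_plane_def)
    then show ?thesis using half[of "- e" x] e False by simp
  qed (use half e in auto)
  have "refl_plane e 0 (refl_plane e 0 x) = x"
    using e by (simp add: refl_plane_def inner_diff_left norm_eq_1 scaleR_diff_left algebra_simps)
  then show ?thesis using le[of x] le[of "refl_plane e 0 x"] by simp
qed

text \<open>Two distinct points of equal norm are exchanged by the reflection in the hyperplane
  through 0 orthogonal to x - y.\<close>

lemma radial_centred:
  assumes centred: "(\<integral>y. - lin_trace (H y) *\<^sub>R y \<partial>lborel) = 0" and xy: "norm x = norm y"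
  shows "w x = w y"
proof (cases "x = y")
  case False
  define e where "e = (1 / norm (x - y)) *\<^sub>R (x - y)"
  have d: "norm (x - y) > 0" using False by simp
  have e: "norm e = 1" using d by (simp add: e_def)
  have xxyy: "x \<bullet> x = y \<bullet> y" using xy by (simp add: norm_eq_sqrt_inner)
  have "2 * (x \<bullet> (x - y)) = (norm (x - y))\<^sup>2"
    by (simp add: power2_norm_eq_inner inner_diff_left inner_diff_right inner_commute xxyy)
  then have "2 * (x \<bullet> e) = norm (x - y)" using d by (simp add: e_def power2_eq_square)
  then have "refl_plane e 0 x = x - norm (x - y) *\<^sub>R e" by (simp add: refl_plane_def)
  also have "\<dots> = y" using d by (simp add: e_def)
  finally show ?thesis using reflection_invariant[OF centred e, of x] by simp
qed simp

text \<open>Only the radius R refers to the origin, and |c + x| \<ge> |x| - |c| accounts for its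
  change.\<close>

lemma decaying_solution_shift:
  "decaying_solution (\<lambda>x. w (c + x)) (\<lambda>x. g (c + x)) (\<lambda>x. H (c + x)) q p \<delta> G K (R + norm c)"
proof
  show "continuous_on UNIV (\<lambda>x. H (c + x) i \<bullet> i)" if "i \<in> Basis" for i
    by (rule continuous_on_compose2[OF cH[OF that]]) (auto intro!: continuous_intros)
  have "filterlim (\<lambda>x::'a. c + x) at_infinity at_infinity"
    by (rule tendsto_add_filterlim_at_infinity[OF tendsto_const filterlim_ident])
  then show "((\<lambda>x. w (c + x)) \<longlongrightarrow> 0) at_infinity" by (rule filterlim_compose[OF lim])
  show "0 < lin_trace (H (c + x))" if "R + norm c < norm x" for x
    using that norm_triangle_ineq4[of "c + x" c] by (intro sub) simp
qed (use dim q hess pos K lip p \<delta> G growth in \<open>auto intro: has_hessian_shift\<close>)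

theorem radially_symmetric_solution: "radially_symmetric w"
proof -
  obtain B where B: "\<And>y. \<bar>- lin_trace (H y)\<bar> \<le> B * (1 + y \<bullet> y) powr (- (q + 2))"
    by (rule density_bound) (rule that; blast)
  have cs: "continuous_on UNIV (\<lambda>y. - lin_trace (H y))" by (intro continuous_on_minus lin_trace_continuous)
  define m0 where "m0 = (\<integral>y. - lin_trace (H y) \<partial>lborel)"
  have m0: "m0 > 0" unfolding m0_def by (rule mass_pos)
  define D where "D = (\<integral>y. - lin_trace (H y) *\<^sub>R y \<partial>lborel)"
  define c where "c = (1 / m0) *\<^sub>R D"
  interpret T: decaying_solution "\<lambda>x. w (c + x)" "\<lambda>x. g (c + x)" "\<lambda>x. H (c + x)" q p \<delta> G K "R + norm c"
    by (rule decaying_solution_shift)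
  have i0: "integrable lborel (\<lambda>y. - lin_trace (H y))" by (rule integrable_density[OF dim q cs B])
  have i1: "integrable lborel (\<lambda>y. - lin_trace (H y) *\<^sub>R y)" by (rule integrable_density_moment[OF dim q cs B])
  have ms: "(\<lambda>y. - lin_trace (H y)) \<in> borel_measurable borel" by (rule borel_measurable_continuous_onI[OF cs])
  have "(\<integral>y. - lin_trace (H (c + y)) *\<^sub>R y \<partial>lborel) = (\<integral>y. - lin_trace (H y) *\<^sub>R (y - c) \<partial>lborel)"
  proof -
    have m: "(\<lambda>y. - lin_trace (H y) *\<^sub>R (y - c)) \<in> borel_measurable borel"
      using ms by measurable
    have "(\<integral>y. - lin_trace (H y) *\<^sub>R (y - c) \<partial>lborel) = (\<integral>y. - lin_trace (H y) *\<^sub>R (y - c) \<partial>distr lborel borel ((+) c))"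
      by (simp add: lborel_distr_plus)
    also have "\<dots> = (\<integral>y. - lin_trace (H (c + y)) *\<^sub>R ((c + y) - c) \<partial>lborel)"
      by (rule integral_distr) (use m in auto)
    finally show ?thesis by simp
  qed
  also have "\<dots> = (\<integral>y. - lin_trace (H y) *\<^sub>R y - - lin_trace (H y) *\<^sub>R c \<partial>lborel)"
    by (simp add: scaleR_diff_right)
  also have "\<dots> = D - m0 *\<^sub>R c"
    using i0 i1 by (subst Bochner_Integration.integral_diff) (auto simp: D_def m0_def)
  also have "\<dots> = 0" using m0 by (simp add: c_def)
  finally have centred: "(\<integral>y. - lin_trace (H (c + y)) *\<^sub>R y \<partial>lborel) = 0" .
  obtain b :: 'a where b: "b \<in> Basis" using nonempty_Basis by blast
  show ?thesis
    unfolding radially_symmetric_def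
  proof (intro exI allI)
    fix x
    have "w (c + (x - c)) = w (c + norm (x - c) *\<^sub>R b)"
      by (rule T.radial_centred[OF centred]) (use b in simp)
    then show "w x = (\<lambda>r. w (c + r *\<^sub>R b)) (norm (x - c))" by simp
  qed
qed

end

section \<open>Passage from the potential \<open>W\<close> to the inequalities for b - u\<close>

lemma hoelder_continuous_on_bounded:
  fixes f :: "real \<Rightarrow> real"
  assumes "hoelder_continuous_on {l..u} f"
  obtains B where "B \<ge> 0" "\<And>t. t \<in> {l..u} \<Longrightarrow> \<bar>f t\<bar> \<le> B"
proof -
  obtain \<alpha> C where C: "0 < \<alpha>" "\<And>x y. x \<in> {l..u} \<Longrightarrow> y \<in> {l..u} \<Longrightarrow> dist (f x) (f y) \<le> C * dist x y powr \<alpha>"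
    using assms unfolding hoelder_continuous_on_def by blast
  have "\<bar>f t\<bar> \<le> \<bar>f u\<bar> + \<bar>C\<bar> * (u - l) powr \<alpha>" if t: "t \<in> {l..u}" for t
  proof -
    have "dist (f t) (f u) \<le> C * dist t u powr \<alpha>" using C(2)[of t u] t by auto
    also have "\<dots> \<le> \<bar>C\<bar> * (u - l) powr \<alpha>"
      using t C(1) by (intro mult_mono powr_mono2) (auto simp: dist_real_def)
    finally show ?thesis by (simp add: dist_real_def)
  qed
  then show ?thesis by (intro that[of "\<bar>f u\<bar> + \<bar>C\<bar> * (u - l) powr \<alpha>"]) auto
qed

lemma C2_deriv_lipschitz:
  fixes W :: "real \<Rightarrow> real"
  assumes "C2 W"
  obtains K where "K \<ge> 0" "\<And>s t. s \<in> {l..u} \<Longrightarrow> t \<in> {l..u} \<Longrightarrow> \<bar>deriv W s - deriv W t\<bar> \<le> K * \<bar>s - t\<bar>"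
proof -
  have d: "(deriv W has_real_derivative deriv (deriv W) t) (at t)" for t
    using assms unfolding C2_real_iff differentiable_on_def
    by (auto simp: DERIV_deriv_iff_real_differentiable)
  have "continuous_on {l..u} (deriv (deriv W))"
    using assms unfolding C2_real_iff by (auto intro: continuous_on_subset)
  then have "bounded (deriv (deriv W) ` {l..u})"
    by (intro compact_imp_bounded compact_continuous_image) auto
  then obtain K where K: "\<And>t. t \<in> {l..u} \<Longrightarrow> \<bar>deriv (deriv W) t\<bar> \<le> K"
    unfolding bounded_iff by (metis imageI real_norm_def)
  have "\<bar>deriv W s - deriv W t\<bar> \<le> \<bar>K\<bar> * \<bar>s - t\<bar>" if "s \<in> {l..u}" "t \<in> {l..u}" for s t
    using field_differentiable_bound[of "{l..u}" "deriv W" "deriv (deriv W)" "\<bar>K\<bar>" s t] d K that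
    by (force intro: DERIV_subset)
  then show ?thesis by (intro that[of "\<bar>K\<bar>"]) auto
qed

lemma tendsto_at_infinity_bounded_below:
  fixes u :: "'a::euclidean_space \<Rightarrow> real"
  assumes "continuous_on UNIV u" "(u \<longlongrightarrow> b) at_infinity"
  obtains l where "\<And>x. l \<le> u x"
proof -
  obtain r where r: "\<And>x. norm x \<ge> r \<Longrightarrow> b - 1 < u x"
    using order_tendstoD(1)[OF assms(2), of "b - 1"] by (auto simp: eventually_at_infinity)
  have "bounded (u ` cball 0 r)"
    by (intro compact_imp_bounded compact_continuous_image continuous_on_subset[OF assms(1)]) auto
  then obtain B where B: "\<And>x. norm x \<le> r \<Longrightarrow> \<bar>u x\<bar> \<le> B"
    unfolding bounded_iff by (metis imageI mem_cball_0 real_norm_def)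
  have "min (- B) (b - 1) \<le> u x" for x
    using r[of x] B[of x] by (cases "norm x \<le> r") auto
  then show ?thesis by (rule that)
qed

theorem proposition1p8:
  fixes a b \<delta> p :: real
    and W :: "real \<Rightarrow> real"
    and u :: "real ^ 'n \<Rightarrow> real"
  assumes "CARD('n) \<ge> 3"
    and "a < b"
    and "C2 W"
    and "deriv W a = 0" and "deriv W b = 0"
    and "\<forall>t\<in>{a<..<b}. deriv W t < 0"
    and "\<delta> > 0"
    and "p \<ge> (real CARD('n) + 2) / (real CARD('n) - 2)"
    and "\<exists>g :: real \<Rightarrow> real. hoelder_continuous_on {b - \<delta>..b} g
           \<and> (\<forall>t\<in>{b - \<delta>..<b}. g t = deriv W t / \<bar>t - b\<bar> powr p)"
    and "C2 u"
    and "\<forall>x. laplacian u x = deriv W (u x)"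
    and "\<forall>x. u x < b"
    and "(u \<longlongrightarrow> b) at_infinity"
  shows "radially_symmetric u"
proof -
  obtain gu Hu where hu: "has_hessian u gu Hu UNIV" "\<And>x. laplacian u x = lin_trace (Hu x)"
    "\<And>i. i \<in> Basis \<Longrightarrow> continuous_on UNIV (\<lambda>x. Hu x i \<bullet> i)"
    using C2_has_hessian[OF \<open>C2 u\<close>] by blast
  \<comment> \<open>Having a finite limit at infinity, u is bounded below, so its range lies in a
    compact interval on which \<open>deriv W\<close> is Lipschitz; this supplies the constant
    K.\<close>
  obtain l where l: "\<And>x. l \<le> u x"
    using tendsto_at_infinity_bounded_below[OF has_hessian_continuous_on[OF hu(1)] assms(13)] by blast
  obtain K where K: "K \<ge> 0" "\<And>s t. s \<in> {l..b} \<Longrightarrow> t \<in> {l..b} \<Longrightarrow> \<bar>deriv W s - deriv W t\<bar> \<le> K * \<bar>s - t\<bar>"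
    using C2_deriv_lipschitz[OF \<open>C2 W\<close>] by blast
  obtain f where f: "hoelder_continuous_on {b - \<delta>..b} f"
    "\<And>t. t \<in> {b - \<delta>..<b} \<Longrightarrow> f t = deriv W t / \<bar>t - b\<bar> powr p"
    using assms(9) by blast
  obtain G where G: "G \<ge> 0" "\<And>t. t \<in> {b - \<delta>..b} \<Longrightarrow> \<bar>f t\<bar> \<le> G"
    using hoelder_continuous_on_bounded[OF f(1)] by blast
  \<comment> \<open>Outside this ball u takes values in (a, b), where \<open>deriv W\<close> is
    negative, so w = b - u is strictly subharmonic there.\<close>
  obtain R where R: "\<And>x. norm x \<ge> R \<Longrightarrow> a < u x"
    using order_tendstoD(1)[OF assms(13) \<open>a < b\<close>] by (auto simp: eventually_at_infinity)
  define q where "q = (real DIM(real ^ 'n) - 2) / 2"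
  have card: "real CARD('n) = 2 * q + 2" by (simp add: q_def diff_divide_distrib)
  have q0: "q > 0" using assms(1) by (simp add: q_def)
  define w where "w x = b - u x" for x
  \<comment> \<open>The differences from 0 are the form that \<open>has_hessian_diff\<close>
    produces for a constant minus u.\<close>
  have tr: "lin_trace (\<lambda>h. 0 - Hu x h) = - deriv W (u x)" for x
    using hu(2)[of x] assms(11) by (simp add: lin_trace_diff lin_trace_zero del: diff_0)
  interpret decaying_solution w "\<lambda>x. 0 - gu x" "\<lambda>x h. 0 - Hu x h" q p \<delta> G K R
  proof
    show "DIM(real ^ 'n) \<ge> 3" using assms(1) by simp
    show "q = (real DIM(real ^ 'n) - 2) / 2" by (rule q_def)
    show "has_hessian w (\<lambda>x. 0 - gu x) (\<lambda>x h. 0 - Hu x h) UNIV"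
      unfolding w_def by (rule has_hessian_diff[OF has_hessian_const hu(1)])
    show "continuous_on UNIV (\<lambda>x. (0 - Hu x i) \<bullet> i)" if "i \<in> Basis" for i
      using hu(3)[OF that] by (simp add: continuous_on_minus)
    show "0 < w x" for x using assms(12) by (simp add: w_def)
    show "(w \<longlongrightarrow> 0) at_infinity"
      unfolding w_def using tendsto_diff[OF tendsto_const assms(13), of b] by simp
    show "0 \<le> K" "0 < \<delta>" "0 \<le> G" by fact+
    show "\<bar>lin_trace (\<lambda>h. 0 - Hu x h) - lin_trace (\<lambda>h. 0 - Hu y h)\<bar> \<le> K * \<bar>w x - w y\<bar>" for x y
      using K(2)[of "u x" "u y"] l assms(12) unfolding tr by (simp add: w_def abs_minus_commute less_imp_le)
    show "0 < lin_trace (\<lambda>h. 0 - Hu x h)" if "R < norm x" for x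
      using R[of x] that assms(6,12) unfolding tr by simp
    show "(q + 2) / q \<le> p"
      using assms(8) q0 unfolding card by (simp add: field_simps)
    show "\<bar>lin_trace (\<lambda>h. 0 - Hu x h)\<bar> \<le> G * w x powr p" if "w x < \<delta>" for x
    proof -
      have t: "u x \<in> {b - \<delta>..<b}" using that assms(12) by (simp add: w_def)
      have "\<bar>u x - b\<bar> powr p > 0" using t by simp
      then have "deriv W (u x) = f (u x) * \<bar>u x - b\<bar> powr p" using f(2)[OF t] by simp
      then have "\<bar>deriv W (u x)\<bar> = \<bar>f (u x)\<bar> * w x powr p" using t by (simp add: abs_mult w_def)
      then show ?thesis unfolding tr using G(2)[of "u x"] t by (simp add: mult_right_mono)
    qed
  qed
  obtain c v where v: "\<And>x. w x = v (norm (x - c))"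
    using radially_symmetric_solution by (auto simp: radially_symmetric_def)
  have "u x = b - v (norm (x - c))" for x using v[of x] by (simp add: w_def)
  then show ?thesis unfolding radially_symmetric_def by (intro exI[of _ c] exI[of _ "\<lambda>r. b - v r"]) blast
qed

end
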